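(* Let $0<s<1$ and $n\ge2$. Let $\Omega\subset\mathbb R^n$ be bounded and open, set $\Omega_e=\mathbb R^n\setminus\overline\Omega$, and let $G$ be the unbounded connected component of $\Omega_e$. Let $W_1,W_2\Subset G$ be nonempty open sets satisfying $\overline W_1\cap\overline W_2=\emptyset$. Let $a_1,a_2\in C^\omega(\mathbb S^{n-1})$ be real analytic elliptic angular densities. If $$\Lambda_{a_1}^{W_1,W_2}f=\Lambda_{a_2}^{W_1,W_2}f\quad\text{for all } f\in\widetilde H^s(W_1),$$ then $a_1=a_2$ on $\mathbb S^{n-1}$.
   Context: Functions are complex-valued unless stated otherwise; $W\Subset G$ means that $\overline W$ is compact and contained in $G$. The Fourier transform is $\widehat u(\xi)=(2\pi)^{-n/2}\int_{\mathbb R^n}e^{-\mathrm i x\cdot\xi}u(x)\,dx$, and $H^t(\mathbb R^n)$ is the $L^2$-based Sobolev space with norm $\|(1+|\xi|^2)^{t/2}\widehat u\|_{L^2(\mathbb R^n)}$. For $U\subset\mathbb R^n$ open, $\widetilde H^t(U)$ is the closure of $C_c^\infty(U)$ in $H^t(\mathbb R^n)$ (elements are identified with their zero extensions), and for $t\ge0$, $H^{-t}(U)=(\widetilde H^t(U))^*$, with pairing $\langle F,v\rangle$ linear in $F\in H^{-t}(U)$ and conjugate-linear in $v\in\widetilde H^t(U)$. For a real-valued even function $a\in L^1(\mathbb S^{n-1})$, set $K_a(z)=a(z/|z|)\,|z|^{-n-2s}$ for $z\ne0$, $$\mathcal E_a(u,v)=\frac12\iint_{\mathbb R^n\times\mathbb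 R^n}(u(x)-u(y))\overline{(v(x)-v(y))}\,K_a(x-y)\,dx\,dy,$$ and $$A_a(\xi)=c_{n,s}\int_{\mathbb S^{n-1}}|\xi\cdot\theta|^{2s}a(\theta)\,d\theta,\qquad c_{n,s}=\int_0^\infty\frac{1-\cos\rho}{\rho^{1+2s}}\,d\rho .$$ Ellipticity: there are constants $0<\lambda\le\Lambda<\infty$ with $\lambda|\xi|^{2s}\le A_a(\xi)\le\Lambda|\xi|^{2s}$ for all $\xi\in\mathbb R^n$. Under ellipticity $\mathcal E_a$ (defined on Schwartz functions) extends to a bounded sesquilinear form on $H^s(\mathbb R^n)\times H^s(\mathbb R^n)$, namely $\int A_a\,\widehat u\,\overline{\widehat v}\,d\xi$. A real analytic elliptic angular density is a real-valued, even, nonnegative, real analytic function $a\in C^\omega(\mathbb S^{n-1})$ whose symbol $A_a$ satisfies ellipticity. For $f\in\widetilde H^s(W_1)$, $u_f\in H^s(\mathbb R^n)$ is the unique function with $u_f-f\in\widetilde H^s(\Omega)$ and $\mathcal E_a(u_f,\phi)=0$ for all $\phi\in\widetilde H^s(\Omega)$ (the weak solution of $L_au_f=0$ in $\Omega$, $u_f=f$ in $\Omega_e$, where $L_au(x)=\mathrm{P.V.}\int(u(x)-u(y))K_a(x-y)\,dy$). The restricted exterior Dirichlet-to-Neumann map $\Lambda_a^{W_1,W_2}:\widetilde H^s(W_1)\to H^{-s}(W_2)$ is defined by $\langle\Lambda_a^{W_1,W_2}f,g\rangle=\mathcal E_a(u_f,g)$ for $g\in\widetilde H^s(W_2)$.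 *)

theory Defs
  imports "HOL-Analysis.Analysis"
begin

text \<open>
  Members of function spaces are represented by Borel measurable functions on the whole space;
  such a function stands for its class modulo equality almost everywhere.
\<close>

primrec C_k :: "nat \<Rightarrow> (real ^ 'n \<Rightarrow> complex) \<Rightarrow> bool" where
  "C_k 0 f \<longleftrightarrow> continuous_on UNIV f"
| "C_k (Suc k) f \<longleftrightarrow> f differentiable_on UNIV \<and>
     (\<forall>i. C_k k (\<lambda>x. frechet_derivative f (at x) (axis i 1)))"

definition test_functions :: "(real ^ 'n) set \<Rightarrow> (real ^ 'n \<Rightarrow> complex) set" where
  "test_functions U = {\<phi>. (\<forall>k. C_k k \<phi>) \<and>
     compact (closure {x. \<phi> x \<noteq> 0}) \<and> closure {x. \<phi> x \<noteq> 0} \<subseteq> U}"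

definition L2 :: "(real ^ 'n \<Rightarrow> complex) set" where
  "L2 = {u \<in> borel_measurable lborel. integrable lborel (\<lambda>x. (norm (u x))\<^sup>2)}"

definition fourier_integral :: "(real ^ 'n \<Rightarrow> complex) \<Rightarrow> real ^ 'n \<Rightarrow> complex" where
  "fourier_integral u \<xi> = (2 * pi) powr (- (real CARD('n) / 2)) *\<^sub>R
     (LINT x|lborel. exp (- (\<i> * complex_of_real (x \<bullet> \<xi>))) * u x)"

text \<open>
  The Fourier integral need not converge for square integrable \<open>u\<close>, so the transform is the
  \<open>L\<^sup>2\<close> limit of the Fourier integrals of the truncations of \<open>u\<close> to balls (Plancherel). The
  choice operator only selects a representative modulo equality almost everywhere.
\<close>

definition has_fourier :: "(real ^ 'n \<Rightarrow> complex) \<Rightarrow> (real ^ 'n \<Rightarrow> complex) \<Rightarrow> bool" where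
  "has_fourier u U \<longleftrightarrow> U \<in> L2 \<and>
     ((\<lambda>R. \<integral>\<^sup>+ \<xi>. ennreal ((norm (fourier_integral (\<lambda>x. indicator (ball 0 R) x *\<^sub>R u x) \<xi> - U \<xi>))\<^sup>2)
        \<partial>lborel) \<longlongrightarrow> 0) (at_top :: real filter)"

definition fourier :: "(real ^ 'n \<Rightarrow> complex) \<Rightarrow> real ^ 'n \<Rightarrow> complex" where
  "fourier u = (SOME U. has_fourier u U)"

text \<open>The next three notions are meant for \<open>t \<ge> 0\<close>, where \<open>H\<^sup>t\<close> is contained in \<open>L\<^sup>2\<close>.\<close>

definition sobolev :: "real \<Rightarrow> (real ^ 'n \<Rightarrow> complex) set" where
  "sobolev t = {u \<in> L2. (\<lambda>\<xi>. (1 + (norm \<xi>)\<^sup>2) powr (t / 2) *\<^sub>R fourier u \<xi>) \<in> L2}"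

definition sobolev_norm :: "real \<Rightarrow> (real ^ 'n \<Rightarrow> complex) \<Rightarrow> real" where
  "sobolev_norm t u =
     sqrt (LINT \<xi>|lborel. (norm ((1 + (norm \<xi>)\<^sup>2) powr (t / 2) *\<^sub>R fourier u \<xi>))\<^sup>2)"

definition sobolev_tilde :: "real \<Rightarrow> (real ^ 'n) set \<Rightarrow> (real ^ 'n \<Rightarrow> complex) set" where
  "sobolev_tilde t U = {u \<in> sobolev t.
     \<forall>\<epsilon>>0. \<exists>\<phi>\<in>test_functions U. sobolev_norm t (\<lambda>x. u x - \<phi> x) < \<epsilon>}"

text \<open>
  Functions on the unit sphere are represented by functions on the whole space of which only the
  values on \<open>sphere 0 1\<close> are used. The surface measure of a Borel set \<open>A\<close> in the unit sphere
  is \<open>n\<close> times the volume of the cone \<open>{r *\<^sub>R \<theta> | r \<theta>. 0 < r < 1 \<and> \<theta> \<in> A}\<close>.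
\<close>

definition sphere_measure :: "(real ^ 'n) measure" where
  "sphere_measure = scale_measure (of_nat CARD('n))
     (distr (restrict_space lborel (ball 0 1 - {0})) (restrict_space borel (sphere 0 1))
       (\<lambda>x. x /\<^sub>R norm x))"

text \<open>
  Real analyticity at a point: expansion in an absolutely convergent power series on a ball;
  the multi-indices are the functions \<open>\<alpha> :: 'n \<Rightarrow> nat\<close>.
\<close>

definition real_analytic_at :: "(real ^ 'n \<Rightarrow> real) \<Rightarrow> real ^ 'n \<Rightarrow> bool" where
  "real_analytic_at F x0 \<longleftrightarrow> (\<exists>r>0. \<exists>c :: ('n \<Rightarrow> nat) \<Rightarrow> real. \<forall>x\<in>ball x0 r.
     ((\<lambda>\<alpha>. c \<alpha> * (\<Prod>i\<in>UNIV. ((x - x0) $ i) ^ \<alpha> i)) has_sum F x) UNIV)"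

text \<open>
  Real analyticity on the sphere as an embedded analytic submanifold: near each of its points the
  function extends to a real analytic function on an open subset of the ambient space.
\<close>

definition real_analytic_on_sphere :: "(real ^ 'n \<Rightarrow> real) \<Rightarrow> bool" where
  "real_analytic_on_sphere a \<longleftrightarrow> (\<forall>\<theta>\<in>sphere 0 1. \<exists>V F. open V \<and> \<theta> \<in> V \<and>
     (\<forall>x\<in>V. real_analytic_at F x) \<and> (\<forall>x\<in>V \<inter> sphere 0 1. F x = a x))"

definition symbol_const :: "real \<Rightarrow> real" where
  "symbol_const s = (LINT \<rho>:{0<..}|lborel. (1 - cos \<rho>) / \<rho> powr (1 + 2 * s))"

definition symbol :: "real \<Rightarrow> (real ^ 'n \<Rightarrow> real) \<Rightarrow> real ^ 'n \<Rightarrow> real" where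
  "symbol s a \<xi> = symbol_const s * (LINT \<theta>|sphere_measure. \<bar>\<xi> \<bullet> \<theta>\<bar> powr (2 * s) * a \<theta>)"

definition elliptic :: "real \<Rightarrow> (real ^ 'n \<Rightarrow> real) \<Rightarrow> bool" where
  "elliptic s a \<longleftrightarrow> (\<exists>l L. 0 < l \<and> l \<le> L \<and>
     (\<forall>\<xi>. l * norm \<xi> powr (2 * s) \<le> symbol s a \<xi> \<and> symbol s a \<xi> \<le> L * norm \<xi> powr (2 * s)))"

definition analytic_elliptic_density :: "real \<Rightarrow> (real ^ 'n \<Rightarrow> real) \<Rightarrow> bool" where
  "analytic_elliptic_density s a \<longleftrightarrow>
     (\<forall>\<theta>\<in>sphere 0 1. a (- \<theta>) = a \<theta>) \<and> (\<forall>\<theta>\<in>sphere 0 1. 0 \<le> a \<theta>) \<and>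
     real_analytic_on_sphere a \<and> elliptic s a"

text \<open>The value at \<open>z = 0\<close> is \<open>0\<close>, because \<open>0 powr p = 0\<close>.\<close>

definition kernel :: "real \<Rightarrow> (real ^ 'n \<Rightarrow> real) \<Rightarrow> real ^ 'n \<Rightarrow> real" where
  "kernel s a z = a (z /\<^sub>R norm z) * norm z powr (- (real CARD('n) + 2 * s))"

text \<open>
  For a nonnegative elliptic density the double integral is absolutely convergent for all \<open>u\<close> and
  \<open>v\<close> in \<open>sobolev s\<close>: by Tonelli and Plancherel the integral for \<open>u = v\<close> is the integral of
  \<open>symbol s a \<xi> * (norm (fourier u \<xi>))\<^sup>2\<close>, and the Cauchy-Schwarz inequality gives the rest. So the
  formula itself is the bounded extension of the form from Schwartz functions to \<open>sobolev s\<close>.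
\<close>

definition energy ::
    "real \<Rightarrow> (real ^ 'n \<Rightarrow> real) \<Rightarrow> (real ^ 'n \<Rightarrow> complex) \<Rightarrow> (real ^ 'n \<Rightarrow> complex) \<Rightarrow> complex" where
  "energy s a u v = (1 / 2) *
     (LINT (x, y)|(lborel \<Otimes>\<^sub>M lborel). (u x - u y) * cnj (v x - v y) * complex_of_real (kernel s a (x - y)))"

definition weak_solution ::
    "real \<Rightarrow> (real ^ 'n \<Rightarrow> real) \<Rightarrow> (real ^ 'n) set \<Rightarrow> (real ^ 'n \<Rightarrow> complex) \<Rightarrow> (real ^ 'n \<Rightarrow> complex) \<Rightarrow> bool" where
  "weak_solution s a \<Omega> f u \<longleftrightarrow> u \<in> sobolev s \<and> (\<lambda>x. u x - f x) \<in> sobolev_tilde s \<Omega> \<and>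
     (\<forall>\<phi>\<in>sobolev_tilde s \<Omega>. energy s a u \<phi> = 0)"

text \<open>
  The weak solution is unique modulo equality almost everywhere, which does not affect the energy
  form; the choice operator picks a representative.
\<close>

definition solution ::
    "real \<Rightarrow> (real ^ 'n \<Rightarrow> real) \<Rightarrow> (real ^ 'n) set \<Rightarrow> (real ^ 'n \<Rightarrow> complex) \<Rightarrow> real ^ 'n \<Rightarrow> complex" where
  "solution s a \<Omega> f = (SOME u. weak_solution s a \<Omega> f u)"

text \<open>
  An element of the dual \<open>H\<^sup>-\<^sup>s(W2)\<close> of \<open>sobolev_tilde s W2\<close> is a functional on that set; \<open>restrict\<close>
  makes equality of such functionals plain equality of functions.
\<close>

definition DN_map ::
    "real \<Rightarrow> (real ^ 'n \<Rightarrow> real) \<Rightarrow> (real ^ 'n) set \<Rightarrow> (real ^ 'n) set \<Rightarrow> (real ^ 'n) set \<Rightarrow>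
     (real ^ 'n \<Rightarrow> complex) \<Rightarrow> (real ^ 'n \<Rightarrow> complex) \<Rightarrow> complex" where
  "DN_map s a \<Omega> W1 W2 =
     (\<lambda>f\<in>sobolev_tilde s W1. \<lambda>g\<in>sobolev_tilde s W2. energy s a (solution s a \<Omega> f) g)"

definition compactly_contained :: "(real ^ 'n) set \<Rightarrow> (real ^ 'n) set \<Rightarrow> bool" where
  "compactly_contained W G \<longleftrightarrow> compact (closure W) \<and> closure W \<subseteq> G"

end

theory Submission
  imports Defs "HOL-Probability.Probability" "HOL-Complex_Analysis.Complex_Analysis"
begin

text \<open>
  The proof looks at weak solutions from outside of their support. If \<open>u\<close> is integrable and \<open>g\<close> has support at a
  positive distance from that of \<open>u\<close>, then \<open>energy s a u g\<close> is minus the integral of \<open>cnj g\<close> against the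
  potential \<open>y \<mapsto> \<integral> kernel s a (y - x) * u x dx\<close> (\<open>energy_disjoint_supports\<close>). Since \<open>a\<close> is analytic, the
  kernel is analytic away from \<open>0\<close>, and the potential is analytic off the support of \<open>u\<close>
  (\<open>kernel_potential_line_analytic\<close>).

  Fix \<open>x0 \<in> W1\<close> and take as exterior datum a smooth bump \<open>f\<close> of mass \<open>1\<close> in a small ball around \<open>x0\<close>. The
  solutions for the two densities are \<open>f + v1\<close> and \<open>f + v2\<close>, with corrections that vanish off \<open>\<Omega>\<close>. Equality
  of the Dirichlet-to-Neumann maps says that their potentials agree on \<open>W2\<close> (\<open>energy_determines_potential\<close>). Both are
  analytic on \<open>G\<close> minus the ball, which is connected since the dimension is at least \<open>2\<close>, so they agree up to
  the ball (\<open>line_analytic_identity\<close>).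

  Now let the bump shrink. The \<open>L\<^sup>1\<close> norms of the corrections stay bounded (\<open>correction_L1_bound\<close>): tested with
  itself, the equation bounds the energy of \<open>v1\<close> by the \<open>L\<^sup>1\<close> norm of \<open>v1\<close>, as the potential of \<open>f\<close> is bounded on
  \<open>\<Omega>\<close>, and the energy controls the square of that norm by the Poincare inequality. The potentials of the
  corrections are therefore bounded near \<open>x0\<close>, while that of \<open>f\<close> tends to the kernel at \<open>y - x0\<close>. Hence
  \<open>kernel s a1 (y - x0) - kernel s a2 (y - x0)\<close> is bounded for \<open>y\<close> near \<open>x0\<close>. It equals
  \<open>(a1 \<theta> - a2 \<theta>) * r powr - (n + 2 * s)\<close> at \<open>y = x0 + r *\<^sub>R \<theta>\<close>, and \<open>r \<rightarrow> 0\<close> gives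
  \<open>a1 \<theta> = a2 \<theta>\<close>.

  The analytic foundation is the coercivity of the energy form. Plancherel in the variable \<open>y\<close> for each increment
  \<open>u (y + h) - u y\<close> expresses the energy through the integral of
  \<open>kernel s a h * (norm (exp (\<i> h \<bullet> \<xi>) - 1))\<^sup>2\<close> over \<open>h\<close>, which by polar coordinates is twice the symbol
  (\<open>energy_identity\<close>, \<open>kernel_multiplier\<close>). Ellipticity then yields the Poincare inequality and, by
  minimizing the energy, the existence of weak solutions (\<open>Poincare\<close>, \<open>weak_form_solvable\<close>), without which
  the value of \<open>solution\<close> would carry no information.
\<close>

section \<open>Square integrable functions on a measure space\<close>

lemma borel_measurable_cnj [measurable (raw)]:
  "f \<in> borel_measurable M \<Longrightarrow> (\<lambda>x. cnj (f x)) \<in> borel_measurable M"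
  by (rule borel_measurable_continuous_on[where f = cnj]) (auto intro: continuous_intros)

definition L2_on :: "'a measure \<Rightarrow> ('a \<Rightarrow> complex) set" where
  "L2_on M = {f \<in> borel_measurable M. integrable M (\<lambda>x. (norm (f x))\<^sup>2)}"

text \<open>
  The norm is used in squared form: it then is an integral of the given functions, and the bound
  \<open>\<parallel>f + g\<parallel>\<^sup>2 \<le> 2 \<parallel>f\<parallel>\<^sup>2 + 2 \<parallel>g\<parallel>\<^sup>2\<close> replaces the triangle inequality in limit arguments.
\<close>

definition norm2_on :: "'a measure \<Rightarrow> ('a \<Rightarrow> complex) \<Rightarrow> real" where
  "norm2_on M f = (LINT x|M. (norm (f x))\<^sup>2)"

definition inner_on :: "'a measure \<Rightarrow> ('a \<Rightarrow> complex) \<Rightarrow> ('a \<Rightarrow> complex) \<Rightarrow> complex" where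
  "inner_on M f g = (LINT x|M. f x * cnj (g x))"

lemma L2_onD [measurable_dest]: "f \<in> L2_on M \<Longrightarrow> f \<in> borel_measurable M"
  by (simp add: L2_on_def)

lemma L2_on_integrable: "f \<in> L2_on M \<Longrightarrow> integrable M (\<lambda>x. (norm (f x))\<^sup>2)"
  by (simp add: L2_on_def)

lemma L2_on_iff_nn:
  "f \<in> L2_on M \<longleftrightarrow> f \<in> borel_measurable M \<and> (\<integral>\<^sup>+x. ennreal ((norm (f x))\<^sup>2) \<partial>M) < \<infinity>"
  by (auto simp: L2_on_def integrable_iff_bounded)

lemma nn_norm2_on: "f \<in> L2_on M \<Longrightarrow> (\<integral>\<^sup>+x. ennreal ((norm (f x))\<^sup>2) \<partial>M) = ennreal (norm2_on M f)"
  unfolding norm2_on_def by (intro nn_integral_eq_integral L2_on_integrable) auto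

lemma norm2_on_nonneg [simp]: "norm2_on M f \<ge> 0"
  unfolding norm2_on_def by simp

lemma norm_add_sq_le: "(norm (a + b))\<^sup>2 \<le> 2 * (norm a)\<^sup>2 + 2 * (norm (b :: complex))\<^sup>2"
proof -
  have "(norm (a + b))\<^sup>2 \<le> (norm a + norm b)\<^sup>2"
    by (intro power_mono norm_triangle_ineq) auto
  also have "\<dots> \<le> 2 * (norm a)\<^sup>2 + 2 * (norm b)\<^sup>2"
    using sum_squares_bound[of "norm a" "norm b"] by (simp add: power2_sum)
  finally show ?thesis .
qed

lemma L2_on_scale: "f \<in> L2_on M \<Longrightarrow> (\<lambda>x. c * f x) \<in> L2_on M"
  by (auto simp: L2_on_def norm_mult power_mult_distrib)

lemma L2_on_add:
  assumes "f \<in> L2_on M" "g \<in> L2_on M" shows "(\<lambda>x. f x + g x) \<in> L2_on M"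
proof -
  have "integrable M (\<lambda>x. (norm (f x + g x))\<^sup>2)"
  proof (rule Bochner_Integration.integrable_bound)
    show "integrable M (\<lambda>x. 2 * (norm (f x))\<^sup>2 + 2 * (norm (g x))\<^sup>2)"
      using assms by (auto simp: L2_on_def)
  qed (use assms norm_add_sq_le in \<open>auto simp: L2_on_def\<close>)
  then show ?thesis using assms by (auto simp: L2_on_def)
qed

lemma L2_on_diff:
  assumes "f \<in> L2_on M" "g \<in> L2_on M" shows "(\<lambda>x. f x - g x) \<in> L2_on M"
  using L2_on_add[OF assms(1) L2_on_scale[OF assms(2), of "-1"]] by simp

lemma L2_on_zero [simp]: "(\<lambda>x. 0) \<in> L2_on M"
  by (auto simp: L2_on_def)

lemma norm2_on_add_le:
  assumes "f \<in> L2_on M" "g \<in> L2_on M"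
  shows "norm2_on M (\<lambda>x. f x + g x) \<le> 2 * norm2_on M f + 2 * norm2_on M g"
proof -
  have "norm2_on M (\<lambda>x. f x + g x) \<le> (LINT x|M. 2 * (norm (f x))\<^sup>2 + 2 * (norm (g x))\<^sup>2)"
    unfolding norm2_on_def using L2_on_add[OF assms] assms norm_add_sq_le
    by (intro integral_mono) (auto simp: L2_on_def)
  also have "\<dots> = 2 * norm2_on M f + 2 * norm2_on M g"
    unfolding norm2_on_def using assms by (subst Bochner_Integration.integral_add) (auto simp: L2_on_def)
  finally show ?thesis .
qed

lemma norm2_on_scale: "norm2_on M (\<lambda>x. c * f x) = (norm c)\<^sup>2 * norm2_on M f"
  by (simp add: norm2_on_def norm_mult power_mult_distrib)

lemma norm2_on_diff_le:
  assumes "f \<in> L2_on M" "g \<in> L2_on M"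
  shows "norm2_on M (\<lambda>x. f x - g x) \<le> 2 * norm2_on M f + 2 * norm2_on M g"
  using norm2_on_add_le[OF assms(1) L2_on_scale[OF assms(2), of "-1"]] norm2_on_scale[of M "-1" g] by simp

lemma norm2_on_commute: "norm2_on M (\<lambda>x. f x - g x) = norm2_on M (\<lambda>x. g x - f x)"
  by (simp add: norm2_on_def norm_minus_commute)

lemma norm2_on_triangle:
  assumes "f \<in> L2_on M" "g \<in> L2_on M" "h \<in> L2_on M"
  shows "norm2_on M (\<lambda>x. f x - h x) \<le> 2 * norm2_on M (\<lambda>x. f x - g x) + 2 * norm2_on M (\<lambda>x. g x - h x)"
  using norm2_on_add_le[OF L2_on_diff[OF assms(1,2)] L2_on_diff[OF assms(2,3)]] by simp

lemma inner_on_integrable: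
  assumes "f \<in> L2_on M" "g \<in> L2_on M" shows "integrable M (\<lambda>x. f x * cnj (g x))"
proof (rule Bochner_Integration.integrable_bound)
  show "integrable M (\<lambda>x. (norm (f x))\<^sup>2 + (norm (g x))\<^sup>2)"
    using assms by (auto simp: L2_on_def)
  have "norm (f x) * norm (g x) \<le> (norm (f x))\<^sup>2 + (norm (g x))\<^sup>2" for x
    using sum_squares_bound[of "norm (f x)" "norm (g x)"]
      mult_nonneg_nonneg[OF norm_ge_zero norm_ge_zero, of "f x" "g x"]
    unfolding mult.assoc by linarith
  then show "AE x in M. norm (f x * cnj (g x)) \<le> norm ((norm (f x))\<^sup>2 + (norm (g x))\<^sup>2)"
    by (auto simp: norm_mult)
qed (use assms in \<open>auto simp: L2_on_def\<close>)

lemma inner_on_add_left: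
  assumes "f \<in> L2_on M" "g \<in> L2_on M" "h \<in> L2_on M"
  shows "inner_on M (\<lambda>x. f x + g x) h = inner_on M f h + inner_on M g h"
  unfolding inner_on_def using inner_on_integrable[OF assms(1,3)] inner_on_integrable[OF assms(2,3)]
  by (simp add: ring_distribs)

lemma inner_on_diff_left:
  assumes "f \<in> L2_on M" "g \<in> L2_on M" "h \<in> L2_on M"
  shows "inner_on M (\<lambda>x. f x - g x) h = inner_on M f h - inner_on M g h"
  unfolding inner_on_def using inner_on_integrable[OF assms(1,3)] inner_on_integrable[OF assms(2,3)]
  by (simp add: ring_distribs)

lemma inner_on_add_right:
  assumes "f \<in> L2_on M" "g \<in> L2_on M" "h \<in> L2_on M"
  shows "inner_on M h (\<lambda>x. f x + g x) = inner_on M h f + inner_on M h g"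
  unfolding inner_on_def using inner_on_integrable[OF assms(3,1)] inner_on_integrable[OF assms(3,2)]
  by (simp add: ring_distribs)

lemma inner_on_diff_right:
  assumes "f \<in> L2_on M" "g \<in> L2_on M" "h \<in> L2_on M"
  shows "inner_on M h (\<lambda>x. f x - g x) = inner_on M h f - inner_on M h g"
  unfolding inner_on_def using inner_on_integrable[OF assms(3,1)] inner_on_integrable[OF assms(3,2)]
  by (simp add: ring_distribs)

lemma inner_on_scale_left: "inner_on M (\<lambda>x. c * f x) g = c * inner_on M f g"
  unfolding inner_on_def by (simp add: mult.assoc)

lemma inner_on_scale_right: "inner_on M f (\<lambda>x. c * g x) = cnj c * inner_on M f g"
proof -
  have "inner_on M f (\<lambda>x. c * g x) = (LINT x|M. cnj c * (f x * cnj (g x)))"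
    unfolding inner_on_def by (rule Bochner_Integration.integral_cong) auto
  then show ?thesis unfolding inner_on_def by simp
qed

lemma inner_on_commute: "inner_on M g f = cnj (inner_on M f g)"
  unfolding inner_on_def Bochner_Integration.integral_cnj[symmetric] by (simp add: mult.commute)

lemma inner_on_self: "inner_on M f f = complex_of_real (norm2_on M f)"
  unfolding inner_on_def norm2_on_def
  by (simp only: integral_complex_of_real[symmetric] complex_norm_square)

lemma norm2_on_add_scale:
  assumes "f \<in> L2_on M" "g \<in> L2_on M"
  shows "norm2_on M (\<lambda>x. f x + c * g x) =
    norm2_on M f + 2 * Re (cnj c * inner_on M f g) + (norm c)\<^sup>2 * norm2_on M g"
proof -
  have m: "(\<lambda>x. c * g x) \<in> L2_on M" using assms L2_on_scale by auto
  have a: "(\<lambda>x. f x + c * g x) \<in> L2_on M" using assms m L2_on_add by auto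
  define w where "w = inner_on M f g"
  have "inner_on M (\<lambda>x. f x + c * g x) (\<lambda>x. f x + c * g x) =
      inner_on M f f + cnj c * w + c * (cnj w + cnj c * inner_on M g g)"
    by (simp only: inner_on_add_left[OF assms(1) m a] inner_on_add_right[OF assms(1) m assms(1)]
        inner_on_add_right[OF assms(1) m assms(2)] inner_on_scale_left inner_on_scale_right
        inner_on_commute[of M g f] w_def)
  also have "\<dots> = of_real (norm2_on M f) + (cnj c * w + cnj (cnj c * w)) + (c * cnj c) * of_real (norm2_on M g)"
    unfolding inner_on_self by (simp add: ring_distribs)
  also have "\<dots> = of_real (norm2_on M f + 2 * Re (cnj c * w) + (norm c)\<^sup>2 * norm2_on M g)"
    unfolding complex_add_cnj complex_norm_square[symmetric] by simp
  finally show ?thesis unfolding inner_on_self of_real_eq_iff w_def .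
qed

text \<open>
  Discriminant argument: inserting \<open>c = - t * inner_on M f g\<close> for real \<open>t\<close> bounds a quadratic polynomial in
  \<open>t\<close> from below, and its minimum at \<open>t = 1 / \<parallel>g\<parallel>\<^sup>2\<close> is the claim. For \<open>d = 0\<close> this is the
  Cauchy-Schwarz inequality; for \<open>d\<close> the infimum of \<open>\<parallel>.\<parallel>\<^sup>2\<close> on an affine space it says that an almost
  minimal \<open>f\<close> is almost orthogonal to the directions \<open>g\<close> of that space.
\<close>

lemma almost_minimal_inner_le:
  assumes f: "f \<in> L2_on M" and g: "g \<in> L2_on M"
    and d: "\<And>c. d \<le> norm2_on M (\<lambda>x. f x + c * g x)"
  shows "(norm (inner_on M f g))\<^sup>2 \<le> (norm2_on M f - d) * norm2_on M g"
proof -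
  define w where "w = inner_on M f g"
  have key: "d \<le> norm2_on M f - 2 * t * (norm w)\<^sup>2 + t\<^sup>2 * (norm w)\<^sup>2 * norm2_on M g" for t :: real
  proof -
    have "Re (cnj (- of_real t * w) * w) = - t * (norm w)\<^sup>2"
      unfolding cmod_power2 by (simp add: power2_eq_square algebra_simps)
    then show ?thesis using d[of "- of_real t * w"] unfolding norm2_on_add_scale[OF f g] w_def[symmetric]
      by (simp add: norm_mult power_mult_distrib)
  qed
  have nn: "norm2_on M g \<ge> 0" by simp
  have d0: "d \<le> norm2_on M f" using key[of 0] by simp
  show ?thesis
  proof (cases "norm2_on M g = 0")
    case True
    have "(norm w)\<^sup>2 = 0"
    proof (rule ccontr)
      assume "(norm w)\<^sup>2 \<noteq> 0"
      (* Here the polynomial is affine in t, so a nonzero slope sends it below d for large t. *)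
      then show False using key[of "(norm2_on M f - d + 1) / (2 * (norm w)\<^sup>2)"] True
        by (simp add: field_simps)
    qed
    then show ?thesis using True w_def by simp
  next
    case False
    then have gp: "norm2_on M g > 0" using nn by linarith
    have "d \<le> norm2_on M f - 2 * (1 / norm2_on M g) * (norm w)\<^sup>2 + (1 / norm2_on M g)\<^sup>2 * (norm w)\<^sup>2 * norm2_on M g"
      by (rule key)
    also have "\<dots> = norm2_on M f - (norm w)\<^sup>2 / norm2_on M g"
      using gp by (simp add: field_simps power2_eq_square)
    finally have "(norm w)\<^sup>2 / norm2_on M g \<le> norm2_on M f - d" by simp
    then show ?thesis using gp by (simp add: field_simps w_def)
  qed
qed

lemma inner_on_Cauchy_Schwarz:
  assumes f: "f \<in> L2_on M" and g: "g \<in> L2_on M"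
  shows "(norm (inner_on M f g))\<^sup>2 \<le> norm2_on M f * norm2_on M g"
  using almost_minimal_inner_le[OF f g, of 0] by simp

lemma parallelogram_on:
  assumes f: "f \<in> L2_on M" and g: "g \<in> L2_on M"
  shows "norm2_on M (\<lambda>x. f x - g x) = 2 * norm2_on M f + 2 * norm2_on M g - norm2_on M (\<lambda>x. f x + g x)"
  using norm2_on_add_scale[OF f g, of 1] norm2_on_add_scale[OF f g, of "-1"] by simp

lemma tendsto_zero_squeeze:
  fixes f g :: "'a \<Rightarrow> real"
  assumes "(g \<longlongrightarrow> 0) F" "\<And>n. 0 \<le> f n" "\<And>n. f n \<le> g n" shows "(f \<longlongrightarrow> 0) F"
  by (rule tendsto_sandwich[OF _ _ tendsto_const assms(1)]) (use assms in auto)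
lemma inner_on_tendsto_right:
  assumes w: "w \<in> L2_on M" and g: "\<And>k. g k \<in> L2_on M" "h \<in> L2_on M"
    and lim: "(\<lambda>k. norm2_on M (\<lambda>x. h x - g k x)) \<longlonglongrightarrow> 0"
  shows "(\<lambda>k. inner_on M w (g k)) \<longlonglongrightarrow> inner_on M w h"
proof -
  have "(\<lambda>k. sqrt (norm2_on M w * norm2_on M (\<lambda>x. h x - g k x))) \<longlonglongrightarrow> sqrt (norm2_on M w * 0)" by (intro tendsto_intros lim)
  then have z: "(\<lambda>k. sqrt (norm2_on M w * norm2_on M (\<lambda>x. h x - g k x))) \<longlonglongrightarrow> 0" by simp
  have "(\<lambda>k. norm (inner_on M w (\<lambda>x. h x - g k x))) \<longlonglongrightarrow> 0"
  proof (rule tendsto_zero_squeeze[OF z])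
    show "norm (inner_on M w (\<lambda>x. h x - g k x)) \<le> sqrt (norm2_on M w * norm2_on M (\<lambda>x. h x - g k x))" for k
      by (rule real_le_rsqrt[OF inner_on_Cauchy_Schwarz[OF w L2_on_diff[OF g(2) g(1)]]])
  qed simp
  then have "(\<lambda>k. inner_on M w (\<lambda>x. h x - g k x)) \<longlonglongrightarrow> 0" by (simp add: tendsto_norm_zero_iff)
  then have "(\<lambda>k. inner_on M w h - inner_on M w (\<lambda>x. h x - g k x)) \<longlonglongrightarrow> inner_on M w h - 0" by (intro tendsto_intros)
  moreover have "inner_on M w h - inner_on M w (\<lambda>x. h x - g k x) = inner_on M w (g k)" for k
    using inner_on_diff_right[OF g(2) g(1)[of k] w] by simp
  ultimately show ?thesis by simp
qed
lemma norm2_on_tendsto: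
  assumes f: "\<And>k. f k \<in> L2_on M" and g: "g \<in> L2_on M" and z: "(\<lambda>k. norm2_on M (\<lambda>x. f k x - g x)) \<longlonglongrightarrow> 0"
  shows "(\<lambda>k. norm2_on M (f k)) \<longlonglongrightarrow> norm2_on M g"
proof -
  let ?D = "\<lambda>k. norm2_on M (\<lambda>x. f k x - g x)"
  have eq: "norm2_on M (f k) = ?D k + 2 * Re (inner_on M g (f k)) - norm2_on M g" for k
    using norm2_on_add_scale[OF g L2_on_diff[OF f g], of 1 k] inner_on_diff_right[OF f g g, of k]
    by (simp add: inner_on_self)
  have "(\<lambda>k. inner_on M g (f k)) \<longlonglongrightarrow> inner_on M g g"
    using z by (intro inner_on_tendsto_right f g) (simp add: norm2_on_commute)
  then have "(\<lambda>k. ?D k + 2 * Re (inner_on M g (f k)) - norm2_on M g) \<longlonglongrightarrow> 0 + 2 * Re (inner_on M g g) - norm2_on M g"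
    by (intro tendsto_intros z)
  then show ?thesis unfolding eq by (simp add: inner_on_self)
qed

definition L2_Cauchy :: "'a measure \<Rightarrow> (nat \<Rightarrow> 'a \<Rightarrow> complex) \<Rightarrow> bool" where
  "L2_Cauchy M f \<longleftrightarrow> (\<forall>e>0. \<exists>N. \<forall>k\<ge>N. \<forall>l\<ge>N. norm2_on M (\<lambda>x. f k x - f l x) < e)"

text \<open>
  Orthogonal projection onto a space that need not be complete, so that only an approximating sequence
  exists. Two almost minimizers of the distance have their midpoint in the same affine space, so the
  parallelogram law makes them close to each other; \<open>almost_minimal_inner_le\<close> makes the
  residuals almost orthogonal to \<open>V\<close>.
\<close>

lemma projection_sequence:
  assumes F: "F \<in> L2_on M" and V: "V \<subseteq> L2_on M" "(\<lambda>x. 0) \<in> V"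
    and add: "\<And>v w c. v \<in> V \<Longrightarrow> w \<in> V \<Longrightarrow> (\<lambda>x. v x + c * w x) \<in> V"
  shows "\<exists>v. (\<forall>k. v k \<in> V) \<and> L2_Cauchy M v \<and>
    (\<forall>w\<in>V. (\<lambda>k. inner_on M (\<lambda>x. F x + v k x) w) \<longlonglongrightarrow> 0)"
proof -
  define S where "S = (\<lambda>v. norm2_on M (\<lambda>x. F x + v x)) ` V"
  define d where "d = Inf S"
  have bdd: "bdd_below S" unfolding S_def by (intro bdd_belowI[of _ 0]) auto
  have ne: "S \<noteq> {}" using V by (auto simp: S_def)
  have dle: "d \<le> norm2_on M (\<lambda>x. F x + v x)" if "v \<in> V" for v
    unfolding d_def using bdd that by (intro cInf_lower) (auto simp: S_def)
  have "\<exists>v\<in>V. norm2_on M (\<lambda>x. F x + v x) < d + inverse (Suc k)" for k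
  proof -
    have "Inf S < d + inverse (Suc k)" by (simp add: d_def)
    then show ?thesis using cInf_lessD[OF ne] by (auto simp: S_def)
  qed
  then obtain v where v: "\<And>k. v k \<in> V" "\<And>k. norm2_on M (\<lambda>x. F x + v k x) < d + inverse (Suc k)"
    by metis
  have vL: "v k \<in> L2_on M" for k using v V by auto
  have FvL: "(\<lambda>x. F x + v k x) \<in> L2_on M" for k using L2_on_add[OF F vL] .
  have "L2_Cauchy M v"
    unfolding L2_Cauchy_def
  proof (intro allI impI)
    fix e :: real assume "e > 0"
    then obtain N where N: "inverse (Suc N) < e / 4"
      using reals_Archimedean[of "e/4"] by auto
    have "norm2_on M (\<lambda>x. v k x - v l x) < e" if "k \<ge> N" "l \<ge> N" for k l
    proof -
      have ik: "inverse (Suc k) \<le> inverse (Suc N)" "inverse (Suc l) \<le> inverse (Suc N)"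
        using that by (auto intro!: le_imp_inverse_le)
      have sV: "(\<lambda>x. v k x + 1 * v l x) \<in> V" "(\<lambda>x. 0 + (1/2) * (v k x + 1 * v l x)) \<in> V"
        using add[OF v(1) v(1), of k 1 l] add[OF V(2), of "\<lambda>x. v k x + 1 * v l x" "1/2"] by auto
      have eq: "(\<lambda>x. (F x + v k x) + (F x + v l x)) = (\<lambda>x. 2 * (F x + (0 + (1/2) * (v k x + 1 * v l x))))"
        by (auto simp: algebra_simps)
      have "norm2_on M (\<lambda>x. (F x + v k x) + (F x + v l x)) \<ge> 4 * d"
        unfolding eq norm2_on_scale using dle[OF sV(2)] by simp
      moreover have "norm2_on M (\<lambda>x. v k x - v l x) = norm2_on M (\<lambda>x. (F x + v k x) - (F x + v l x))"
        by simp
      ultimately show ?thesis using parallelogram_on[OF FvL FvL, of k l] v(2)[of k] v(2)[of l] ik N by linarith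
    qed
    then show "\<exists>N. \<forall>k\<ge>N. \<forall>l\<ge>N. norm2_on M (\<lambda>x. v k x - v l x) < e" by blast
  qed
  moreover have "(\<lambda>k. inner_on M (\<lambda>x. F x + v k x) w) \<longlonglongrightarrow> 0" if w: "w \<in> V" for w
  proof -
    have wL: "w \<in> L2_on M" using w V by auto
    have le: "(norm (inner_on M (\<lambda>x. F x + v k x) w))\<^sup>2 \<le> inverse (Suc k) * norm2_on M w" for k
    proof -
      have "(norm (inner_on M (\<lambda>x. F x + v k x) w))\<^sup>2 \<le> (norm2_on M (\<lambda>x. F x + v k x) - d) * norm2_on M w"
      proof (rule almost_minimal_inner_le[OF FvL wL])
        fix c show "d \<le> norm2_on M (\<lambda>x. F x + v k x + c * w x)"
          using dle[OF add[OF v(1) w, of k c]] by (simp add: add.assoc)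
      qed
      also have "\<dots> \<le> inverse (Suc k) * norm2_on M w"
        using v(2)[of k] by (intro mult_right_mono) auto
      finally show ?thesis .
    qed
    have "(\<lambda>k. (norm (inner_on M (\<lambda>x. F x + v k x) w))\<^sup>2) \<longlonglongrightarrow> 0"
    proof (rule tendsto_sandwich[OF _ _ tendsto_const])
      show "(\<lambda>k. inverse (Suc k) * norm2_on M w) \<longlonglongrightarrow> 0"
        using tendsto_mult_right[OF LIMSEQ_inverse_real_of_nat] by (auto intro: tendsto_eq_intros)
    qed (use le in auto)
    then have "(\<lambda>k. sqrt ((norm (inner_on M (\<lambda>x. F x + v k x) w))\<^sup>2)) \<longlonglongrightarrow> sqrt 0"
      by (rule tendsto_real_sqrt)
    then show ?thesis by (simp add: tendsto_norm_zero_iff)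
  qed
  ultimately show ?thesis using v(1) by blast
qed

text \<open>
  For each \<open>j\<close>, either \<open>norm (a j) \<le> 2\<^sup>-\<^sup>j\<close> or \<open>norm (a j) \<le> 2\<^sup>j * (norm (a j))\<^sup>2\<close>.
\<close>

lemma summable_norm_of_weighted_sq:
  fixes a :: "nat \<Rightarrow> complex"
  assumes "summable (\<lambda>j. 2 ^ j * (norm (a j))\<^sup>2)" shows "summable (\<lambda>j. norm (a j))"
proof (rule summable_comparison_test')
  show "summable (\<lambda>j. (1/2) ^ j + 2 ^ j * (norm (a j))\<^sup>2)"
    using assms by (intro summable_add summable_geometric) auto
  fix j :: nat assume "j \<ge> 0"
  show "norm (norm (a j)) \<le> (1/2) ^ j + 2 ^ j * (norm (a j))\<^sup>2"
  proof (cases "norm (a j) \<le> (1/2) ^ j")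
    case True
    then show ?thesis by (simp add: add_increasing2)
  next
    case False
    then have "norm (a j) * 1 \<le> norm (a j) * (2 ^ j * norm (a j))"
      by (intro mult_left_mono) (auto simp: field_simps power_one_over)
    then show ?thesis by (simp add: power2_eq_square algebra_simps add_increasing)
  qed
qed

text \<open>
  Riesz-Fischer theorem. Along a subsequence whose increments have squared norm at most \<open>4\<^sup>-\<^sup>j\<close>, the
  squares of the increments with weights \<open>2\<^sup>j\<close> have a finite integral, so the subsequence converges almost
  everywhere; the Fatou lemma turns the Cauchy property into convergence in the norm. The subsequence is part
  of the conclusion because it lets the limit vanish wherever the members of the sequence vanish.
\<close>

theorem L2_complete:
  assumes L: "\<And>k. f k \<in> L2_on M" and C: "L2_Cauchy M f"
  shows "\<exists>g r. g \<in> L2_on M \<and> (\<lambda>k. norm2_on M (\<lambda>x. f k x - g x)) \<longlonglongrightarrow> 0 \<and>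
      strict_mono (r :: nat \<Rightarrow> nat) \<and> (AE x in M. (\<lambda>j. f (r j) x) \<longlonglongrightarrow> g x)"
proof -
  have [measurable]: "f k \<in> borel_measurable M" for k using L by measurable
  have ex: "\<exists>N. \<forall>k\<ge>N. \<forall>l\<ge>N. norm2_on M (\<lambda>x. f k x - f l x) < (1/4)^j" for j :: nat
    using C unfolding L2_Cauchy_def by auto
  then obtain N where N: "\<And>j k l. k \<ge> N j \<Longrightarrow> l \<ge> N j \<Longrightarrow> norm2_on M (\<lambda>x. f k x - f l x) < (1/4)^j"
    by metis
  define r where "r = rec_nat (N 0) (\<lambda>j q. max (N (Suc j)) (Suc q))"
  have rS: "r (Suc j) = max (N (Suc j)) (Suc (r j))" for j by (simp add: r_def)
  have rN: "r j \<ge> N j" for j by (cases j) (auto simp: r_def)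
  have rmono: "strict_mono r" using rS by (intro strict_monoI_Suc) (auto simp: less_Suc_eq_le)
  define a where "a = (\<lambda>j x. f (r (Suc j)) x - f (r j) x)"
  have [measurable]: "a j \<in> borel_measurable M" for j unfolding a_def by measurable
  have aL: "a j \<in> L2_on M" for j unfolding a_def by (intro L2_on_diff L)
  have an: "norm2_on M (a j) \<le> (1/4)^j" for j
    unfolding a_def using N[of j "r (Suc j)" "r j"] rN[of j] strict_monoD[OF rmono, of j "Suc j"]
    by (intro less_imp_le) auto
  have "(\<integral>\<^sup>+x. (\<Sum>j. ennreal (2 ^ j * (norm (a j x))\<^sup>2)) \<partial>M) = (\<Sum>j. \<integral>\<^sup>+x. ennreal (2 ^ j * (norm (a j x))\<^sup>2) \<partial>M)"
    by (intro nn_integral_suminf) auto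
  also have "\<dots> = (\<Sum>j. ennreal (2 ^ j * norm2_on M (a j)))"
    using nn_norm2_on[OF aL] by (simp add: ennreal_mult nn_integral_cmult)
  also have "\<dots> \<le> (\<Sum>j. ennreal ((1/2)^j))"
  proof (intro suminf_le ennreal_leI)
    fix j :: nat
    have "2 ^ j * norm2_on M (a j) \<le> 2 ^ j * (1/4)^j" using an by (intro mult_left_mono) auto
    also have "\<dots> = (1/2)^j" by (simp add: power_mult_distrib[symmetric])
    finally show "2 ^ j * norm2_on M (a j) \<le> (1/2)^j" .
  qed auto
  also have "\<dots> = ennreal (\<Sum>j. (1/2)^j)"
    by (intro suminf_ennreal2) (auto intro: summable_geometric)
  also have "\<dots> < \<infinity>" by simp
  finally have "AE x in M. (\<Sum>j. ennreal (2 ^ j * (norm (a j x))\<^sup>2)) \<noteq> \<infinity>"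
    by (intro nn_integral_PInf_AE) auto
  then have AEc: "AE x in M. convergent (\<lambda>j. f (r j) x)"
  proof eventually_elim
    case (elim x)
    then have "summable (\<lambda>j. 2 ^ j * (norm (a j x))\<^sup>2)"
      by (intro summable_suminf_not_top) auto
    then have "summable (\<lambda>j. a j x)"
      by (intro summable_norm_cancel[OF summable_norm_of_weighted_sq])
    then have "convergent (\<lambda>n. (\<Sum>j<n. a j x) + f (r 0) x)"
      by (intro convergent_add convergent_const) (simp add: summable_iff_convergent)
    moreover have "(\<Sum>j<n. a j x) + f (r 0) x = f (r n) x" for n
      unfolding a_def by (subst sum_lessThan_telescope) simp
    ultimately show ?case by simp
  qed
  define g where "g = (\<lambda>x. lim (\<lambda>j. f (r j) x))"
  have [measurable]: "g \<in> borel_measurable M" unfolding g_def by measurable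
  have AEg: "AE x in M. (\<lambda>j. f (r j) x) \<longlonglongrightarrow> g x"
    using AEc by eventually_elim (simp add: g_def convergent_LIMSEQ_iff)
  have bd: "(\<integral>\<^sup>+x. ennreal ((norm (f k x - g x))\<^sup>2) \<partial>M) \<le> ennreal e"
    if e: "\<forall>l\<ge>K. norm2_on M (\<lambda>x. f k x - f l x) \<le> e" for k e K
  proof -
    have "(\<integral>\<^sup>+x. ennreal ((norm (f k x - g x))\<^sup>2) \<partial>M) = (\<integral>\<^sup>+x. liminf (\<lambda>j. ennreal ((norm (f k x - f (r j) x))\<^sup>2)) \<partial>M)"
      using AEg
    proof (intro nn_integral_cong_AE, eventually_elim)
      case (elim x)
      have "(\<lambda>j. ennreal ((norm (f k x - f (r j) x))\<^sup>2)) \<longlonglongrightarrow> ennreal ((norm (f k x - g x))\<^sup>2)"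
        by (intro tendsto_ennrealI tendsto_intros elim)
      from lim_imp_Liminf[OF _ this] show ?case by simp
    qed
    also have "\<dots> \<le> liminf (\<lambda>j. \<integral>\<^sup>+x. ennreal ((norm (f k x - f (r j) x))\<^sup>2) \<partial>M)"
      by (intro nn_integral_liminf) auto
    also have "\<dots> = liminf (\<lambda>j. ennreal (norm2_on M (\<lambda>x. f k x - f (r j) x)))"
      by (simp add: nn_norm2_on[OF L2_on_diff[OF L L]])
    also have "\<dots> \<le> limsup (\<lambda>j. ennreal (norm2_on M (\<lambda>x. f k x - f (r j) x)))"
      by (intro Liminf_le_Limsup) auto
    also have "\<dots> \<le> ennreal e"
    proof (rule Limsup_bounded)
      show "\<forall>\<^sub>F j in sequentially. ennreal (norm2_on M (\<lambda>x. f k x - f (r j) x)) \<le> ennreal e"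
        using eventually_ge_at_top[of K]
      proof eventually_elim
        case (elim j)
        then have "r j \<ge> K" using seq_suble[OF rmono, of j] by linarith
        then show ?case using e by (intro ennreal_leI) auto
      qed
    qed
    finally show ?thesis .
  qed
  have gL: "g \<in> L2_on M"
  proof -
    obtain K where K: "\<And>k l. k \<ge> K \<Longrightarrow> l \<ge> K \<Longrightarrow> norm2_on M (\<lambda>x. f k x - f l x) < 1"
      using C unfolding L2_Cauchy_def by (meson zero_less_one)
    have "(\<lambda>x. f K x - g x) \<in> L2_on M"
      using bd[of K K 1] K[of K] by (auto simp: L2_on_iff_nn less_imp_le intro: le_less_trans)
    from L2_on_diff[OF L[of K] this] show ?thesis by simp
  qed
  have "(\<lambda>k. norm2_on M (\<lambda>x. f k x - g x)) \<longlonglongrightarrow> 0"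
  proof (rule LIMSEQ_I)
    fix e :: real assume e: "e > 0"
    then obtain K where K: "\<And>k l. k \<ge> K \<Longrightarrow> l \<ge> K \<Longrightarrow> norm2_on M (\<lambda>x. f k x - f l x) < e/2"
      using C unfolding L2_Cauchy_def by (meson half_gt_zero)
    have "norm (norm2_on M (\<lambda>x. f k x - g x) - 0) < e" if "k \<ge> K" for k
    proof -
      have "ennreal (norm2_on M (\<lambda>x. f k x - g x)) \<le> ennreal (e/2)"
        using bd[of K k "e/2"] K that by (simp add: nn_norm2_on[OF L2_on_diff[OF L gL], symmetric] less_imp_le)
      then show ?thesis using e by (simp add: ennreal_le_iff)
    qed
    then show "\<exists>no. \<forall>n\<ge>no. norm (norm2_on M (\<lambda>x. f n x - g x) - 0) < e" by blast
  qed
  then show ?thesis using gL rmono AEg by blast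
qed

section \<open>Continuity of translations in the mean\<close>

lemma nn_integral_lborel_translate:
  fixes f :: "'a::euclidean_space \<Rightarrow> ennreal"
  assumes [measurable]: "f \<in> borel_measurable borel"
  shows "(\<integral>\<^sup>+x. f (x + h) \<partial>lborel) = (\<integral>\<^sup>+x. f x \<partial>lborel)"
proof -
  have "(\<integral>\<^sup>+x. f x \<partial>lborel) = (\<integral>\<^sup>+x. f x \<partial>distr lborel borel ((+) h))"
    by (simp add: lborel_distr_plus)
  also have "\<dots> = (\<integral>\<^sup>+x. f (x + h) \<partial>lborel)"
    by (subst nn_integral_distr) (auto simp: add.commute)
  finally show ?thesis by simp
qed

lemma nn_integral_lborel_scale:
  fixes f :: "'a::euclidean_space \<Rightarrow> ennreal"
  assumes [measurable]: "f \<in> borel_measurable borel" and c: "c \<noteq> 0"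
  shows "(\<integral>\<^sup>+x. f x \<partial>lborel) = ennreal (\<bar>c\<bar> ^ DIM('a)) * (\<integral>\<^sup>+x. f (c *\<^sub>R x) \<partial>lborel)"
proof -
  have "(\<integral>\<^sup>+x. f x \<partial>lborel) = (\<integral>\<^sup>+x. f x \<partial>density (distr lborel borel (\<lambda>x. 0 + c *\<^sub>R x)) (\<lambda>_. \<bar>c\<bar>^DIM('a)))"
    using lborel_affine[OF c, of "0::'a"] by simp
  also have "\<dots> = ennreal (\<bar>c\<bar> ^ DIM('a)) * (\<integral>\<^sup>+x. f (c *\<^sub>R x) \<partial>lborel)"
    by (simp add: nn_integral_density nn_integral_distr nn_integral_cmult)
  finally show ?thesis .
qed

lemma integral_lborel_translate:
  fixes f :: "'a::euclidean_space \<Rightarrow> 'b::{banach, second_countable_topology}"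
  assumes [measurable]: "f \<in> borel_measurable borel"
  shows "(LINT x|lborel. f (x + h)) = (LINT x|lborel. f x)"
proof -
  have "(LINT x|lborel. f x) = (LINT x|distr lborel borel ((+) h). f x)"
    by (simp add: lborel_distr_plus)
  also have "\<dots> = (LINT x|lborel. f (x + h))"
    by (subst integral_distr) (auto simp: add.commute)
  finally show ?thesis by simp
qed

lemma integrable_lborel_translate:
  fixes f :: "'a::euclidean_space \<Rightarrow> 'b::{banach, second_countable_topology}"
  assumes "integrable lborel f" shows "integrable lborel (\<lambda>x. f (x + h))"
proof -
  have [measurable]: "f \<in> borel_measurable borel" using assms by auto
  have "integrable (distr lborel borel ((+) h)) f"
    using assms by (simp add: lborel_distr_plus)
  then show ?thesis by (subst (asm) integrable_distr_eq) (auto simp: add.commute)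
qed

lemma L2_on_translate:
  assumes "u \<in> L2_on lborel" shows "(\<lambda>x. u (x + h)) \<in> L2_on lborel"
proof -
  have [measurable]: "u \<in> borel_measurable borel" using assms by (auto simp: L2_on_def)
  show ?thesis using integrable_lborel_translate[OF L2_on_integrable[OF assms]] by (auto simp: L2_on_def)
qed

lemma norm2_on_translate:
  fixes u :: "'a::euclidean_space \<Rightarrow> complex"
  assumes [measurable]: "u \<in> borel_measurable borel"
  shows "norm2_on lborel (\<lambda>x. u (x + h)) = norm2_on lborel u"
  unfolding norm2_on_def using integral_lborel_translate[of "\<lambda>x. (norm (u x))\<^sup>2" h] by simp

text \<open>
  Stated for sequences, so that dominated convergence applies directly.
\<close>

definition translation_continuous :: "('a::euclidean_space \<Rightarrow> complex) \<Rightarrow> bool" where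
  "translation_continuous u \<longleftrightarrow>
     (\<forall>h. h \<longlonglongrightarrow> 0 \<longrightarrow> (\<lambda>n. norm2_on lborel (\<lambda>x. u (x + h n) - u x)) \<longlonglongrightarrow> 0)"

lemma translation_continuous_add_scale:
  assumes u: "u \<in> L2_on lborel" "translation_continuous u" and v: "v \<in> L2_on lborel" "translation_continuous v"
  shows "translation_continuous (\<lambda>x. u x + c * v x)"
  unfolding translation_continuous_def
proof (intro allI impI)
  fix h :: "nat \<Rightarrow> 'a" assume h: "h \<longlonglongrightarrow> 0"
  let ?B = "\<lambda>n. 2 * norm2_on lborel (\<lambda>x. u (x + h n) - u x) + 2 * ((norm c)\<^sup>2 * norm2_on lborel (\<lambda>x. v (x + h n) - v x))"
  have le: "norm2_on lborel (\<lambda>x. (u (x + h n) + c * v (x + h n)) - (u x + c * v x)) \<le> ?B n" for n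
    using norm2_on_add_le[OF L2_on_diff[OF L2_on_translate[OF u(1), of "h n"] u(1)]
        L2_on_scale[OF L2_on_diff[OF L2_on_translate[OF v(1), of "h n"] v(1)], of c]]
    unfolding norm2_on_scale by (simp add: algebra_simps)
  have "?B \<longlonglongrightarrow> 2 * 0 + 2 * ((norm c)\<^sup>2 * 0)"
    using u(2) v(2) h unfolding translation_continuous_def by (intro tendsto_intros) auto
  then have lim: "?B \<longlonglongrightarrow> 0" by simp
  show "(\<lambda>n. norm2_on lborel (\<lambda>x. (u (x + h n) + c * v (x + h n)) - (u x + c * v x))) \<longlonglongrightarrow> 0"
    by (rule tendsto_zero_squeeze[OF lim norm2_on_nonneg le])
qed

lemma translation_continuous_limit:
  assumes u: "u \<in> L2_on lborel"
    and ap: "\<And>e. e > 0 \<Longrightarrow> \<exists>v. v \<in> L2_on lborel \<and> translation_continuous v \<and> norm2_on lborel (\<lambda>x. u x - v x) < e"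
  shows "translation_continuous u"
  unfolding translation_continuous_def
proof (intro allI impI LIMSEQ_I)
  fix h :: "nat \<Rightarrow> 'a" and e :: real assume h: "h \<longlonglongrightarrow> 0" and e: "e > 0"
  (* With the factors 2 of the squared triangle inequality the errors add up to
     2 * (e/12) + 4 * (e/8) + 4 * (e/12) = e. *)
  obtain v where v: "v \<in> L2_on lborel" "translation_continuous v" "norm2_on lborel (\<lambda>x. u x - v x) < e / 12"
    using ap[of "e/12"] e by auto
  have "(\<lambda>n. norm2_on lborel (\<lambda>x. v (x + h n) - v x)) \<longlonglongrightarrow> 0"
    using v(2) h unfolding translation_continuous_def by auto
  then obtain N where N: "\<And>n. n \<ge> N \<Longrightarrow> norm2_on lborel (\<lambda>x. v (x + h n) - v x) < e / 8"
    using e LIMSEQ_D[of _ 0 "e/8"] by fastforce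
  have "norm (norm2_on lborel (\<lambda>x. u (x + h n) - u x) - 0) < e" if "n \<ge> N" for n
  proof -
    have [measurable]: "u \<in> borel_measurable borel" "v \<in> borel_measurable borel" using u v by (auto simp: L2_on_def)
    note ut = L2_on_translate[OF u, of "h n"] and vt = L2_on_translate[OF v(1), of "h n"]
    have "norm2_on lborel (\<lambda>x. u (x + h n) - u x) \<le>
      2 * norm2_on lborel (\<lambda>x. u (x + h n) - v (x + h n)) + 2 * norm2_on lborel (\<lambda>x. v (x + h n) - u x)"
      by (rule norm2_on_triangle[OF ut vt u])
    moreover have "norm2_on lborel (\<lambda>x. v (x + h n) - u x) \<le>
      2 * norm2_on lborel (\<lambda>x. v (x + h n) - v x) + 2 * norm2_on lborel (\<lambda>x. v x - u x)"
      by (rule norm2_on_triangle[OF vt v(1) u])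
    moreover have "norm2_on lborel (\<lambda>x. u (x + h n) - v (x + h n)) = norm2_on lborel (\<lambda>x. u x - v x)"
      using norm2_on_translate[of "\<lambda>x. u x - v x" "h n"] by simp
    ultimately show ?thesis using N[OF that] v(3) norm2_on_commute[of lborel v u] by simp
  qed
  then show "\<exists>no. \<forall>n\<ge>no. norm (norm2_on lborel (\<lambda>x. u (x + h n) - u x) - 0) < e" by blast
qed

lemma indicator_L2_on: "A \<in> sets M \<Longrightarrow> emeasure M A < \<infinity> \<Longrightarrow> indicator A \<in> L2_on M"
proof -
  assume A: "A \<in> sets M" "emeasure M A < \<infinity>"
  have "(\<integral>\<^sup>+x. ennreal ((norm (indicator A x :: complex))\<^sup>2) \<partial>M) = (\<integral>\<^sup>+x. indicator A x \<partial>M)"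
    by (intro nn_integral_cong) (auto simp: indicator_def)
  then show ?thesis using A by (auto simp: L2_on_iff_nn)
qed

text \<open>
  A point of an open set stays in it under small translations, so dominated convergence shows that the
  measure of the part of \<open>U\<close> that leaves \<open>U\<close> tends to \<open>0\<close>. As \<open>U\<close> and its translate have the same finite measure, the
  symmetric difference has twice that measure.
\<close>

lemma translation_continuous_indicator_open:
  assumes U: "open U" "emeasure lborel U < \<infinity>"
  shows "translation_continuous (indicator U)"
  unfolding translation_continuous_def
proof (intro allI impI)
  fix h :: "nat \<Rightarrow> 'a" assume h: "h \<longlonglongrightarrow> 0"
  have [measurable]: "U \<in> sets borel" using U by auto
  let ?g = "\<lambda>n x. indicator U x * (1 - indicator U (x + h n)) :: real"
  have iU: "integrable lborel (indicator U :: _ \<Rightarrow> real)" using U by auto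
  have iUt: "integrable lborel (\<lambda>x. indicator U (x + h n) :: real)" for n
    by (rule integrable_lborel_translate[OF iU])
  have iUU: "integrable lborel (\<lambda>x. indicator U x * indicator U (x + h n) :: real)" for n
    by (rule Bochner_Integration.integrable_bound[OF iU]) (auto simp: indicator_def)
  have eq: "norm2_on lborel (\<lambda>x. indicator U (x + h n) - indicator U x) = 2 * (LINT x|lborel. ?g n x)" for n
  proof -
    have "norm2_on lborel (\<lambda>x. indicator U (x + h n) - indicator U x) =
       (LINT x|lborel. indicator U (x + h n) + indicator U x - 2 * (indicator U x * indicator U (x + h n)))"
      unfolding norm2_on_def by (rule Bochner_Integration.integral_cong) (auto simp: indicator_def)
    also have "\<dots> = 2 * (LINT x|lborel. indicator U x - indicator U x * indicator U (x + h n))"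
      using iU iUt[of n] iUU[of n] integral_lborel_translate[of "indicator U :: _ \<Rightarrow> real" "h n"] by simp
    finally show ?thesis by (simp add: right_diff_distrib)
  qed
  have "(\<lambda>n. LINT x|lborel. ?g n x) \<longlonglongrightarrow> (LINT x|(lborel :: 'a measure). (0::real))"
  proof (rule Bochner_Integration.integral_dominated_convergence[where w = "indicator U"])
    show "AE x in lborel. (\<lambda>n. ?g n x) \<longlonglongrightarrow> 0"
    proof (intro AE_I2)
      fix x :: 'a
      show "(\<lambda>n. ?g n x) \<longlonglongrightarrow> 0"
      proof (cases "x \<in> U")
        case True
        have "(\<lambda>n. x + h n) \<longlonglongrightarrow> x + 0" by (intro tendsto_intros h)
        then have "\<forall>\<^sub>F n in sequentially. x + h n \<in> U"
          using U(1) True by (auto dest: topological_tendstoD)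
        then have "\<forall>\<^sub>F n in sequentially. ?g n x = 0" by eventually_elim auto
        then show ?thesis by (rule tendsto_eventually)
      qed auto
    qed
  qed (auto simp: iU indicator_def)
  then have "(\<lambda>n. 2 * (LINT x|lborel. ?g n x)) \<longlonglongrightarrow> 2 * 0" by (intro tendsto_intros) simp
  then show "(\<lambda>n. norm2_on lborel (\<lambda>x. indicator U (x + h n) - indicator U x)) \<longlonglongrightarrow> 0"
    by (simp add: eq)
qed

text \<open>
  Outer regularity reduces Borel sets to open sets.
\<close>

lemma translation_continuous_indicator:
  assumes A: "A \<in> sets borel" "emeasure lborel A < \<infinity>"
  shows "translation_continuous (indicator (A :: 'a::euclidean_space set))"
proof (rule translation_continuous_limit)
  show "indicator A \<in> L2_on lborel" using A by (intro indicator_L2_on) auto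
  fix e :: real assume e: "e > 0"
  obtain U where U: "open U" "A \<subseteq> U" "emeasure lborel (U - A) < e"
    using outer_regular_lborel[OF A(1) e] by blast
  have [measurable]: "U \<in> sets borel" "A \<in> sets borel" using U A by auto
  have "emeasure lborel U = emeasure lborel (A \<union> (U - A))" using U by (auto intro!: arg_cong[where f="emeasure lborel"])
  also have "\<dots> \<le> emeasure lborel A + emeasure lborel (U - A)" by (intro emeasure_subadditive) auto
  also have "\<dots> < \<infinity>" using A U by (auto simp: less_top dest: less_trans[OF _ ennreal_less_top])
  finally have fU: "emeasure lborel U < \<infinity>" .
  have "norm2_on lborel (\<lambda>x. indicator A x - indicator U x) = (LINT x|lborel. indicator (U - A) x)"
    unfolding norm2_on_def using U(2) by (intro Bochner_Integration.integral_cong) (auto simp: indicator_def)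
  also have "\<dots> = measure lborel (U - A)" by simp
  also have "\<dots> < e"
  proof -
    have "emeasure lborel (U - A) = ennreal (measure lborel (U - A))"
      using U(3) by (intro emeasure_eq_ennreal_measure) (auto simp: top_unique)
    then show ?thesis using U(3) by (simp add: ennreal_less_iff)
  qed
  finally show "\<exists>v. v \<in> L2_on lborel \<and> translation_continuous v \<and> norm2_on lborel (\<lambda>x. indicator A x - v x) < e"
    using translation_continuous_indicator_open[OF U(1) fU] indicator_L2_on[of U lborel] fU by (intro exI[of _ "indicator U"]) auto
qed

text \<open>
  Dominated simple functions approximate \<open>u\<close>, and their nonzero values are attained on sets of finite measure.
\<close>

theorem L2_translation_continuous:
  fixes u :: "'a::euclidean_space \<Rightarrow> complex"
  assumes u: "u \<in> L2_on lborel" shows "translation_continuous u"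
proof (rule translation_continuous_limit[OF u])
  fix e :: real assume e: "e > 0"
  have [measurable]: "u \<in> borel_measurable borel" using u by (auto simp: L2_on_def)
  obtain F where F: "\<And>i. simple_function lborel (F i)" "\<And>x. (\<lambda>i. F i x) \<longlonglongrightarrow> u x"
     "\<And>i x. norm (F i x) \<le> 2 * norm (u x)"
    using borel_measurable_implies_sequence_metric[of u lborel 0] by auto
  have Fm [measurable]: "F i \<in> borel_measurable borel" for i
    using borel_measurable_simple_function[OF F(1)[of i]] by simp
  have FL: "F i \<in> L2_on lborel" for i
  proof -
    have "integrable lborel (\<lambda>x. (norm (F i x))\<^sup>2)"
    proof (rule Bochner_Integration.integrable_bound)
      show "integrable lborel (\<lambda>x. 4 * (norm (u x))\<^sup>2)" using L2_on_integrable[OF u] by auto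
      show "AE x in lborel. norm ((norm (F i x))\<^sup>2) \<le> norm (4 * (norm (u x))\<^sup>2)"
        using power_mono[OF F(3), of _ _ 2] by (auto simp: power_mult_distrib)
    qed auto
    then show ?thesis by (auto simp: L2_on_def)
  qed
  have "(\<lambda>i. LINT x|lborel. (norm (u x - F i x))\<^sup>2) \<longlonglongrightarrow> (LINT x|(lborel :: 'a measure). (0::real))"
  proof (rule Bochner_Integration.integral_dominated_convergence[where w = "\<lambda>x. 9 * (norm (u x))\<^sup>2"])
    show "integrable lborel (\<lambda>x. 9 * (norm (u x))\<^sup>2)" using L2_on_integrable[OF u] by auto
    show "AE x in lborel. (\<lambda>i. (norm (u x - F i x))\<^sup>2) \<longlonglongrightarrow> 0"
    proof (intro AE_I2)
      fix x
      have "(\<lambda>i. (norm (u x - F i x))\<^sup>2) \<longlonglongrightarrow> (norm (u x - u x))\<^sup>2" by (intro tendsto_intros F)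
      then show "(\<lambda>i. (norm (u x - F i x))\<^sup>2) \<longlonglongrightarrow> 0" by simp
    qed
    show "AE x in lborel. norm ((norm (u x - F i x))\<^sup>2) \<le> 9 * (norm (u x))\<^sup>2" for i
    proof (intro AE_I2)
      fix x
      have "norm (u x - F i x) \<le> 3 * norm (u x)" using norm_triangle_ineq4[of "u x" "F i x"] F(3)[of i x] by linarith
      from power_mono[OF this, of 2] show "norm ((norm (u x - F i x))\<^sup>2) \<le> 9 * (norm (u x))\<^sup>2"
        by (simp add: power_mult_distrib)
    qed
  qed auto
  then have "\<forall>\<^sub>F i in sequentially. norm2_on lborel (\<lambda>x. u x - F i x) < e"
    unfolding norm2_on_def using e by (auto dest: order_tendstoD(2))
  then obtain i where i: "norm2_on lborel (\<lambda>x. u x - F i x) < e" by (auto simp: eventually_sequentially)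
  (* The level set of the value 0 may have infinite measure, and does not contribute. *)
  define C where "C = F i ` UNIV - {0}"
  have C: "finite C" using F(1)[of i] by (auto simp: C_def simple_function_def)
  define G where "G = (\<lambda>D x. \<Sum>c\<in>D. c * indicator (F i -` {c}) x)"
  have GD: "G D \<in> L2_on lborel \<and> translation_continuous (G D)" if "finite D" "D \<subseteq> C" for D
    using that
  proof (induction D rule: finite_induct)
    case empty
    then show ?case by (auto simp: G_def translation_continuous_def norm2_on_def)
  next
    case (insert c D)
    have c0: "c \<noteq> 0" using insert by (auto simp: C_def)
    have [measurable]: "F i -` {c} \<in> sets borel" using measurable_sets_borel[OF Fm, of "{c}" i] by simp
    have "ennreal ((norm c)\<^sup>2) * emeasure lborel (F i -` {c}) = (\<integral>\<^sup>+x. ennreal ((norm c)\<^sup>2) * indicator (F i -` {c}) x \<partial>lborel)"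
      by (simp add: nn_integral_cmult_indicator)
    also have "\<dots> \<le> (\<integral>\<^sup>+x. ennreal ((norm (F i x))\<^sup>2) \<partial>lborel)"
      by (intro nn_integral_mono) (auto simp: indicator_def)
    also have "\<dots> < \<infinity>" using FL by (auto simp: L2_on_iff_nn)
    finally have fin: "emeasure lborel (F i -` {c}) < \<infinity>"
      using c0 by (auto simp: ennreal_mult_less_top)
    have IL: "indicator (F i -` {c}) \<in> L2_on lborel" using fin by (intro indicator_L2_on) auto
    have eq: "G (insert c D) = (\<lambda>x. G D x + c * indicator (F i -` {c}) x)"
      by (intro ext) (simp only: G_def sum.insert[OF insert(1,2)] add.commute)
    have IT: "translation_continuous (indicator (F i -` {c}))"
      by (rule translation_continuous_indicator) (use fin in auto)
    have GD: "G D \<in> L2_on lborel" "translation_continuous (G D)" using insert by auto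
    show ?case unfolding eq
      using L2_on_add[OF GD(1) L2_on_scale[OF IL]] translation_continuous_add_scale[OF GD IL IT] by blast
  qed
  have GC: "G C = F i"
  proof
    fix x
    have "G C x = (\<Sum>c\<in>C. if c = F i x then c else 0)"
      unfolding G_def by (intro sum.cong) (auto simp: indicator_def)
    also have "\<dots> = F i x" using C by (auto simp: sum.delta' C_def)
    finally show "G C x = F i x" .
  qed
  have "translation_continuous (F i)" using GD[OF C order_refl] unfolding GC ..
  then show "\<exists>v. v \<in> L2_on lborel \<and> translation_continuous v \<and> norm2_on lborel (\<lambda>x. u x - v x) < e"
    using FL i by blast
qed

section \<open>Fourier transform of the Gaussian\<close>

lemma integral_lborel_scale:
  fixes f :: "'a::euclidean_space \<Rightarrow> 'b::{banach, second_countable_topology}"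
  assumes [measurable]: "f \<in> borel_measurable borel" and c: "c \<noteq> 0"
  shows "(LINT x|lborel. f x) = (\<bar>c\<bar> ^ DIM('a)) *\<^sub>R (LINT x|lborel. f (c *\<^sub>R x))"
proof -
  have "(LINT x|lborel. f x) = (LINT x|density (distr lborel borel (\<lambda>x. 0 + c *\<^sub>R x)) (\<lambda>_. \<bar>c\<bar>^DIM('a)). f x)"
    using lborel_affine[OF c, of "0::'a"] by simp
  also have "\<dots> = (\<bar>c\<bar> ^ DIM('a)) *\<^sub>R (LINT x|lborel. f (c *\<^sub>R x))"
    by (subst integral_density) (auto simp: integral_distr)
  finally show ?thesis .
qed

lemma norm_sq_Basis: "(norm (x::'a::euclidean_space))\<^sup>2 = (\<Sum>b\<in>Basis. (x \<bullet> b)\<^sup>2)"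
proof -
  have "(norm x)\<^sup>2 = x \<bullet> x" by (rule power2_norm_eq_inner)
  also have "\<dots> = (\<Sum>b\<in>Basis. (x \<bullet> b) * (x \<bullet> b))" by (rule euclidean_inner)
  finally have f: "(norm x)\<^sup>2 = (\<Sum>b\<in>Basis. (x \<bullet> b) * (x \<bullet> b))" .
  show ?thesis unfolding f by (simp add: power2_eq_square)
qed

lemma gaussian_nn_integral:
  "(\<integral>\<^sup>+x. ennreal (exp (- (norm (x::'a::euclidean_space))\<^sup>2 / 2)) \<partial>lborel) = ennreal (sqrt (2 * pi) ^ DIM('a))"
proof -
  have one: "(\<integral>\<^sup>+x. ennreal (exp (- x\<^sup>2 / 2)) \<partial>lborel) = ennreal (sqrt (2 * pi))"
  proof -
    have "(\<integral>\<^sup>+x. ennreal (exp (- x\<^sup>2 / 2)) \<partial>lborel) = (\<integral>\<^sup>+x. ennreal (sqrt (2*pi)) * ennreal (std_normal_density x) \<partial>lborel)"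
      by (intro nn_integral_cong) (simp add: ennreal_mult[symmetric] std_normal_density_def)
    also have "\<dots> = ennreal (sqrt (2*pi)) * emeasure (density lborel std_normal_density) (space lborel)"
      by (subst nn_integral_cmult) (auto simp: emeasure_density)
    also have "emeasure (density lborel std_normal_density) (space lborel) = 1"
      using prob_space.emeasure_space_1[OF prob_space_normal_density[of 1 0]] by simp
    finally show ?thesis by simp
  qed
  have "(\<integral>\<^sup>+x. ennreal (exp (- (norm (x::'a))\<^sup>2 / 2)) \<partial>lborel)
     = (\<integral>\<^sup>+x. (\<Prod>b\<in>Basis. ennreal (exp (- (x \<bullet> b)\<^sup>2 / 2))) \<partial>(lborel :: 'a measure))"
  proof (intro nn_integral_cong)
    fix x :: 'a
    have "- (norm x)\<^sup>2 / 2 = (\<Sum>b\<in>Basis. - (x \<bullet> b)\<^sup>2 / 2)"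
      unfolding norm_sq_Basis by (simp add: sum_negf sum_divide_distrib[symmetric])
    then show "ennreal (exp (- (norm x)\<^sup>2 / 2)) = (\<Prod>b\<in>Basis. ennreal (exp (- (x \<bullet> b)\<^sup>2 / 2)))"
      by (simp add: prod_ennreal exp_sum)
  qed
  also have "\<dots> = (\<Prod>b\<in>(Basis :: 'a set). (\<integral>\<^sup>+x. ennreal (exp (- x\<^sup>2 / 2)) \<partial>lborel))"
    by (rule nn_integral_lborel_prod) auto
  also have "\<dots> = ennreal (sqrt (2 * pi) ^ DIM('a))"
    unfolding one by (simp add: ennreal_power)
  finally show ?thesis .
qed

lemma gaussian_integrable: "integrable lborel (\<lambda>x::'a::euclidean_space. exp (- (norm x)\<^sup>2 / 2))"
  by (rule integrableI_nn_integral_finite[OF _ _ gaussian_nn_integral]) auto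

lemma gaussian_scaled_integrable:
  assumes e: "e > 0"
  shows "integrable lborel (\<lambda>x::'a::euclidean_space. exp (- (e * norm x)\<^sup>2 / 2))"
proof (rule integrableI_nonneg)
  have "(\<integral>\<^sup>+x. ennreal (exp (- (norm (x::'a))\<^sup>2 / 2)) \<partial>lborel) =
     ennreal (\<bar>e\<bar> ^ DIM('a)) * (\<integral>\<^sup>+x. ennreal (exp (- (norm (e *\<^sub>R (x::'a)))\<^sup>2 / 2)) \<partial>lborel)"
    using e by (intro nn_integral_lborel_scale) auto
  moreover have "(\<integral>\<^sup>+x. ennreal (exp (- (norm (x::'a))\<^sup>2 / 2)) \<partial>lborel) < \<infinity>"
    unfolding gaussian_nn_integral by simp
  ultimately show "(\<integral>\<^sup>+x. ennreal (exp (- (e * norm (x::'a))\<^sup>2 / 2)) \<partial>lborel) < \<infinity>"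
    using e by (auto simp: ennreal_mult_less_top)
qed auto

lemma gaussian_integral: "(LINT x|lborel. exp (- (norm (x::'a::euclidean_space))\<^sup>2 / 2)) = sqrt (2 * pi) ^ DIM('a)"
  by (subst integral_eq_nn_integral) (use gaussian_nn_integral[where 'a='a] in simp_all)

lemma gaussian_char_real:
  "(LINT x|lborel. exp (\<i> * complex_of_real (t * x)) * complex_of_real (exp (- x\<^sup>2 / 2))) =
    complex_of_real (sqrt (2 * pi) * exp (- t\<^sup>2 / 2))"
proof -
  have "complex_of_real (exp (- t\<^sup>2 / 2)) = (LINT x|density lborel std_normal_density. exp (\<i> * complex_of_real (t * x)))"
    using fun_cong[OF char_std_normal_distribution, of t] by (simp add: char_def mult.assoc)
  also have "\<dots> = (LINT x|lborel. std_normal_density x *\<^sub>R exp (\<i> * complex_of_real (t * x)))"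
    by (subst integral_density) (auto)
  also have "\<dots> = (LINT x|lborel. complex_of_real (1 / sqrt (2*pi)) * (exp (\<i> * complex_of_real (t * x)) * complex_of_real (exp (- x\<^sup>2 / 2))))"
    by (rule Bochner_Integration.integral_cong) (auto simp: std_normal_density_def scaleR_conv_of_real)
  also have "\<dots> = complex_of_real (1 / sqrt (2*pi)) * (LINT x|lborel. (exp (\<i> * complex_of_real (t * x)) * complex_of_real (exp (- x\<^sup>2 / 2))))"
    by simp
  finally show ?thesis by (simp add: field_simps)
qed

lemma gaussian_char:
  fixes z :: "'a::euclidean_space"
  shows "(LINT x|lborel. exp (\<i> * complex_of_real (z \<bullet> x)) * complex_of_real (exp (- (norm x)\<^sup>2 / 2))) =
    complex_of_real (sqrt (2 * pi) ^ DIM('a) * exp (- (norm z)\<^sup>2 / 2))"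
proof -
  interpret product_sigma_finite "\<lambda>_::'a. lborel :: real measure" ..
  let ?f = "\<lambda>b x. exp (\<i> * complex_of_real ((z \<bullet> b) * x)) * complex_of_real (exp (- x\<^sup>2 / 2))"
  have pt: "exp (\<i> * complex_of_real (z \<bullet> x)) * complex_of_real (exp (- (norm x)\<^sup>2 / 2)) = (\<Prod>b\<in>Basis. ?f b (x \<bullet> b))" for x
  proof -
    have "- (norm x)\<^sup>2 / 2 = (\<Sum>b\<in>Basis. - (x \<bullet> b)\<^sup>2 / 2)"
      unfolding norm_sq_Basis by (simp add: sum_negf sum_divide_distrib[symmetric])
    moreover have "z \<bullet> x = (\<Sum>b\<in>Basis. (z \<bullet> b) * (x \<bullet> b))" by (rule euclidean_inner)
    ultimately show ?thesis
      by (simp only: prod.distrib exp_of_real[symmetric] exp_sum[OF finite_Basis, symmetric] of_real_sum sum_distrib_left)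
  qed
  have sp: "(\<Sum>b\<in>Basis. f b *\<^sub>R b) \<bullet> c = f c" if "c \<in> Basis" for f :: "'a \<Rightarrow> real" and c
    using that by (simp add: inner_sum_left inner_Basis if_distrib cong: if_cong)
  have "(LINT x|lborel. (\<Prod>b\<in>Basis. ?f b (x \<bullet> b))) = (LINT x|(\<Pi>\<^sub>M b\<in>Basis. lborel). (\<Prod>b\<in>Basis. ?f b (x b)))"
    unfolding lborel_eq[where 'a='a]
    by (subst integral_distr) (auto simp: sp intro!: Bochner_Integration.integral_cong prod.cong)
  also have "\<dots> = (\<Prod>b\<in>Basis. (LINT x|lborel. ?f b x))"
  proof (rule product_integral_prod)
    fix b :: 'a assume "b \<in> Basis"
    have "integrable lborel (\<lambda>x::real. exp (- x\<^sup>2 / 2))" using gaussian_integrable[where 'a=real] by simp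
    then show "integrable lborel (?f b)"
      by (rule Bochner_Integration.integrable_bound) (auto simp: norm_mult)
  qed auto
  also have "\<dots> = (\<Prod>b\<in>Basis. complex_of_real (sqrt (2 * pi) * exp (- (z \<bullet> b)\<^sup>2 / 2)))"
    by (simp only: gaussian_char_real)
  also have "\<dots> = complex_of_real (\<Prod>b\<in>Basis. sqrt (2 * pi) * exp (- (z \<bullet> b)\<^sup>2 / 2))"
    by (rule of_real_prod[symmetric])
  also have "(\<Prod>b\<in>Basis. sqrt (2 * pi) * exp (- (z \<bullet> b)\<^sup>2 / 2)) = sqrt (2 * pi) ^ DIM('a) * exp (- (norm z)\<^sup>2 / 2)"
    unfolding prod.distrib exp_sum[OF finite_Basis, symmetric] norm_sq_Basis
    by (simp add: sum_negf sum_divide_distrib[symmetric])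
  finally show ?thesis by (simp only: pt)
qed

lemma gaussian_char_scaled:
  fixes z :: "'a::euclidean_space"
  assumes e: "e > 0"
  shows "(LINT x|lborel. exp (- (\<i> * complex_of_real (z \<bullet> x))) * complex_of_real (exp (- (e * norm x)\<^sup>2 / 2))) =
    complex_of_real ((1 / e) ^ DIM('a) * (sqrt (2 * pi) ^ DIM('a) * exp (- (norm z / e)\<^sup>2 / 2)))"
proof -
  let ?f = "\<lambda>x. exp (- (\<i> * complex_of_real (z \<bullet> x))) * complex_of_real (exp (- (e * norm x)\<^sup>2 / 2))"
  have "(LINT x|lborel. ?f x) = (1 / e) ^ DIM('a) *\<^sub>R (LINT x|lborel. ?f ((1/e) *\<^sub>R x))"
    using e by (subst integral_lborel_scale[where c = "1/e"]) auto
  also have "(\<lambda>x. ?f ((1/e) *\<^sub>R x)) = (\<lambda>x. exp (\<i> * complex_of_real ((- z /\<^sub>R e) \<bullet> x)) * complex_of_real (exp (- (norm x)\<^sup>2 / 2)))"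
  proof
    fix x :: 'a
    have "e * norm ((1/e) *\<^sub>R x) = norm x" "z \<bullet> ((1/e) *\<^sub>R x) = - ((- z /\<^sub>R e) \<bullet> x)"
      using e by (auto simp: divide_inverse)
    then show "?f ((1/e) *\<^sub>R x) = exp (\<i> * complex_of_real ((- z /\<^sub>R e) \<bullet> x)) * complex_of_real (exp (- (norm x)\<^sup>2 / 2))"
      by (simp only: of_real_minus mult_minus_right minus_minus)
  qed
  also have "(LINT x|lborel. \<dots> x) = complex_of_real (sqrt (2 * pi) ^ DIM('a) * exp (- (norm (- z /\<^sub>R e))\<^sup>2 / 2))"
    by (rule gaussian_char)
  also have "norm (- z /\<^sub>R e) = norm z / e" using e by (simp add: divide_inverse_commute)
  finally show ?thesis by (simp add: scaleR_conv_of_real)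
qed

lemma integrable_lborel_product:
  fixes f :: "'a::euclidean_space \<Rightarrow> complex" and g :: "'b::euclidean_space \<Rightarrow> complex"
  assumes f: "integrable lborel f" and g: "integrable lborel g"
  shows "integrable (lborel \<Otimes>\<^sub>M lborel) (\<lambda>(x, y). f x * g y)"
proof (rule lborel_pair.Fubini_integrable)
  have [measurable]: "f \<in> borel_measurable borel" "g \<in> borel_measurable borel" using f g by auto
  show "(\<lambda>(x, y). f x * g y) \<in> borel_measurable (lborel \<Otimes>\<^sub>M lborel)" by measurable
  show "integrable lborel (\<lambda>x. LINT y|lborel. norm (case (x, y) of (x, y) \<Rightarrow> f x * g y))"
    using f by (simp add: norm_mult)
  show "AE x in lborel. integrable lborel (\<lambda>y. case (x, y) of (x, y) \<Rightarrow> f x * g y)"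
    using g by auto
qed

section \<open>Plancherel theorem for integrable functions\<close>

text \<open>
  The normalizing factor of the Fourier transform; the argument \<open>TYPE('n)\<close> only carries the dimension.
\<close>

abbreviation fconst :: "'n::finite itself \<Rightarrow> real" where
  "fconst _ \<equiv> (2 * pi) powr (- (real CARD('n) / 2))"

lemma fconst_sq: "(fconst TYPE('n::finite))\<^sup>2 * sqrt (2 * pi) ^ CARD('n) = fconst TYPE('n)"
proof -
  have "sqrt (2 * pi) ^ CARD('n) = (2 * pi) powr (real CARD('n) / 2)"
    by (simp add: powr_half_sqrt[symmetric] powr_realpow[symmetric] powr_powr)
  then show ?thesis by (simp add: power2_eq_square powr_add[symmetric])
qed

lemma fconst_gauss: "fconst TYPE('n::finite) * sqrt (2 * pi) ^ CARD('n) = 1"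
proof -
  have "sqrt (2 * pi) ^ CARD('n) = (2 * pi) powr (real CARD('n) / 2)"
    by (simp add: powr_half_sqrt[symmetric] powr_realpow[symmetric] powr_powr)
  then show ?thesis by (simp add: powr_add[symmetric])
qed

lemma norm_exp_minus_ii [simp]: "norm (exp (- (\<i> * complex_of_real t))) = 1"
  using norm_exp_i_times[of "- t"] by simp

lemma fourier_integrand_integrable:
  fixes u :: "real ^ 'n \<Rightarrow> complex"
  assumes "integrable lborel u"
  shows "integrable lborel (\<lambda>x. exp (- (\<i> * complex_of_real (x \<bullet> \<xi>))) * u x)"
proof -
  have [measurable]: "u \<in> borel_measurable borel" using assms by auto
  show ?thesis by (rule Bochner_Integration.integrable_bound[OF assms]) (auto simp: norm_mult)
qed

lemma fourier_integral_measurable [measurable]: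
  fixes u :: "real ^ 'n \<Rightarrow> complex"
  assumes [measurable]: "u \<in> borel_measurable borel"
  shows "fourier_integral u \<in> borel_measurable borel"
proof -
  have "(\<lambda>\<xi>. LINT x|lborel. exp (- (\<i> * complex_of_real (x \<bullet> \<xi>))) * u x) \<in> borel_measurable borel"
    by (rule lborel.borel_measurable_lebesgue_integral) measurable
  then show ?thesis unfolding fourier_integral_def[abs_def] by measurable
qed

lemma fourier_integral_add:
  fixes u v :: "real ^ 'n \<Rightarrow> complex"
  assumes "integrable lborel u" "integrable lborel v"
  shows "fourier_integral (\<lambda>x. u x + c * v x) \<xi> = fourier_integral u \<xi> + c * fourier_integral v \<xi>"
proof -
  have "(LINT x|lborel. exp (- (\<i> * complex_of_real (x \<bullet> \<xi>))) * (u x + c * v x)) =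
    (LINT x|lborel. exp (- (\<i> * complex_of_real (x \<bullet> \<xi>))) * u x + c * (exp (- (\<i> * complex_of_real (x \<bullet> \<xi>))) * v x))"
    by (simp add: algebra_simps)
  then show ?thesis unfolding fourier_integral_def
    using fourier_integrand_integrable[OF assms(1), of \<xi>] fourier_integrand_integrable[OF assms(2), of \<xi>]
    by (simp add: scaleR_add_right)
qed

lemma fourier_integral_diff:
  fixes u v :: "real ^ 'n \<Rightarrow> complex"
  assumes "integrable lborel u" "integrable lborel v"
  shows "fourier_integral (\<lambda>x. u x - v x) \<xi> = fourier_integral u \<xi> - fourier_integral v \<xi>"
  using fourier_integral_add[OF assms, of "-1"] by simp

lemma norm_fourier_integral_le:
  fixes u :: "real ^ 'n \<Rightarrow> complex"
  assumes "integrable lborel u"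
  shows "norm (fourier_integral u \<xi>) \<le> fconst TYPE('n) * (LINT x|lborel. norm (u x))"
proof -
  have "norm (LINT x|lborel. exp (- (\<i> * complex_of_real (x \<bullet> \<xi>))) * u x) \<le> (LINT x|lborel. norm (exp (- (\<i> * complex_of_real (x \<bullet> \<xi>))) * u x))"
    by (rule integral_norm_bound)
  also have "\<dots> = (LINT x|lborel. norm (u x))" by (simp add: norm_mult)
  finally show ?thesis by (simp add: fourier_integral_def mult_left_mono)
qed

lemma fourier_integral_translate:
  fixes u :: "real ^ 'n \<Rightarrow> complex"
  assumes [measurable]: "u \<in> borel_measurable borel"
  shows "fourier_integral (\<lambda>x. u (x + h)) \<xi> = exp (\<i> * complex_of_real (h \<bullet> \<xi>)) * fourier_integral u \<xi>"
proof -
  have "(LINT x|lborel. exp (- (\<i> * complex_of_real (x \<bullet> \<xi>))) * u (x + h)) =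
        (LINT x|lborel. exp (\<i> * complex_of_real (h \<bullet> \<xi>)) * (exp (- (\<i> * complex_of_real ((x + h) \<bullet> \<xi>))) * u (x + h)))"
    by (rule Bochner_Integration.integral_cong) (auto simp: inner_add_left mult.assoc[symmetric] exp_add[symmetric] algebra_simps)
  also have "\<dots> = exp (\<i> * complex_of_real (h \<bullet> \<xi>)) * (LINT x|lborel. exp (- (\<i> * complex_of_real ((x + h) \<bullet> \<xi>))) * u (x + h))"
    by simp
  also have "(LINT x|lborel. exp (- (\<i> * complex_of_real ((x + h) \<bullet> \<xi>))) * u (x + h)) = (LINT x|lborel. exp (- (\<i> * complex_of_real (x \<bullet> \<xi>))) * u x)"
    by (rule integral_lborel_translate[of "\<lambda>x. exp (- (\<i> * complex_of_real (x \<bullet> \<xi>))) * u x"]) auto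
  finally show ?thesis by (simp add: fourier_integral_def)
qed

text \<open>
  The convolution of \<open>u\<close> with its conjugate reflection; up to a factor its Fourier transform is the squared modulus of that
  of \<open>u\<close>, and its value at \<open>0\<close> is \<open>\<parallel>u\<parallel>\<^sup>2\<close>.
\<close>

definition autocorrelation :: "(real ^ 'n \<Rightarrow> complex) \<Rightarrow> real ^ 'n \<Rightarrow> complex" where
  "autocorrelation u h = (LINT x|lborel. u (x + h) * cnj (u x))"

context
  fixes u :: "real ^ 'n \<Rightarrow> complex"
  assumes u1: "integrable lborel u"
begin

lemma autocorrelation_product_integrable:
  "integrable (lborel \<Otimes>\<^sub>M lborel) (\<lambda>(x, h). u (x + h) * cnj (u x))"
proof (rule lborel_pair.Fubini_integrable)
  have [measurable]: "u \<in> borel_measurable borel" using u1 by auto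
  show "(\<lambda>(x, h). u (x + h) * cnj (u x)) \<in> borel_measurable (lborel \<Otimes>\<^sub>M lborel)" by measurable
  have "(LINT h|lborel. norm (u (x + h) * cnj (u x))) = (LINT h|lborel. norm (u h)) * norm (u x)" for x
    using integral_lborel_translate[of "\<lambda>h. norm (u h)" x] by (simp add: norm_mult add.commute)
  then show "integrable lborel (\<lambda>x. LINT h|lborel. norm (case (x, h) of (x, h) \<Rightarrow> u (x + h) * cnj (u x)))"
    using u1 by simp
  show "AE x in lborel. integrable lborel (\<lambda>h. case (x, h) of (x, h) \<Rightarrow> u (x + h) * cnj (u x))"
    using integrable_lborel_translate[OF u1] by (auto simp: add.commute)
qed

lemma autocorrelation_integrable: "integrable lborel (autocorrelation u)"
proof -
  have "integrable (lborel \<Otimes>\<^sub>M lborel) (\<lambda>(h, x). u (x + h) * cnj (u x))"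
    using lborel_pair.integrable_product_swap[OF autocorrelation_product_integrable] by (simp add: case_prod_unfold)
  from lborel_pair.integrable_fst[OF this] show ?thesis by (simp add: autocorrelation_def[abs_def])
qed

lemma fourier_integral_sq:
  "complex_of_real ((norm (fourier_integral u \<xi>))\<^sup>2) =
     (fconst TYPE('n))\<^sup>2 *\<^sub>R (LINT h|lborel. exp (- (\<i> * complex_of_real (h \<bullet> \<xi>))) * autocorrelation u h)"
proof -
  have [measurable]: "u \<in> borel_measurable borel" using u1 by auto
  let ?e = "\<lambda>h. exp (- (\<i> * complex_of_real (h \<bullet> \<xi>)))"
  have prod_int: "integrable (lborel \<Otimes>\<^sub>M lborel) (\<lambda>(x, h). ?e h * (u (x + h) * cnj (u x)))"
    by (rule Bochner_Integration.integrable_bound[OF autocorrelation_product_integrable]) (auto simp: norm_mult)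
  let ?I = "LINT x|lborel. ?e x * u x"
  have "(LINT h|lborel. ?e h * autocorrelation u h) = (LINT h|lborel. (LINT x|lborel. ?e h * (u (x + h) * cnj (u x))))"
    by (simp add: autocorrelation_def)
  also have "\<dots> = (LINT x|lborel. (LINT h|lborel. ?e h * (u (x + h) * cnj (u x))))"
    using lborel_pair.Fubini_integral[OF prod_int] by simp
  also have "\<dots> = (LINT x|lborel. cnj (?e x * u x) * ?I)"
  proof (rule Bochner_Integration.integral_cong[OF refl])
    fix x
    have ec: "cnj (?e x) = exp (\<i> * complex_of_real (x \<bullet> \<xi>))" by (simp add: exp_cnj)
    have "(LINT h|lborel. ?e h * (u (x + h) * cnj (u x))) = (LINT h|lborel. cnj (?e x * u x) * (?e (h + x) * u (h + x)))"
      unfolding complex_cnj_mult ec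
      by (rule Bochner_Integration.integral_cong) (auto simp: inner_add_left exp_add[symmetric] algebra_simps)
    also have "\<dots> = cnj (?e x * u x) * (LINT h|lborel. ?e (h + x) * u (h + x))" by simp
    also have "(LINT h|lborel. ?e (h + x) * u (h + x)) = ?I"
      by (rule integral_lborel_translate[of "\<lambda>x. ?e x * u x"]) auto
    finally show "(LINT h|lborel. ?e h * (u (x + h) * cnj (u x))) = cnj (?e x * u x) * ?I" .
  qed
  also have "\<dots> = (LINT x|lborel. cnj (?e x * u x)) * ?I"
    by simp
  also have "(LINT x|lborel. cnj (?e x * u x)) = cnj ?I" by (rule Bochner_Integration.integral_cnj)
  finally have "(LINT h|lborel. ?e h * autocorrelation u h) = ?I * cnj ?I" by (simp add: mult.commute)
  also have "\<dots> = complex_of_real ((norm ?I)\<^sup>2)" by (rule complex_norm_square[symmetric])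
  finally show ?thesis
    unfolding fourier_integral_def norm_scaleR power_mult_distrib of_real_mult
    by (simp add: scaleR_conv_of_real)
qed

text \<open>
  The Gaussian weight makes the double integral absolutely convergent. Its own Fourier transform
  concentrates on the scale \<open>e\<close>, which after rescaling leaves an average of the autocorrelation near \<open>0\<close>.
\<close>

lemma gaussian_weighted_fourier:
  assumes e: "e > 0"
  shows "complex_of_real (LINT \<xi>|lborel. (norm (fourier_integral u \<xi>))\<^sup>2 * exp (- (e * norm \<xi>)\<^sup>2 / 2)) =
    fconst TYPE('n) *\<^sub>R (LINT h|lborel. exp (- (norm h)\<^sup>2 / 2) *\<^sub>R autocorrelation u (e *\<^sub>R h))"
proof -
  let ?g = "\<lambda>\<xi>::real^'n. complex_of_real (exp (- (e * norm \<xi>)\<^sup>2 / 2))"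
  let ?A = "autocorrelation u" and ?c = "fconst TYPE('n)"
  have [measurable]: "?A \<in> borel_measurable borel" using autocorrelation_integrable by auto
  have gi: "integrable lborel ?g"
  proof -
    have "integrable lborel (\<lambda>\<xi>::real^'n. exp (- (e * norm \<xi>)\<^sup>2 / 2))" by (rule gaussian_scaled_integrable[OF e])
    then show ?thesis by (rule integrable_of_real)
  qed
  have pint: "integrable (lborel \<Otimes>\<^sub>M lborel) (\<lambda>(h, \<xi>). exp (- (\<i> * complex_of_real (h \<bullet> \<xi>))) * (?A h * ?g \<xi>))"
    by (rule Bochner_Integration.integrable_bound[OF integrable_lborel_product[OF autocorrelation_integrable gi]])
      (auto simp: norm_mult)
  have "complex_of_real (LINT \<xi>|lborel. (norm (fourier_integral u \<xi>))\<^sup>2 * exp (- (e * norm \<xi>)\<^sup>2 / 2)) =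
      (LINT \<xi>|lborel. complex_of_real ((norm (fourier_integral u \<xi>))\<^sup>2) * ?g \<xi>)"
    by (simp only: integral_complex_of_real[symmetric] of_real_mult)
  also have "\<dots> = (LINT \<xi>|lborel. ?c\<^sup>2 *\<^sub>R (LINT h|lborel. exp (- (\<i> * complex_of_real (h \<bullet> \<xi>))) * (?A h * ?g \<xi>)))"
    unfolding fourier_integral_sq by (simp add: mult.assoc[symmetric])
  also have "\<dots> = ?c\<^sup>2 *\<^sub>R (LINT \<xi>|lborel. (LINT h|lborel. exp (- (\<i> * complex_of_real (h \<bullet> \<xi>))) * (?A h * ?g \<xi>)))"
    by (rule integral_scaleR_right) 
  also have "(LINT \<xi>|lborel. (LINT h|lborel. exp (- (\<i> * complex_of_real (h \<bullet> \<xi>))) * (?A h * ?g \<xi>))) =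
      (LINT h|lborel. (LINT \<xi>|lborel. exp (- (\<i> * complex_of_real (h \<bullet> \<xi>))) * (?A h * ?g \<xi>)))"
    using lborel_pair.Fubini_integral[OF pint] by simp
  also have "\<dots> = (LINT h|lborel. ?A h * complex_of_real ((1 / e) ^ CARD('n) * (sqrt (2 * pi) ^ CARD('n) * exp (- (norm h / e)\<^sup>2 / 2))))"
  proof (rule Bochner_Integration.integral_cong[OF refl])
    fix h
    have "(LINT \<xi>|lborel. exp (- (\<i> * complex_of_real (h \<bullet> \<xi>))) * (?A h * ?g \<xi>)) =
        (LINT \<xi>|lborel. ?A h * (exp (- (\<i> * complex_of_real (h \<bullet> \<xi>))) * ?g \<xi>))"
      by (rule Bochner_Integration.integral_cong) auto
    also have "\<dots> = ?A h * (LINT \<xi>|lborel. exp (- (\<i> * complex_of_real (h \<bullet> \<xi>))) * ?g \<xi>)" by simp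
    finally show "(LINT \<xi>|lborel. exp (- (\<i> * complex_of_real (h \<bullet> \<xi>))) * (?A h * ?g \<xi>)) =
       ?A h * complex_of_real ((1 / e) ^ CARD('n) * (sqrt (2 * pi) ^ CARD('n) * exp (- (norm h / e)\<^sup>2 / 2)))"
      unfolding gaussian_char_scaled[OF e] by simp
  qed
  also have "\<dots> = e ^ CARD('n) *\<^sub>R (LINT h|lborel. ?A (e *\<^sub>R h) * complex_of_real ((1 / e) ^ CARD('n) * (sqrt (2 * pi) ^ CARD('n) * exp (- (norm (e *\<^sub>R h) / e)\<^sup>2 / 2))))"
    using e by (subst integral_lborel_scale[where c = e]) auto
  also have "(LINT h|lborel. ?A (e *\<^sub>R h) * complex_of_real ((1 / e) ^ CARD('n) * (sqrt (2 * pi) ^ CARD('n) * exp (- (norm (e *\<^sub>R h) / e)\<^sup>2 / 2)))) =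
     (LINT h|lborel. ((1 / e) ^ CARD('n) * sqrt (2 * pi) ^ CARD('n)) *\<^sub>R (exp (- (norm h)\<^sup>2 / 2) *\<^sub>R ?A (e *\<^sub>R h)))"
    using e by (intro Bochner_Integration.integral_cong) (auto simp: scaleR_conv_of_real[where 'a=complex])
  also have "\<dots> = ((1 / e) ^ CARD('n) * sqrt (2 * pi) ^ CARD('n)) *\<^sub>R (LINT h|lborel. exp (- (norm h)\<^sup>2 / 2) *\<^sub>R ?A (e *\<^sub>R h))"
    by (rule integral_scaleR_right)
  finally have r: "complex_of_real (LINT \<xi>|lborel. (norm (fourier_integral u \<xi>))\<^sup>2 * exp (- (e * norm \<xi>)\<^sup>2 / 2)) =
    (?c\<^sup>2 * (e ^ CARD('n) * ((1 / e) ^ CARD('n) * sqrt (2 * pi) ^ CARD('n)))) *\<^sub>R (LINT h|lborel. exp (- (norm h)\<^sup>2 / 2) *\<^sub>R ?A (e *\<^sub>R h))"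
    by simp
  have c: "e ^ CARD('n) * ((1 / e) ^ CARD('n) * sqrt (2 * pi) ^ CARD('n)) = sqrt (2 * pi) ^ CARD('n)"
    using e by (simp add: power_one_over)
  show ?thesis unfolding r c fconst_sq ..
qed

text \<open>
  By the Cauchy-Schwarz inequality applied to the inner product of \<open>u (x + h) - u x\<close> with \<open>u\<close>, this is
  continuity of translations.
\<close>

lemma autocorrelation_tendsto:
  assumes u2: "u \<in> L2_on lborel" and h: "h \<longlonglongrightarrow> 0"
  shows "(\<lambda>k. autocorrelation u (h k)) \<longlonglongrightarrow> complex_of_real (norm2_on lborel u)"
proof -
  have eq: "autocorrelation u (h k) - complex_of_real (norm2_on lborel u) = inner_on lborel (\<lambda>x. u (x + h k) - u x) u" for k
    unfolding inner_on_diff_left[OF L2_on_translate[OF u2] u2 u2] inner_on_self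
    by (simp add: autocorrelation_def inner_on_def)
  have lim: "(\<lambda>k. norm2_on lborel (\<lambda>x. u (x + h k) - u x)) \<longlonglongrightarrow> 0"
    using L2_translation_continuous[OF u2] h by (auto simp: translation_continuous_def)
  have "(\<lambda>k. sqrt (norm2_on lborel (\<lambda>x. u (x + h k) - u x) * norm2_on lborel u)) \<longlonglongrightarrow> sqrt (0 * norm2_on lborel u)"
    by (intro tendsto_intros lim)
  then have lim': "(\<lambda>k. sqrt (norm2_on lborel (\<lambda>x. u (x + h k) - u x) * norm2_on lborel u)) \<longlonglongrightarrow> 0" by simp
  have "(\<lambda>k. norm (autocorrelation u (h k) - complex_of_real (norm2_on lborel u))) \<longlonglongrightarrow> 0"
  proof (rule tendsto_zero_squeeze[OF lim'])
    fix k
    show "norm (autocorrelation u (h k) - complex_of_real (norm2_on lborel u)) \<le> sqrt (norm2_on lborel (\<lambda>x. u (x + h k) - u x) * norm2_on lborel u)"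
      unfolding eq by (rule real_le_rsqrt[OF inner_on_Cauchy_Schwarz[OF L2_on_diff[OF L2_on_translate[OF u2] u2] u2]])
  qed simp
  then show ?thesis by (simp add: tendsto_norm_zero_iff LIM_zero_iff)
qed

lemma norm_autocorrelation_le:
  assumes u2: "u \<in> L2_on lborel" shows "norm (autocorrelation u h) \<le> norm2_on lborel u"
proof -
  have [measurable]: "u \<in> borel_measurable borel" using u1 by auto
  have "(norm (autocorrelation u h))\<^sup>2 \<le> norm2_on lborel (\<lambda>x. u (x + h)) * norm2_on lborel u"
    using inner_on_Cauchy_Schwarz[OF L2_on_translate[OF u2] u2] by (simp add: autocorrelation_def inner_on_def)
  also have "\<dots> = (norm2_on lborel u)\<^sup>2" by (simp add: norm2_on_translate power2_eq_square)
  finally show ?thesis by (rule power2_le_imp_le) simp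
qed

text \<open>
  The limit \<open>e \<rightarrow> 0\<close> in \<open>gaussian_weighted_fourier\<close>: monotone convergence on the side of the
  transform, dominated convergence on the side of the autocorrelation. Finiteness of the limit also shows that the
  transform is square integrable.
\<close>

theorem Plancherel:
  assumes u2: "u \<in> L2_on lborel"
  shows "fourier_integral u \<in> L2_on lborel" "norm2_on lborel (fourier_integral u) = norm2_on lborel u"
proof -
  have [measurable]: "u \<in> borel_measurable borel" using u1 by auto
  have [measurable]: "autocorrelation u \<in> borel_measurable borel" using autocorrelation_integrable by auto
  let ?c = "fconst TYPE('n)"
  define e where "e = (\<lambda>k::nat. inverse (real (Suc k)))"
  have e: "e k > 0" for k by (simp add: e_def)
  have e0: "e \<longlonglongrightarrow> 0" unfolding e_def by (rule LIMSEQ_inverse_real_of_nat)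
  have edec: "e (Suc k) \<le> e k" for k by (simp add: e_def)
  define J where "J = (\<lambda>k. LINT \<xi>|lborel. (norm (fourier_integral u \<xi>))\<^sup>2 * exp (- (e k * norm \<xi>)\<^sup>2 / 2))"
  have "(\<lambda>k. LINT h|lborel. exp (- (norm h)\<^sup>2 / 2) *\<^sub>R autocorrelation u (e k *\<^sub>R h)) \<longlonglongrightarrow>
     (LINT h|(lborel :: (real^'n) measure). exp (- (norm h)\<^sup>2 / 2) *\<^sub>R complex_of_real (norm2_on lborel u))"
  proof (rule Bochner_Integration.integral_dominated_convergence[where w = "\<lambda>h. exp (- (norm h)\<^sup>2 / 2) * norm2_on lborel u"])
    show "integrable lborel (\<lambda>h::real^'n. exp (- (norm h)\<^sup>2 / 2) * norm2_on lborel u)"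
      using gaussian_integrable[where 'a="real^'n"] by (intro integrable_mult_left) auto
    show "AE h in lborel. (\<lambda>k. exp (- (norm h)\<^sup>2 / 2) *\<^sub>R autocorrelation u (e k *\<^sub>R h)) \<longlonglongrightarrow> exp (- (norm h)\<^sup>2 / 2) *\<^sub>R complex_of_real (norm2_on lborel u)"
    proof (intro AE_I2 tendsto_scaleR tendsto_const autocorrelation_tendsto u2)
      fix h :: "real^'n"
      have "(\<lambda>k. e k *\<^sub>R h) \<longlonglongrightarrow> 0 *\<^sub>R h" by (intro tendsto_intros e0)
      then show "(\<lambda>k. e k *\<^sub>R h) \<longlonglongrightarrow> 0" by simp
    qed
    show "AE h in lborel. norm (exp (- (norm h)\<^sup>2 / 2) *\<^sub>R autocorrelation u (e k *\<^sub>R h)) \<le> exp (- (norm h)\<^sup>2 / 2) * norm2_on lborel u" for k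
      using norm_autocorrelation_le[OF u2] by (auto intro!: mult_left_mono)
  qed auto
  also have "(LINT h|(lborel :: (real^'n) measure). exp (- (norm h)\<^sup>2 / 2) *\<^sub>R complex_of_real (norm2_on lborel u)) =
      (LINT h|(lborel :: (real^'n) measure). exp (- (norm h)\<^sup>2 / 2)) *\<^sub>R complex_of_real (norm2_on lborel u)"
    by (rule integral_scaleR_left) (use gaussian_integrable[where 'a="real^'n"] in auto)
  finally have "(\<lambda>k. ?c *\<^sub>R (LINT h|lborel. exp (- (norm h)\<^sup>2 / 2) *\<^sub>R autocorrelation u (e k *\<^sub>R h))) \<longlonglongrightarrow>
     ?c *\<^sub>R (sqrt (2 * pi) ^ CARD('n) *\<^sub>R complex_of_real (norm2_on lborel u))"
    unfolding gaussian_integral by (intro tendsto_intros) simp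
  then have "(\<lambda>k. complex_of_real (J k)) \<longlonglongrightarrow> complex_of_real (norm2_on lborel u)"
    unfolding J_def gaussian_weighted_fourier[OF e] using fconst_gauss[where 'n='n] by simp
  then have J: "J \<longlonglongrightarrow> norm2_on lborel u" by (simp only: tendsto_of_real_iff)
  let ?G = "\<lambda>k \<xi>. ennreal ((norm (fourier_integral u \<xi>))\<^sup>2 * exp (- (e k * norm \<xi>)\<^sup>2 / 2))"
  have Gi: "integrable lborel (\<lambda>\<xi>. (norm (fourier_integral u \<xi>))\<^sup>2 * exp (- (e k * norm \<xi>)\<^sup>2 / 2))" for k
  proof (rule Bochner_Integration.integrable_bound)
    have "integrable lborel (\<lambda>\<xi>::real^'n. exp (- (e k * norm \<xi>)\<^sup>2 / 2))" by (rule gaussian_scaled_integrable[OF e])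
    then show "integrable lborel (\<lambda>\<xi>::real^'n. (?c * (LINT x|lborel. norm (u x)))\<^sup>2 * exp (- (e k * norm \<xi>)\<^sup>2 / 2))"
      by (rule integrable_mult_right)
    show "AE \<xi> in lborel. norm ((norm (fourier_integral u \<xi>))\<^sup>2 * exp (- (e k * norm \<xi>)\<^sup>2 / 2)) \<le>
        norm ((?c * (LINT x|lborel. norm (u x)))\<^sup>2 * exp (- (e k * norm \<xi>)\<^sup>2 / 2))"
      using norm_fourier_integral_le[OF u1] by (auto simp: abs_mult intro!: mult_right_mono power_mono)
  qed auto
  have "(\<lambda>k. \<integral>\<^sup>+\<xi>. ?G k \<xi> \<partial>lborel) \<longlonglongrightarrow> (\<integral>\<^sup>+\<xi>. ennreal ((norm (fourier_integral u \<xi>))\<^sup>2) \<partial>lborel)"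
  proof (rule nn_integral_LIMSEQ)
    show "incseq ?G"
    proof (intro incseq_SucI le_funI ennreal_leI mult_left_mono)
      fix k and \<xi> :: "real^'n"
      have "(e (Suc k) * norm \<xi>)\<^sup>2 \<le> (e k * norm \<xi>)\<^sup>2"
        using e[of "Suc k"] by (intro power_mono mult_right_mono edec) auto
      then show "exp (- (e k * norm \<xi>)\<^sup>2 / 2) \<le> exp (- (e (Suc k) * norm \<xi>)\<^sup>2 / 2)" by simp
    qed simp
    show "(\<lambda>k. ?G k \<xi>) \<longlonglongrightarrow> ennreal ((norm (fourier_integral u \<xi>))\<^sup>2)" for \<xi>
    proof (intro tendsto_ennrealI)
      have "(\<lambda>k. (norm (fourier_integral u \<xi>))\<^sup>2 * exp (- (e k * norm \<xi>)\<^sup>2 / 2)) \<longlonglongrightarrow> (norm (fourier_integral u \<xi>))\<^sup>2 * exp (- (0 * norm \<xi>)\<^sup>2 / 2)"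
        by (intro tendsto_intros e0) auto
      then show "(\<lambda>k. (norm (fourier_integral u \<xi>))\<^sup>2 * exp (- (e k * norm \<xi>)\<^sup>2 / 2)) \<longlonglongrightarrow> (norm (fourier_integral u \<xi>))\<^sup>2" by simp
    qed
  qed auto
  moreover have "(\<integral>\<^sup>+\<xi>. ?G k \<xi> \<partial>lborel) = ennreal (J k)" for k
    unfolding J_def by (intro nn_integral_eq_integral Gi) auto
  moreover have "(\<lambda>k. ennreal (J k)) \<longlonglongrightarrow> ennreal (norm2_on lborel u)" by (intro tendsto_ennrealI J)
  ultimately have eq: "(\<integral>\<^sup>+\<xi>. ennreal ((norm (fourier_integral u \<xi>))\<^sup>2) \<partial>lborel) = ennreal (norm2_on lborel u)"
    using LIMSEQ_unique by auto
  then show L: "fourier_integral u \<in> L2_on lborel" by (auto simp: L2_on_iff_nn)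
  show "norm2_on lborel (fourier_integral u) = norm2_on lborel u"
    using eq nn_norm2_on[OF L] by simp
qed

end

section \<open>Fourier transform on square integrable functions\<close>

lemma L2_eq_L2_on: "L2 = L2_on lborel"
  by (simp add: L2_def L2_on_def)

definition truncation :: "real \<Rightarrow> (real ^ 'n \<Rightarrow> complex) \<Rightarrow> real ^ 'n \<Rightarrow> complex" where
  "truncation R u = (\<lambda>x. indicator (ball 0 R) x *\<^sub>R u x)"

lemma truncation_measurable [measurable (raw)]:
  "u \<in> borel_measurable borel \<Longrightarrow> truncation R u \<in> borel_measurable borel"
  unfolding truncation_def
  by (intro borel_measurable_scaleR borel_measurable_indicator) auto

lemma L2_on_bounded_integrable:
  fixes u :: "'a::euclidean_space \<Rightarrow> complex"
  assumes u: "u \<in> L2_on lborel" and B: "B \<in> sets borel" "bounded B" and v: "AE x in lborel. x \<notin> B \<longrightarrow> u x = 0"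
  shows "integrable lborel u"
proof (rule Bochner_Integration.integrable_bound)
  have [measurable]: "u \<in> borel_measurable borel" using u by (auto simp: L2_on_def)
  show "u \<in> borel_measurable lborel" by measurable
  have "emeasure lborel B < \<infinity>" using B emeasure_bounded_finite by auto
  then show "integrable lborel (\<lambda>x. indicator B x + (norm (u x))\<^sup>2 :: real)"
    using L2_on_integrable[OF u] B by (intro Bochner_Integration.integrable_add) auto
  show "AE x in lborel. norm (u x) \<le> norm (indicator B x + (norm (u x))\<^sup>2 :: real)"
    using v
  proof eventually_elim
    case (elim x)
    have "norm (u x) \<le> 1 + (norm (u x))\<^sup>2"
      using sum_squares_bound[of 1 "norm (u x)"] norm_ge_zero[of "u x"] unfolding power_one by linarith
    then show ?case using elim by (auto simp: indicator_def)
  qed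
qed

context
  fixes u :: "real ^ 'n \<Rightarrow> complex"
  assumes u: "u \<in> L2_on lborel"
begin

lemma truncation_L2: "truncation R u \<in> L2_on lborel"
proof -
  have [measurable]: "u \<in> borel_measurable borel" using u by (auto simp: L2_on_def)
  have "integrable lborel (\<lambda>x. (norm (truncation R u x))\<^sup>2)"
    by (rule Bochner_Integration.integrable_bound[OF L2_on_integrable[OF u]])
      (auto simp: truncation_def indicator_def)
  then show ?thesis by (auto simp: L2_on_def)
qed

lemma truncation_integrable: "integrable lborel (truncation R u)"
  by (rule L2_on_bounded_integrable[OF truncation_L2, of "ball 0 R"]) (auto simp: truncation_def)

lemma truncation_tendsto: "((\<lambda>R. norm2_on lborel (\<lambda>x. truncation R u x - u x)) \<longlongrightarrow> 0) at_top"
proof -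
  have [measurable]: "u \<in> borel_measurable borel" using u by (auto simp: L2_on_def)
  have "((\<lambda>R. LINT x|lborel. (norm (truncation R u x - u x))\<^sup>2) \<longlongrightarrow> (LINT x|(lborel :: (real^'n) measure). (0::real))) at_top"
  proof (rule integral_dominated_convergence_at_top[where w = "\<lambda>x. (norm (u x))\<^sup>2"])
    show "AE x in lborel. ((\<lambda>R. (norm (truncation R u x - u x))\<^sup>2) \<longlongrightarrow> 0) at_top"
    proof (rule AE_I2)
      fix x :: "real^'n"
      have "\<forall>\<^sub>F R in at_top. (norm (truncation R u x - u x))\<^sup>2 = 0"
        using eventually_gt_at_top[of "norm x"] by eventually_elim (auto simp: truncation_def)
      then show "((\<lambda>R. (norm (truncation R u x - u x))\<^sup>2) \<longlongrightarrow> 0) at_top" by (rule tendsto_eventually)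
    qed
    show "\<forall>\<^sub>F R in at_top. AE x in lborel. norm ((norm (truncation R u x - u x))\<^sup>2) \<le> (norm (u x))\<^sup>2"
      by (auto simp: truncation_def indicator_def)
  qed (use L2_on_integrable[OF u] in auto)
  then show ?thesis by (simp add: norm2_on_def)
qed

lemma has_fourier_iff:
  "has_fourier u U \<longleftrightarrow> U \<in> L2_on lborel \<and>
     ((\<lambda>R. norm2_on lborel (\<lambda>\<xi>. fourier_integral (truncation R u) \<xi> - U \<xi>)) \<longlongrightarrow> 0) at_top"
proof (cases "U \<in> L2_on lborel")
  case True
  have "(\<integral>\<^sup>+ \<xi>. ennreal ((norm (fourier_integral (truncation R u) \<xi> - U \<xi>))\<^sup>2) \<partial>lborel) =
     ennreal (norm2_on lborel (\<lambda>\<xi>. fourier_integral (truncation R u) \<xi> - U \<xi>))" for R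
    by (intro nn_norm2_on L2_on_diff True Plancherel truncation_L2 truncation_integrable)
  then show ?thesis using True
    by (simp add: has_fourier_def L2_eq_L2_on truncation_def[symmetric] flip: ennreal_0)
qed (simp add: has_fourier_def L2_eq_L2_on)

lemma fourier_truncation_diff:
  "norm2_on lborel (\<lambda>\<xi>. fourier_integral (truncation R u) \<xi> - fourier_integral (truncation S u) \<xi>)
    \<le> 2 * norm2_on lborel (\<lambda>x. truncation R u x - u x) + 2 * norm2_on lborel (\<lambda>x. truncation S u x - u x)"
proof -
  let ?L = "fourier_integral (\<lambda>x. truncation R u x - truncation S u x)"
  have e: "(\<lambda>\<xi>. fourier_integral (truncation R u) \<xi> - fourier_integral (truncation S u) \<xi>) =
     fourier_integral (\<lambda>x. truncation R u x - truncation S u x)"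
    by (auto simp: fourier_integral_diff truncation_integrable)
  have "norm2_on lborel ?L = norm2_on lborel (\<lambda>x. truncation R u x - truncation S u x)"
    by (intro Plancherel L2_on_diff truncation_L2 Bochner_Integration.integrable_diff truncation_integrable)
  also have "\<dots> \<le> 2 * norm2_on lborel (\<lambda>x. truncation R u x - u x) + 2 * norm2_on lborel (\<lambda>x. u x - truncation S u x)"
    by (intro norm2_on_triangle truncation_L2 u)
  finally show ?thesis unfolding e using norm2_on_commute[of lborel u "truncation S u"] by simp
qed

text \<open>
  By Plancherel the transforms of the truncations to balls of integer radius form a Cauchy sequence. The bound
  of the distance to the limit by \<open>4 * ?d R\<close> holds for every real radius, which the definition asks for.
\<close>

lemma has_fourier_exists: "\<exists>U. has_fourier u U \<and> norm2_on lborel U = norm2_on lborel u"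
proof -
  let ?d = "\<lambda>R. norm2_on lborel (\<lambda>x. truncation R u x - u x)"
  let ?F = "\<lambda>R. fourier_integral (truncation R u)"
  have FL: "?F R \<in> L2_on lborel" for R by (intro Plancherel truncation_L2 truncation_integrable)
  have d: "(\<lambda>k. ?d (real k)) \<longlonglongrightarrow> 0"
    using filterlim_compose[OF truncation_tendsto filterlim_real_sequentially] .
  have "L2_Cauchy lborel (\<lambda>k. ?F (real k))"
    unfolding L2_Cauchy_def
  proof (intro allI impI)
    fix e :: real assume "e > 0"
    then obtain N where N: "\<And>k. k \<ge> N \<Longrightarrow> ?d (real k) < e / 4"
      using LIMSEQ_D[OF d, of "e/4"] by auto
    have "norm2_on lborel (\<lambda>\<xi>. ?F (real k) \<xi> - ?F (real l) \<xi>) < e" if "k \<ge> N" "l \<ge> N" for k l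
      using fourier_truncation_diff[of "real k" "real l"] N[OF that(1)] N[OF that(2)] by linarith
    then show "\<exists>N. \<forall>k\<ge>N. \<forall>l\<ge>N. norm2_on lborel (\<lambda>\<xi>. ?F (real k) \<xi> - ?F (real l) \<xi>) < e" by blast
  qed
  from L2_complete[OF FL this] obtain U where U: "U \<in> L2_on lborel"
    "(\<lambda>k. norm2_on lborel (\<lambda>\<xi>. ?F (real k) \<xi> - U \<xi>)) \<longlonglongrightarrow> 0" by blast
  have bd: "norm2_on lborel (\<lambda>\<xi>. ?F R \<xi> - U \<xi>) \<le> 4 * ?d R" for R
  proof (rule LIMSEQ_le_const)
    have "(\<lambda>k. 4 * ?d R + 4 * ?d (real k) + 2 * norm2_on lborel (\<lambda>\<xi>. ?F (real k) \<xi> - U \<xi>)) \<longlonglongrightarrow> 4 * ?d R + 4 * 0 + 2 * 0"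
      by (intro tendsto_intros d U)
    then show "(\<lambda>k. 4 * ?d R + 4 * ?d (real k) + 2 * norm2_on lborel (\<lambda>\<xi>. ?F (real k) \<xi> - U \<xi>)) \<longlonglongrightarrow> 4 * ?d R" by simp
    have "norm2_on lborel (\<lambda>\<xi>. ?F R \<xi> - U \<xi>) \<le> 4 * ?d R + 4 * ?d (real k) + 2 * norm2_on lborel (\<lambda>\<xi>. ?F (real k) \<xi> - U \<xi>)" for k
      using norm2_on_triangle[OF FL[of R] FL[of "real k"] U(1)] fourier_truncation_diff[of R "real k"] by linarith
    then show "\<exists>N. \<forall>k\<ge>N. norm2_on lborel (\<lambda>\<xi>. ?F R \<xi> - U \<xi>) \<le> 4 * ?d R + 4 * ?d (real k) + 2 * norm2_on lborel (\<lambda>\<xi>. ?F (real k) \<xi> - U \<xi>)"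
      by blast
  qed
  have lim: "((\<lambda>R. 4 * ?d R) \<longlongrightarrow> 0) at_top"
    using tendsto_mult_left[OF truncation_tendsto, of 4] by simp
  have "((\<lambda>R. norm2_on lborel (\<lambda>\<xi>. ?F R \<xi> - U \<xi>)) \<longlongrightarrow> 0) at_top"
    by (rule tendsto_zero_squeeze[OF lim norm2_on_nonneg bd])
  then have h: "has_fourier u U" using U by (simp add: has_fourier_iff)
  have "(\<lambda>k. norm2_on lborel (?F (real k))) \<longlonglongrightarrow> norm2_on lborel U" by (rule norm2_on_tendsto[OF FL U])
  moreover have "norm2_on lborel (?F (real k)) = norm2_on lborel (truncation (real k) u)" for k
    by (intro Plancherel truncation_L2 truncation_integrable)
  moreover have "(\<lambda>k. norm2_on lborel (truncation (real k) u)) \<longlonglongrightarrow> norm2_on lborel u"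
    by (rule norm2_on_tendsto[OF truncation_L2 u d])
  ultimately have "norm2_on lborel U = norm2_on lborel u" using LIMSEQ_unique by auto
  then show ?thesis using h by blast
qed

end

lemma norm2_on_eq_0:
  assumes "f \<in> L2_on M" "norm2_on M f = 0" shows "AE x in M. f x = 0"
proof -
  have "AE x in M. (norm (f x))\<^sup>2 = 0"
    using assms integral_nonneg_eq_0_iff_AE[of M "\<lambda>x. (norm (f x))\<^sup>2"] by (auto simp: norm2_on_def L2_on_def)
  then show ?thesis by eventually_elim simp
qed

lemma norm2_on_cong_AE:
  assumes "AE x in M. f x = g x" "f \<in> borel_measurable M" "g \<in> borel_measurable M"
  shows "norm2_on M f = norm2_on M g"
proof -
  have [measurable]: "f \<in> borel_measurable M" "g \<in> borel_measurable M" by fact+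
  show ?thesis unfolding norm2_on_def using assms(1) by (intro integral_cong_AE) auto
qed

lemma has_fourier_unique:
  assumes u: "u \<in> L2_on lborel" and U: "has_fourier u U" and V: "has_fourier u V"
  shows "AE \<xi> in lborel. U \<xi> = V \<xi>"
proof -
  let ?F = "\<lambda>R. fourier_integral (truncation R u)"
  have L: "U \<in> L2_on lborel" "V \<in> L2_on lborel" using U V by (auto simp: has_fourier_iff[OF u])
  have FL: "?F R \<in> L2_on lborel" for R by (intro Plancherel truncation_L2 truncation_integrable u)
  have "((\<lambda>R. 2 * norm2_on lborel (\<lambda>\<xi>. ?F R \<xi> - U \<xi>) + 2 * norm2_on lborel (\<lambda>\<xi>. ?F R \<xi> - V \<xi>)) \<longlongrightarrow> 2 * 0 + 2 * 0) (at_top :: real filter)"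
    using U V by (intro tendsto_intros) (auto simp: has_fourier_iff[OF u])
  moreover have "norm2_on lborel (\<lambda>\<xi>. U \<xi> - V \<xi>) \<le> 2 * norm2_on lborel (\<lambda>\<xi>. ?F R \<xi> - U \<xi>) + 2 * norm2_on lborel (\<lambda>\<xi>. ?F R \<xi> - V \<xi>)" for R
    using norm2_on_triangle[OF L(1) FL[of R] L(2)] norm2_on_commute[of lborel U "?F R"] by linarith
  ultimately have "norm2_on lborel (\<lambda>\<xi>. U \<xi> - V \<xi>) \<le> 2 * 0 + 2 * 0"
    by (intro tendsto_lowerbound[where F = "at_top :: real filter"]) auto
  then have "norm2_on lborel (\<lambda>\<xi>. U \<xi> - V \<xi>) = 0"
    using norm2_on_nonneg[of lborel "\<lambda>\<xi>. U \<xi> - V \<xi>"] by linarith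
  then have "AE \<xi> in lborel. U \<xi> - V \<xi> = 0" by (intro norm2_on_eq_0 L2_on_diff L)
  then show ?thesis by eventually_elim simp
qed

lemma has_fourier_fourier: "u \<in> L2_on lborel \<Longrightarrow> has_fourier u (fourier u)"
  unfolding fourier_def using has_fourier_exists someI_ex[of "has_fourier u"] by blast

lemma fourier_L2: "u \<in> L2_on lborel \<Longrightarrow> fourier u \<in> L2_on lborel"
  using has_fourier_fourier has_fourier_iff by blast

lemma norm2_fourier:
  assumes u: "u \<in> L2_on lborel" shows "norm2_on lborel (fourier u) = norm2_on lborel u"
proof -
  obtain U where U: "has_fourier u U" "norm2_on lborel U = norm2_on lborel u" using has_fourier_exists[OF u] by blast
  have "AE \<xi> in lborel. fourier u \<xi> = U \<xi>" by (rule has_fourier_unique[OF u has_fourier_fourier[OF u] U(1)])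
  then have "norm2_on lborel (fourier u) = norm2_on lborel U"
    using fourier_L2[OF u] U has_fourier_iff[OF u] by (intro norm2_on_cong_AE) (auto dest: L2_onD)
  then show ?thesis using U by simp
qed

lemma fourier_eq_fourier_integral:
  assumes u: "u \<in> L2_on lborel" and u1: "integrable lborel u"
  shows "AE \<xi> in lborel. fourier u \<xi> = fourier_integral u \<xi>"
proof -
  have eq: "norm2_on lborel (\<lambda>\<xi>. fourier_integral (truncation R u) \<xi> - fourier_integral u \<xi>) = norm2_on lborel (\<lambda>x. truncation R u x - u x)" for R
  proof -
    let ?L = "fourier_integral (\<lambda>x. truncation R u x - u x)"
    have e: "(\<lambda>\<xi>. fourier_integral (truncation R u) \<xi> - fourier_integral u \<xi>) = fourier_integral (\<lambda>x. truncation R u x - u x)"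
      by (auto simp: fourier_integral_diff truncation_integrable u u1)
    have "norm2_on lborel ?L = norm2_on lborel (\<lambda>x. truncation R u x - u x)"
      by (intro Plancherel L2_on_diff truncation_L2 Bochner_Integration.integrable_diff truncation_integrable u u1)
    then show ?thesis unfolding e .
  qed
  have "has_fourier u (fourier_integral u)"
    using Plancherel[OF u1 u] truncation_tendsto[OF u] by (simp add: has_fourier_iff[OF u] eq)
  then show ?thesis by (intro has_fourier_unique[OF u has_fourier_fourier[OF u]])
qed

section \<open>Polar coordinates\<close>

lemma radial_tail_integral:
  assumes r: "r > 0" and n: "n > 0"
  shows "(\<integral>\<^sup>+t. ennreal (real n * (1 / t ^ (n + 1))) * indicator {r<..} t \<partial>lborel) = ennreal (1 / r ^ n)"
proof -
  have "(\<integral>\<^sup>+t. ennreal (real n * (1 / t ^ (n + 1))) * indicator {r<..} t \<partial>lborel) =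
     (\<integral>\<^sup>+t. ennreal (real n * (1 / t ^ (n + 1))) * indicator {r..} t \<partial>lborel)"
    by (intro nn_integral_cong_AE AE_I[where N = "{r}"]) (auto simp: indicator_def)
  also have "\<dots> = ennreal (0 - (- (1 / r ^ n)))"
  proof (rule nn_integral_FTC_atLeast)
    fix x assume x: "r \<le> x"
    show "((\<lambda>t. - (1 / t ^ n)) has_real_derivative real n * (1 / x ^ (n + 1))) (at x)"
      using x r n by (auto intro!: derivative_eq_intros simp: field_simps power_add[symmetric])
        (cases n; simp add: power_add)
    show "0 \<le> real n * (1 / x ^ (n + 1))" using x r by simp
  next
    have "((\<lambda>t::real. inverse (t ^ n)) \<longlongrightarrow> 0) at_top"
      using n by (intro tendsto_inverse_0_at_top filterlim_pow_at_top filterlim_ident) auto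
    then have "((\<lambda>t::real. - inverse (t ^ n)) \<longlongrightarrow> - 0) at_top" by (rule tendsto_minus)
    then show "((\<lambda>t::real. - (1 / t ^ n)) \<longlongrightarrow> 0) at_top" by (simp add: inverse_eq_divide)
  qed auto
  finally show ?thesis by simp
qed

lemma nn_integral_sphere:
  fixes g :: "real ^ 'n \<Rightarrow> ennreal"
  assumes [measurable]: "g \<in> borel_measurable (restrict_space borel (sphere 0 1))"
  shows "(\<integral>\<^sup>+\<theta>. g \<theta> \<partial>sphere_measure) =
    of_nat CARD('n) * (\<integral>\<^sup>+x. g (x /\<^sub>R norm x) * indicator (ball 0 1 - {0}) x \<partial>lborel)"
proof -
  have m: "(\<lambda>x::real^'n. x /\<^sub>R norm x) \<in> restrict_space lborel (ball 0 1 - {0}) \<rightarrow>\<^sub>M restrict_space borel (sphere 0 1)"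
    by (intro measurable_restrict_space3) (auto)
  show ?thesis
    unfolding sphere_measure_def
    by (simp add: nn_integral_scale_measure nn_integral_distr[OF m] nn_integral_restrict_space
        measurable_compose[OF m])
qed

lemma measurable_indicator_norm_less [measurable (raw)]:
  fixes f :: "'a \<Rightarrow> 'b::euclidean_space" and g :: "'a \<Rightarrow> real"
  assumes [measurable]: "f \<in> borel_measurable M" "g \<in> borel_measurable M"
  shows "(\<lambda>x. indicator {norm (f x)<..} (g x) :: ennreal) \<in> borel_measurable M"
  unfolding indicator_def greaterThan_iff by measurable

text \<open>
  The surface measure is an image of Lebesgue measure on the unit ball, so an integral over the sphere is
  \<open>n\<close> times an integral over \<open>x\<close> in the ball. Substituting \<open>\<rho> = norm x * t\<close> in the radial integral,
  exchanging the order, and substituting \<open>y = t *\<^sub>R x\<close> leaves the integral of \<open>F y\<close> with the weight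
  \<open>n * norm y ^ n * (\<integral>\<^sup>+t. 1 / t ^ (n + 1))\<close> over \<open>t > norm y\<close>, which is \<open>1\<close>.
\<close>

theorem nn_integral_polar:
  fixes F :: "real ^ 'n \<Rightarrow> ennreal"
  assumes F [measurable]: "F \<in> borel_measurable borel"
  shows "(\<integral>\<^sup>+h. F h \<partial>lborel) =
    (\<integral>\<^sup>+\<theta>. (\<integral>\<^sup>+\<rho>. F (\<rho> *\<^sub>R \<theta>) * ennreal (\<rho> ^ (CARD('n) - 1)) * indicator {0<..} \<rho> \<partial>lborel) \<partial>sphere_measure)"
proof -
  let ?n = "CARD('n)"
  have n: "?n > 0" by simp
  let ?g = "\<lambda>\<theta>. \<integral>\<^sup>+\<rho>. F (\<rho> *\<^sub>R \<theta>) * ennreal (\<rho> ^ (?n - 1)) * indicator {0<..} \<rho> \<partial>lborel"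
  have g: "?g \<in> borel_measurable borel" by measurable
  let ?B = "ball (0::real^'n) 1 - {0}"
  have [measurable]: "?B \<in> sets borel" by auto
  (* Substitution rho = norm x * t for fixed x. *)
  have gx: "?g (x /\<^sub>R norm x) * indicator ?B x =
     (\<integral>\<^sup>+t. F (t *\<^sub>R x) * ennreal (norm x ^ ?n * t ^ (?n - 1)) * indicator {0<..} t * indicator ?B x \<partial>lborel)" for x
  proof (cases "x \<in> ?B")
    case True
    then have x: "norm x > 0" by auto
    have "?g (x /\<^sub>R norm x) = ennreal \<bar>norm x\<bar> * (\<integral>\<^sup>+t. F ((0 + norm x * t) *\<^sub>R (x /\<^sub>R norm x)) * ennreal ((0 + norm x * t) ^ (?n - 1)) * indicator {0<..} (0 + norm x * t) \<partial>lborel)"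
      using x by (intro nn_integral_real_affine) auto
    also have "\<dots> = (\<integral>\<^sup>+t. ennreal (norm x) * (F ((0 + norm x * t) *\<^sub>R (x /\<^sub>R norm x)) * ennreal ((0 + norm x * t) ^ (?n - 1)) * indicator {0<..} (0 + norm x * t)) \<partial>lborel)"
      by (subst nn_integral_cmult) auto
    also have "\<dots> = (\<integral>\<^sup>+t. F (t *\<^sub>R x) * ennreal (norm x ^ ?n * t ^ (?n - 1)) * indicator {0<..} t * indicator ?B x \<partial>lborel)"
    proof (rule nn_integral_cong)
      fix t :: real
      have 1: "(0 + norm x * t) *\<^sub>R (x /\<^sub>R norm x) = t *\<^sub>R x" using x by simp
      have 2: "norm x * (norm x * t) ^ (?n - 1) = norm x ^ ?n * t ^ (?n - 1)"
        using n by (cases ?n) (auto simp: power_mult_distrib)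
      have 3: "ennreal (norm x) * ennreal ((norm x * t) ^ (?n - 1)) = ennreal (norm x ^ ?n * t ^ (?n - 1))" if "t > 0"
        using x that by (subst ennreal_mult[symmetric]) (simp_all only: 2, auto)
      have 4: "indicator {0<..} (0 + norm x * t) = (indicator {0<..} t :: ennreal)"
        using x by (auto simp: indicator_def zero_less_mult_iff)
      show "ennreal (norm x) * (F ((0 + norm x * t) *\<^sub>R (x /\<^sub>R norm x)) * ennreal ((0 + norm x * t) ^ (?n - 1)) * indicator {0<..} (0 + norm x * t)) =
         F (t *\<^sub>R x) * ennreal (norm x ^ ?n * t ^ (?n - 1)) * indicator {0<..} t * indicator ?B x"
      proof (cases "t > 0")
        case pos: True
        show ?thesis unfolding 1 4 3[OF pos, symmetric] using True pos by (simp add: mult.left_commute)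
      next
        case False
        then show ?thesis unfolding 4 by simp
      qed
    qed
    finally show ?thesis using True by simp
  qed simp
  (* Substitution y = t x for fixed t; the condition norm x < 1 becomes norm y < t. *)
  have tx: "(\<integral>\<^sup>+x. F (t *\<^sub>R x) * ennreal (norm x ^ ?n * t ^ (?n - 1)) * indicator {0<..} t * indicator ?B x \<partial>lborel) =
      (\<integral>\<^sup>+y. F y * ennreal (norm y ^ ?n * (1 / t ^ (?n + 1))) * indicator {norm y<..} t \<partial>lborel)" for t
  proof (cases "t > 0")
    case True
    let ?G = "\<lambda>y. F y * ennreal (norm y ^ ?n * (1 / t ^ (?n + 1))) * indicator {norm y<..} t"
    have "(\<integral>\<^sup>+y. ?G y \<partial>lborel) = ennreal (\<bar>t\<bar> ^ DIM(real^'n)) * (\<integral>\<^sup>+x. ?G (t *\<^sub>R x) \<partial>lborel)"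
      using True by (intro nn_integral_lborel_scale) (measurable, auto)
    also have "\<dots> = (\<integral>\<^sup>+x. ennreal (t ^ ?n) * ?G (t *\<^sub>R x) \<partial>lborel)"
    proof -
      have "(\<lambda>x. ?G (t *\<^sub>R x)) \<in> borel_measurable lborel" by measurable
      moreover have "\<bar>t\<bar> ^ DIM(real^'n) = t ^ ?n" using True by simp
      ultimately show ?thesis by (subst nn_integral_cmult) simp_all
    qed
    also have "\<dots> = (\<integral>\<^sup>+x. F (t *\<^sub>R x) * ennreal (norm x ^ ?n * t ^ (?n - 1)) * indicator {0<..} t * indicator ?B x \<partial>lborel)"
    proof (rule nn_integral_cong)
      fix x :: "real^'n"
      have "t ^ ?n * (norm (t *\<^sub>R x) ^ ?n * (1 / t ^ (?n + 1))) = norm x ^ ?n * t ^ (?n - 1)"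
        using True n by (cases ?n) (auto simp: power_mult_distrib field_simps)
      then have e: "ennreal (t ^ ?n) * ennreal (norm (t *\<^sub>R x) ^ ?n * (1 / t ^ (?n + 1))) = ennreal (norm x ^ ?n * t ^ (?n - 1))"
        using True by (subst ennreal_mult[symmetric]) auto
      show "ennreal (t ^ ?n) * ?G (t *\<^sub>R x) = F (t *\<^sub>R x) * ennreal (norm x ^ ?n * t ^ (?n - 1)) * indicator {0<..} t * indicator ?B x"
      proof (cases "x = 0")
        case False
        have "(indicator {norm (t *\<^sub>R x)<..} t :: ennreal) = indicator {0<..} t * indicator ?B x"
          using True False by (auto simp: indicator_def)
        then show ?thesis unfolding e[symmetric]
          by (simp only: mult.assoc mult.left_commute[of "ennreal (t ^ ?n)"])
      next
        case True
        have "ennreal (norm (t *\<^sub>R x) ^ ?n * (1 / t ^ (?n + 1))) = 0" using True n by (simp add: power_0_left)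
        then show ?thesis using True by simp
      qed
    qed
    finally show ?thesis by simp
  next
    case False
    then have "indicator {0<..} t = (0::ennreal)" "\<And>y::real^'n. indicator {norm y<..} t = (0::ennreal)"
      using order.strict_trans1[OF norm_ge_zero] by (auto simp: indicator_def)
    then show ?thesis by simp
  qed
  have "(\<integral>\<^sup>+\<theta>. ?g \<theta> \<partial>sphere_measure) = of_nat ?n * (\<integral>\<^sup>+x. ?g (x /\<^sub>R norm x) * indicator ?B x \<partial>lborel)"
    by (rule nn_integral_sphere) (use g in \<open>auto intro!: measurable_restrict_space1\<close>)
  also have "(\<integral>\<^sup>+x. ?g (x /\<^sub>R norm x) * indicator ?B x \<partial>lborel) =
     (\<integral>\<^sup>+x. (\<integral>\<^sup>+t. F (t *\<^sub>R x) * ennreal (norm x ^ ?n * t ^ (?n - 1)) * indicator {0<..} t * indicator ?B x \<partial>lborel) \<partial>lborel)"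
    unfolding gx ..
  also have "\<dots> = (\<integral>\<^sup>+t. (\<integral>\<^sup>+x. F (t *\<^sub>R x) * ennreal (norm x ^ ?n * t ^ (?n - 1)) * indicator {0<..} t * indicator ?B x \<partial>lborel) \<partial>lborel)"
    by (rule lborel_pair.Fubini') measurable
  also have "\<dots> = (\<integral>\<^sup>+t. (\<integral>\<^sup>+y. F y * ennreal (norm y ^ ?n * (1 / t ^ (?n + 1))) * indicator {norm y<..} t \<partial>lborel) \<partial>lborel)"
    unfolding tx ..
  also have "\<dots> = (\<integral>\<^sup>+y. (\<integral>\<^sup>+t. F y * ennreal (norm y ^ ?n * (1 / t ^ (?n + 1))) * indicator {norm y<..} t \<partial>lborel) \<partial>lborel)"
    by (rule lborel_pair.Fubini') measurable
  also have "of_nat ?n * \<dots> = (\<integral>\<^sup>+y. of_nat ?n * (\<integral>\<^sup>+t. F y * ennreal (norm y ^ ?n * (1 / t ^ (?n + 1))) * indicator {norm y<..} t \<partial>lborel) \<partial>lborel)"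
    by (rule nn_integral_cmult[symmetric]) measurable
  also have "\<dots> = (\<integral>\<^sup>+y. F y \<partial>lborel)"
  proof (intro nn_integral_cong_AE AE_I[where N = "{0}"])
    show "{x \<in> space lborel. \<not> of_nat ?n * (\<integral>\<^sup>+t. F x * ennreal (norm x ^ ?n * (1 / t ^ (?n + 1))) * indicator {norm x<..} t \<partial>lborel) = F x} \<subseteq> {0}"
    proof (rule subsetI, rule ccontr)
      fix y :: "real^'n"
      assume bad: "y \<in> {x \<in> space lborel. \<not> of_nat ?n * (\<integral>\<^sup>+t. F x * ennreal (norm x ^ ?n * (1 / t ^ (?n + 1))) * indicator {norm x<..} t \<partial>lborel) = F x}"
        and "y \<notin> {0}"
      then have y: "norm y > 0" "y \<noteq> 0" by auto
      have "of_nat ?n * (\<integral>\<^sup>+t. F y * ennreal (norm y ^ ?n * (1 / t ^ (?n + 1))) * indicator {norm y<..} t \<partial>lborel) =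
        (\<integral>\<^sup>+t. of_nat ?n * (F y * ennreal (norm y ^ ?n * (1 / t ^ (?n + 1))) * indicator {norm y<..} t) \<partial>lborel)"
        by (rule nn_integral_cmult[symmetric]) measurable
      also have "\<dots> = (\<integral>\<^sup>+t. (F y * ennreal (norm y ^ ?n)) * (ennreal (real ?n * (1 / t ^ (?n + 1))) * indicator {norm y<..} t) \<partial>lborel)"
      proof (rule nn_integral_cong)
        fix t :: real
        show "of_nat ?n * (F y * ennreal (norm y ^ ?n * (1 / t ^ (?n + 1))) * indicator {norm y<..} t) =
          (F y * ennreal (norm y ^ ?n)) * (ennreal (real ?n * (1 / t ^ (?n + 1))) * indicator {norm y<..} t)"
        proof (cases "norm y < t")
          case True
          then have t: "t > 0" using y by linarith
          have "ennreal (norm y ^ ?n * (1 / t ^ (?n + 1))) = ennreal (norm y ^ ?n) * ennreal (1 / t ^ (?n + 1))"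
            "ennreal (real ?n * (1 / t ^ (?n + 1))) = of_nat ?n * ennreal (1 / t ^ (?n + 1))"
            unfolding ennreal_of_nat_eq_real_of_nat using t by (intro ennreal_mult; simp)+
          then show ?thesis using True by (simp only: mult_ac)
        qed simp
      qed
      also have "\<dots> = (F y * ennreal (norm y ^ ?n)) * ennreal (1 / norm y ^ ?n)"
        unfolding radial_tail_integral[OF y(1) n, symmetric] by (rule nn_integral_cmult) measurable
      also have "\<dots> = F y"
        using y by (simp add: mult.assoc ennreal_mult[symmetric])
      finally show False using bad by simp
    qed
  qed auto
  finally show ?thesis by simp
qed

section \<open>The symbol as a multiplier\<close>

lemma norm_exp_i_minus_1_sq: "(norm (exp (\<i> * complex_of_real t) - 1))\<^sup>2 = 2 * (1 - cos t)"
proof -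
  have "(norm (exp (\<i> * complex_of_real t) - 1))\<^sup>2 = (cos t - 1)\<^sup>2 + (sin t)\<^sup>2"
    by (simp add: cis_conv_exp[symmetric] cmod_power2)
  also have "\<dots> = 2 * (1 - cos t)"
    using sin_cos_squared_add[of t] by (simp add: power2_eq_square algebra_simps)
  finally show ?thesis .
qed

text \<open>
  Scaling by \<open>\<bar>c\<bar>\<close>. The integral that defines \<open>symbol_const\<close> converges because its value is nonzero:
  a divergent Bochner integral has the value \<open>0\<close>.
\<close>

lemma radial_integral:
  assumes s: "s > 0" and C: "symbol_const s \<noteq> 0"
  shows "(\<integral>\<^sup>+\<rho>. ennreal ((1 - cos (\<rho> * c)) * \<rho> powr (- (1 + 2 * s))) * indicator {0<..} \<rho> \<partial>lborel) =
    ennreal (symbol_const s * \<bar>c\<bar> powr (2 * s))"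
proof (cases "c = 0")
  case True
  then show ?thesis using s by simp
next
  case False
  let ?f = "\<lambda>\<rho>::real. (1 - cos \<rho>) / \<rho> powr (1 + 2 * s)"
  have int: "set_integrable lborel {0<..} ?f"
    using C not_integrable_integral_eq unfolding symbol_const_def set_lebesgue_integral_def set_integrable_def by blast
  have nn: "(\<integral>\<^sup>+\<rho>. ennreal (?f \<rho>) * indicator {0<..} \<rho> \<partial>lborel) = ennreal (symbol_const s)"
  proof -
    have "(\<integral>\<^sup>+\<rho>. ennreal (?f \<rho>) * indicator {0<..} \<rho> \<partial>lborel) = (\<integral>\<^sup>+\<rho>. ennreal (indicator {0<..} \<rho> *\<^sub>R ?f \<rho>) \<partial>lborel)"
      by (intro nn_integral_cong) (auto simp: indicator_def)
    also have "\<dots> = ennreal (LINT \<rho>|lborel. indicator {0<..} \<rho> *\<^sub>R ?f \<rho>)"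
      using int unfolding set_integrable_def by (intro nn_integral_eq_integral) auto
    finally show ?thesis by (simp add: symbol_const_def set_lebesgue_integral_def)
  qed
  let ?c = "\<bar>c\<bar>"
  have c: "?c > 0" using False by simp
  have "(\<integral>\<^sup>+\<rho>. ennreal ((1 - cos (\<rho> * c)) * \<rho> powr (- (1 + 2 * s))) * indicator {0<..} \<rho> \<partial>lborel) =
    ennreal \<bar>1 / ?c\<bar> * (\<integral>\<^sup>+\<rho>. ennreal ((1 - cos ((0 + (1 / ?c) * \<rho>) * c)) * (0 + (1 / ?c) * \<rho>) powr (- (1 + 2 * s))) * indicator {0<..} (0 + (1 / ?c) * \<rho>) \<partial>lborel)"
    using c by (intro nn_integral_real_affine) auto
  also have "\<dots> = ennreal \<bar>1 / ?c\<bar> * (\<integral>\<^sup>+\<rho>. ennreal (?c powr (1 + 2 * s)) * (ennreal (?f \<rho>) * indicator {0<..} \<rho>) \<partial>lborel)"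
  proof (rule arg_cong[where f = "\<lambda>I. ennreal \<bar>1 / ?c\<bar> * I"], rule nn_integral_cong)
    fix \<rho> :: real
    have "cos (1 / ?c * \<rho> * c) = cos \<rho>" using False by (cases "c > 0") auto
    moreover have "(1 / ?c * \<rho>) powr (- (1 + 2 * s)) = ?c powr (1 + 2 * s) * (1 / \<rho> powr (1 + 2 * s))" if "\<rho> > 0"
    proof -
      have "(1 / ?c * \<rho>) powr (- (1 + 2 * s)) = (1 / ?c) powr (- (1 + 2 * s)) * \<rho> powr (- (1 + 2 * s))"
        using that c by (intro powr_mult)
      also have "(1 / ?c) powr (- (1 + 2 * s)) = ?c powr (1 + 2 * s)"
        unfolding powr_minus using c by (simp add: powr_divide)
      also have "\<rho> powr (- (1 + 2 * s)) = 1 / \<rho> powr (1 + 2 * s)" by (simp only: powr_minus inverse_eq_divide)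
      finally show ?thesis .
    qed
    ultimately have 1: "(1 - cos ((0 + (1 / ?c) * \<rho>) * c)) * (0 + (1 / ?c) * \<rho>) powr (- (1 + 2 * s)) = ?c powr (1 + 2 * s) * ?f \<rho>" if "\<rho> > 0"
      using that by simp
    have 2: "indicator {0<..} (0 + (1 / ?c) * \<rho>) = (indicator {0<..} \<rho> :: ennreal)"
      using c by (auto simp: indicator_def zero_less_divide_iff)
    have 3: "ennreal (?c powr (1 + 2 * s) * ?f \<rho>) = ennreal (?c powr (1 + 2 * s)) * ennreal (?f \<rho>)"
      by (intro ennreal_mult) auto
    show "ennreal ((1 - cos ((0 + (1 / ?c) * \<rho>) * c)) * (0 + (1 / ?c) * \<rho>) powr (- (1 + 2 * s))) * indicator {0<..} (0 + (1 / ?c) * \<rho>) =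
       ennreal (?c powr (1 + 2 * s)) * (ennreal (?f \<rho>) * indicator {0<..} \<rho>)"
      unfolding 2 by (cases "\<rho> > 0") (simp_all only: 1 3 mult.assoc, simp)
  qed
  also have "\<dots> = ennreal (1 / ?c) * (ennreal (?c powr (1 + 2 * s)) * ennreal (symbol_const s))"
    by (subst nn_integral_cmult) (auto simp: nn[simplified])
  also have "\<dots> = ennreal (symbol_const s * ?c powr (2 * s))"
  proof -
    have "symbol_const s \<ge> 0" unfolding symbol_const_def set_lebesgue_integral_def
      by (intro integral_nonneg_AE) (auto simp: indicator_def)
    moreover have "1 / ?c * (?c powr (1 + 2 * s) * symbol_const s) = symbol_const s * ?c powr (2 * s)"
      using c by (simp add: powr_add)
    ultimately show ?thesis using c by (subst ennreal_mult[symmetric]; simp)+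
  qed
  finally show ?thesis .
qed

lemma elliptic_symbol_pos:
  assumes "elliptic s a" "\<xi> \<noteq> 0" shows "symbol s a \<xi> > 0"
proof -
  obtain l where "0 < l" "l * norm \<xi> powr (2 * s) \<le> symbol s a \<xi>" using assms(1) by (auto simp: elliptic_def)
  moreover have "norm \<xi> powr (2 * s) > 0" using assms(2) by simp
  ultimately show ?thesis using mult_pos_pos[of l "norm \<xi> powr (2 * s)"] by linarith
qed

lemma kernel_on_ray:
  fixes \<theta> :: "real ^ 'n"
  assumes "norm \<theta> = 1" "\<rho> > 0"
  shows "kernel s a (\<rho> *\<^sub>R \<theta>) * \<rho> ^ (CARD('n) - 1) = a \<theta> * \<rho> powr (- (1 + 2 * s))"
proof -
  have 1: "(\<rho> *\<^sub>R \<theta>) /\<^sub>R norm (\<rho> *\<^sub>R \<theta>) = \<theta>" using assms by simp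
  have "\<rho> ^ (CARD('n) - 1) = \<rho> powr (real CARD('n) - 1)"
    using assms by (subst powr_realpow[symmetric]) (auto simp: of_nat_diff Suc_leI)
  then have "\<rho> powr (- (real CARD('n) + 2 * s)) * \<rho> ^ (CARD('n) - 1) = \<rho> powr (- (1 + 2 * s))"
    by (simp add: powr_add[symmetric] algebra_simps)
  then show ?thesis unfolding kernel_def 1 using assms by (simp add: mult.assoc)
qed

text \<open>
  Polar coordinates separate the radial integral, which yields \<open>symbol_const s * \<bar>\<xi> \<bullet> \<theta>\<bar> powr (2 * s)\<close>,
  from the integral against \<open>a\<close>. Convergence is read off from ellipticity, since the positive value of the
  symbol cannot be the default value of a divergent integral. The factor \<open>2\<close> comes from
  \<open>(norm (exp (\<i> t) - 1))\<^sup>2 = 2 (1 - cos t)\<close>.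
\<close>

theorem kernel_multiplier:
  fixes a :: "real ^ 'n \<Rightarrow> real"
  assumes s: "s > 0" and a: "\<And>\<theta>. norm \<theta> = 1 \<Longrightarrow> a \<theta> \<ge> 0" and el: "elliptic s a"
    and K [measurable]: "kernel s a \<in> borel_measurable borel"
  shows "(\<integral>\<^sup>+h. ennreal (kernel s a h * (norm (exp (\<i> * complex_of_real (h \<bullet> \<xi>)) - 1))\<^sup>2) \<partial>lborel) = ennreal (2 * symbol s a \<xi>)"
proof -
  let ?S = "sphere_measure :: (real ^ 'n) measure"
  obtain e :: "real^'n" where "e \<noteq> 0" using vector_choose_size[of 1] by (metis norm_zero zero_le_one zero_neq_one)
  then have C: "symbol_const s \<noteq> 0" using elliptic_symbol_pos[OF el, of e] by (auto simp: symbol_def)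
  have spS: "space ?S = sphere 0 1" by (simp add: sphere_measure_def space_scale_measure space_restrict_space)
  have setsS: "sets ?S = sets (restrict_space borel (sphere 0 1))" by (simp add: sphere_measure_def)
  have am: "a \<in> borel_measurable ?S"
  proof -
    have "kernel s a \<in> borel_measurable (restrict_space borel (sphere 0 1))" by (intro measurable_restrict_space1 K)
    then have "kernel s a \<in> borel_measurable ?S" by (simp add: measurable_cong_sets[OF setsS refl])
    moreover have "kernel s a \<theta> = a \<theta>" if "\<theta> \<in> space ?S" for \<theta> using that by (simp add: spS kernel_def)
    ultimately show ?thesis by (simp cong: measurable_cong)
  qed
  have im: "(\<lambda>\<theta>. \<bar>\<xi> \<bullet> \<theta>\<bar> powr (2 * s)) \<in> borel_measurable ?S"
    unfolding measurable_cong_sets[OF setsS refl] by (intro measurable_restrict_space1) measurable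
  have "(\<integral>\<^sup>+h. ennreal (kernel s a h * (norm (exp (\<i> * complex_of_real (h \<bullet> \<xi>)) - 1))\<^sup>2) \<partial>lborel) =
    (\<integral>\<^sup>+\<theta>. (\<integral>\<^sup>+\<rho>. ennreal (kernel s a (\<rho> *\<^sub>R \<theta>) * (norm (exp (\<i> * complex_of_real ((\<rho> *\<^sub>R \<theta>) \<bullet> \<xi>)) - 1))\<^sup>2) * ennreal (\<rho> ^ (CARD('n) - 1)) * indicator {0<..} \<rho> \<partial>lborel) \<partial>?S)"
    by (rule nn_integral_polar) measurable
  also have "\<dots> = (\<integral>\<^sup>+\<theta>. ennreal (2 * symbol_const s * (\<bar>\<xi> \<bullet> \<theta>\<bar> powr (2 * s) * a \<theta>)) \<partial>?S)"
  proof (rule nn_integral_cong)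
    fix \<theta> assume "\<theta> \<in> space ?S"
    then have \<theta>: "norm \<theta> = 1" by (simp add: spS)
    have "(\<integral>\<^sup>+\<rho>. ennreal (kernel s a (\<rho> *\<^sub>R \<theta>) * (norm (exp (\<i> * complex_of_real ((\<rho> *\<^sub>R \<theta>) \<bullet> \<xi>)) - 1))\<^sup>2) * ennreal (\<rho> ^ (CARD('n) - 1)) * indicator {0<..} \<rho> \<partial>lborel) =
      (\<integral>\<^sup>+\<rho>. ennreal (2 * a \<theta>) * (ennreal ((1 - cos (\<rho> * (\<theta> \<bullet> \<xi>))) * \<rho> powr (- (1 + 2 * s))) * indicator {0<..} \<rho>) \<partial>lborel)"
    proof (rule nn_integral_cong)
      fix \<rho> :: real
      show "ennreal (kernel s a (\<rho> *\<^sub>R \<theta>) * (norm (exp (\<i> * complex_of_real ((\<rho> *\<^sub>R \<theta>) \<bullet> \<xi>)) - 1))\<^sup>2) * ennreal (\<rho> ^ (CARD('n) - 1)) * indicator {0<..} \<rho> =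
        ennreal (2 * a \<theta>) * (ennreal ((1 - cos (\<rho> * (\<theta> \<bullet> \<xi>))) * \<rho> powr (- (1 + 2 * s))) * indicator {0<..} \<rho>)"
      proof (cases "\<rho> > 0")
        case True
        have "kernel s a (\<rho> *\<^sub>R \<theta>) \<ge> 0" using True \<theta> a by (simp add: kernel_def)
        then have "ennreal (kernel s a (\<rho> *\<^sub>R \<theta>) * (norm (exp (\<i> * complex_of_real ((\<rho> *\<^sub>R \<theta>) \<bullet> \<xi>)) - 1))\<^sup>2) * ennreal (\<rho> ^ (CARD('n) - 1)) =
           ennreal ((kernel s a (\<rho> *\<^sub>R \<theta>) * \<rho> ^ (CARD('n) - 1)) * (2 * (1 - cos (\<rho> * (\<theta> \<bullet> \<xi>)))))"
          using True unfolding norm_exp_i_minus_1_sq by (subst ennreal_mult[symmetric]) (auto simp: mult_ac)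
        also have "\<dots> = ennreal (2 * a \<theta> * ((1 - cos (\<rho> * (\<theta> \<bullet> \<xi>))) * \<rho> powr (- (1 + 2 * s))))"
          unfolding kernel_on_ray[OF \<theta> True] by (simp only: mult_ac)
        also have "\<dots> = ennreal (2 * a \<theta>) * ennreal ((1 - cos (\<rho> * (\<theta> \<bullet> \<xi>))) * \<rho> powr (- (1 + 2 * s)))"
          using a[OF \<theta>] by (intro ennreal_mult) auto
        finally show ?thesis by (simp add: mult.assoc)
      qed simp
    qed
    also have "\<dots> = ennreal (2 * a \<theta>) * ennreal (symbol_const s * \<bar>\<theta> \<bullet> \<xi>\<bar> powr (2 * s))"
      unfolding radial_integral[OF s C, symmetric] by (rule nn_integral_cmult) measurable
    also have "\<dots> = ennreal (2 * a \<theta> * (symbol_const s * \<bar>\<theta> \<bullet> \<xi>\<bar> powr (2 * s)))"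
      using a[OF \<theta>] by (intro ennreal_mult'[symmetric]) auto
    also have "2 * a \<theta> * (symbol_const s * \<bar>\<theta> \<bullet> \<xi>\<bar> powr (2 * s)) = 2 * symbol_const s * (\<bar>\<xi> \<bullet> \<theta>\<bar> powr (2 * s) * a \<theta>)"
      by (simp add: inner_commute mult_ac)
    finally show "(\<integral>\<^sup>+\<rho>. ennreal (kernel s a (\<rho> *\<^sub>R \<theta>) * (norm (exp (\<i> * complex_of_real ((\<rho> *\<^sub>R \<theta>) \<bullet> \<xi>)) - 1))\<^sup>2) * ennreal (\<rho> ^ (CARD('n) - 1)) * indicator {0<..} \<rho> \<partial>lborel) =
      ennreal (2 * symbol_const s * (\<bar>\<xi> \<bullet> \<theta>\<bar> powr (2 * s) * a \<theta>))" .
  qed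
  also have "\<dots> = ennreal (LINT \<theta>|?S. 2 * symbol_const s * (\<bar>\<xi> \<bullet> \<theta>\<bar> powr (2 * s) * a \<theta>))"
  proof (rule nn_integral_eq_integral)
    have "symbol_const s \<ge> 0" unfolding symbol_const_def set_lebesgue_integral_def
      by (intro integral_nonneg_AE) (auto simp: indicator_def)
    then show "AE \<theta> in ?S. 0 \<le> 2 * symbol_const s * (\<bar>\<xi> \<bullet> \<theta>\<bar> powr (2 * s) * a \<theta>)"
      using a by (auto simp: spS)
    show "integrable ?S (\<lambda>\<theta>. 2 * symbol_const s * (\<bar>\<xi> \<bullet> \<theta>\<bar> powr (2 * s) * a \<theta>))"
    proof (cases "\<xi> = 0")
      case True
      then show ?thesis using s by simp
    next
      case False
      then have "(LINT \<theta>|?S. \<bar>\<xi> \<bullet> \<theta>\<bar> powr (2 * s) * a \<theta>) \<noteq> 0" using elliptic_symbol_pos[OF el, of \<xi>] by (auto simp: symbol_def)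
      then have "integrable ?S (\<lambda>\<theta>. \<bar>\<xi> \<bullet> \<theta>\<bar> powr (2 * s) * a \<theta>)" using not_integrable_integral_eq by blast
      then show ?thesis by simp
    qed
  qed
  also have "\<dots> = ennreal (2 * symbol s a \<xi>)" by (simp add: symbol_def mult.assoc)
  finally show ?thesis .
qed

section \<open>Test functions\<close>

lemma C_k_add_scale:
  fixes f g :: "real ^ 'n \<Rightarrow> complex"
  assumes "C_k k f" "C_k k g" shows "C_k k (\<lambda>x. f x + c * g x)"
  using assms
proof (induction k arbitrary: f g)
  case 0
  then show ?case by (auto intro!: continuous_intros)
next
  case (Suc k)
  have df: "(f has_derivative frechet_derivative f (at x)) (at x)" and dg: "(g has_derivative frechet_derivative g (at x)) (at x)" for x
    using Suc.prems by (auto simp: differentiable_on_def frechet_derivative_works[symmetric])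
  have d: "((\<lambda>x. f x + c * g x) has_derivative (\<lambda>h. frechet_derivative f (at x) h + c * frechet_derivative g (at x) h)) (at x)" for x
    by (intro has_derivative_add df has_derivative_mult_right dg)
  have eq: "frechet_derivative (\<lambda>x. f x + c * g x) (at x) = (\<lambda>h. frechet_derivative f (at x) h + c * frechet_derivative g (at x) h)" for x
    using frechet_derivative_at[OF d] by simp
  show ?case
    using Suc.prems d by (auto simp: eq differentiable_on_def differentiable_def intro!: Suc.IH)
qed

lemma test_functions_add_scale:
  assumes "f \<in> test_functions U" "g \<in> test_functions U"
  shows "(\<lambda>x. f x + c * g x) \<in> test_functions U"
proof -
  have sub: "closure {x. f x + c * g x \<noteq> 0} \<subseteq> closure {x. f x \<noteq> 0} \<union> closure {x. g x \<noteq> 0}"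
    unfolding closure_Un[symmetric] by (rule closure_mono) auto
  have "compact ((closure {x. f x \<noteq> 0} \<union> closure {x. g x \<noteq> 0}) \<inter> closure {x. f x + c * g x \<noteq> 0})"
    using assms by (intro compact_Int_closed compact_Un closed_closure) (simp_all add: test_functions_def)
  then have "compact (closure {x. f x + c * g x \<noteq> 0})"
    unfolding Int_absorb1[OF sub] .
  moreover have "closure {x. f x + c * g x \<noteq> 0} \<subseteq> U"
    using sub assms unfolding test_functions_def by blast
  ultimately show ?thesis using assms by (simp add: test_functions_def C_k_add_scale)
qed

lemma C_k_zero: "C_k k (\<lambda>x. 0)"
proof (induction k)
  case (Suc k)
  have "frechet_derivative (\<lambda>x::real^'n. 0::complex) (at x) = (\<lambda>h. 0)" for x
    by (rule frechet_derivative_at[symmetric]) (rule has_derivative_const)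
  then show ?case using Suc by (simp add: differentiable_on_def)
qed simp

lemma test_functions_zero: "(\<lambda>x. 0) \<in> test_functions U"
  by (simp add: test_functions_def C_k_zero)

lemma test_functions_vanish: "f \<in> test_functions U \<Longrightarrow> x \<notin> U \<Longrightarrow> f x = 0"
  using closure_subset[of "{x. f x \<noteq> 0}"] by (auto simp: test_functions_def)

lemma test_functions_continuous: "f \<in> test_functions U \<Longrightarrow> continuous_on UNIV f"
  by (auto simp: test_functions_def dest: spec[of _ 0])

lemma compact_support_bounded:
  fixes f :: "'a::topological_space \<Rightarrow> 'b::real_normed_vector"
  assumes "continuous_on UNIV f" "compact K" "\<And>x. x \<notin> K \<Longrightarrow> f x = 0"
  obtains B where "B > 0" "\<And>x. norm (f x) \<le> B"
proof -
  have "bounded (f ` K)"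
    using assms by (intro compact_imp_bounded compact_continuous_image) (auto intro: continuous_on_subset)
  then obtain B where "B > 0" "\<And>x. x \<in> K \<Longrightarrow> norm (f x) \<le> B" by (auto simp: bounded_pos)
  then show ?thesis using assms(3) by (intro that[of B]) (metis less_imp_le norm_zero)+
qed

lemma test_functions_L1_L2:
  assumes f: "f \<in> test_functions U" shows "f \<in> L2_on lborel" "integrable lborel f"
proof -
  let ?K = "closure {x. f x \<noteq> 0}"
  have K: "compact ?K" "\<And>x. x \<notin> ?K \<Longrightarrow> f x = 0"
    using f closure_subset[of "{x. f x \<noteq> 0}"] by (auto simp: test_functions_def)
  have c: "continuous_on UNIV f" by (rule test_functions_continuous[OF f])
  obtain B where B: "B > 0" "\<And>x. norm (f x) \<le> B" using compact_support_bounded[OF c K] by blast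
  have [measurable]: "f \<in> borel_measurable borel" by (rule borel_measurable_continuous_onI[OF c])
  have "emeasure lborel ?K < \<infinity>" using emeasure_compact_finite[OF K(1)] by simp
  then have fin: "integrable lborel (\<lambda>x. B\<^sup>2 * indicator ?K x)"
    by (intro integrable_mult_right integrable_real_indicator) auto
  have "integrable lborel (\<lambda>x. (norm (f x))\<^sup>2)"
  proof (rule Bochner_Integration.integrable_bound[OF fin])
    show "AE x in lborel. norm ((norm (f x))\<^sup>2) \<le> norm (B\<^sup>2 * indicator ?K x :: real)"
    proof (rule AE_I2)
      fix x
      show "norm ((norm (f x))\<^sup>2) \<le> norm (B\<^sup>2 * indicator ?K x :: real)"
        using K(2)[of x] power_mono[OF B(2)[of x] norm_ge_zero, of 2] by (cases "x \<in> ?K") simp_all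
    qed
  qed auto
  then show L: "f \<in> L2_on lborel" by (auto simp: L2_on_def)
  show "integrable lborel f"
  proof (rule L2_on_bounded_integrable[OF L])
    show "?K \<in> sets borel" "bounded ?K" using compact_imp_bounded[OF K(1)] by simp_all
    show "AE x in lborel. x \<notin> ?K \<longrightarrow> f x = 0" using K(2) by (intro AE_I2 impI)
  qed
qed

lemma test_functions_Lipschitz:
  fixes f :: "real ^ 'n \<Rightarrow> complex"
  assumes f: "f \<in> test_functions U"
  obtains L where "L \<ge> 0" "\<And>x y. norm (f x - f y) \<le> L * norm (x - y)"
proof -
  let ?K = "closure {x. f x \<noteq> 0}"
  have K: "compact ?K" using f by (auto simp: test_functions_def)
  have "C_k (Suc 0) f" using f by (auto simp: test_functions_def simp del: C_k.simps)
  then have df: "(f has_derivative frechet_derivative f (at x)) (at x)"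
    and cont: "continuous_on UNIV (\<lambda>x. frechet_derivative f (at x) (axis i 1))" for x i
    by (auto simp: differentiable_on_def frechet_derivative_works[symmetric])
  have z: "frechet_derivative f (at x) = (\<lambda>h. 0)" if "x \<notin> ?K" for x
  proof (rule frechet_derivative_at[symmetric], rule has_derivative_transform_within_open)
    show "((\<lambda>x. 0) has_derivative (\<lambda>h. 0)) (at x)" by (rule has_derivative_const)
    show "open (- ?K)" "x \<in> - ?K" using that by auto
    show "\<And>y. y \<in> - ?K \<Longrightarrow> 0 = f y" using closure_subset[of "{x. f x \<noteq> 0}"] by auto
  qed
  have "\<exists>B. B > 0 \<and> (\<forall>x. norm (frechet_derivative f (at x) (axis i 1)) \<le> B)" for i
    using compact_support_bounded[OF cont[of i] K] z by metis
  then obtain B where B: "\<And>i. B i > 0" "\<And>i x. norm (frechet_derivative f (at x) (axis i 1)) \<le> B i" by metis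
  define L where "L = (\<Sum>i\<in>UNIV. B i)"
  have on: "onorm (frechet_derivative f (at x)) \<le> L" for x
  proof (rule onorm_le)
    fix v :: "real^'n"
    interpret bounded_linear "frechet_derivative f (at x)" using df[of x] by (rule has_derivative_bounded_linear)
    have "frechet_derivative f (at x) v = frechet_derivative f (at x) (\<Sum>i\<in>UNIV. (v $ i) *\<^sub>R axis i 1)"
      using basis_expansion[of v] by (simp add: scalar_mult_eq_scaleR)
    also have "\<dots> = (\<Sum>i\<in>UNIV. (v $ i) *\<^sub>R frechet_derivative f (at x) (axis i 1))" by (simp add: sum scaleR)
    also have "norm \<dots> \<le> (\<Sum>i\<in>UNIV. norm v * B i)"
      by (intro sum_norm_le) (auto intro!: mult_mono B component_le_norm_cart)
    finally show "norm (frechet_derivative f (at x) v) \<le> L * norm v" by (simp add: L_def sum_distrib_left mult.commute)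
  qed
  have "norm (f x - f y) \<le> L * norm (x - y)" for x y
    by (rule differentiable_bound[of UNIV f "\<lambda>x. frechet_derivative f (at x)"]) (use df on in auto)
  moreover have "L \<ge> 0" unfolding L_def using B(1) by (intro sum_nonneg) (auto intro: less_imp_le)
  ultimately show ?thesis by (rule that[rotated])
qed

lemma test_functions_difference_quotient:
  fixes f :: "real ^ 'n \<Rightarrow> complex"
  assumes f: "f \<in> test_functions U"
  obtains C where "C \<ge> 0" "\<And>h. norm h \<le> 1 \<Longrightarrow> norm2_on lborel (\<lambda>x. f (x + h) - f x) \<le> C * (norm h)\<^sup>2"
proof -
  obtain L where L: "L \<ge> 0" "\<And>x y. norm (f x - f y) \<le> L * norm (x - y)" using test_functions_Lipschitz[OF f] by blast
  let ?K = "closure {x. f x \<noteq> 0}"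
  have "bounded ?K" using f by (auto simp: test_functions_def compact_imp_bounded)
  then obtain R where R: "\<And>x. x \<in> ?K \<Longrightarrow> norm x \<le> R" by (auto simp: bounded_iff)
  have z: "f x = 0" if "norm x > R" for x
    using R[of x] closure_subset[of "{x. f x \<noteq> 0}"] that by force
  have [measurable]: "f \<in> borel_measurable borel" using test_functions_L1_L2[OF f] by auto
  (* Outside this ball both f x and f (x + h) vanish when norm h <= 1. *)
  let ?B = "cball (0::real^'n) (R + 1)"
  have le: "norm2_on lborel (\<lambda>x. f (x + h) - f x) \<le> (L\<^sup>2 * measure lborel ?B) * (norm h)\<^sup>2" if h: "norm h \<le> 1" for h
  proof -
    have i1: "integrable lborel (\<lambda>x. (L * norm h)\<^sup>2 * indicator ?B x)"
      using emeasure_compact_finite[OF compact_cball, of "0::real^'n" "R+1"] by (intro integrable_mult_right integrable_real_indicator) auto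
    have "norm2_on lborel (\<lambda>x. f (x + h) - f x) \<le> (LINT x|lborel. (L * norm h)\<^sup>2 * indicator ?B x)"
      unfolding norm2_on_def
    proof (rule integral_mono[OF _ i1])
      show "integrable lborel (\<lambda>x. (norm (f (x + h) - f x))\<^sup>2)"
        by (intro L2_on_integrable L2_on_diff L2_on_translate test_functions_L1_L2[OF f])
      fix x :: "real^'n"
      show "(norm (f (x + h) - f x))\<^sup>2 \<le> (L * norm h)\<^sup>2 * indicator ?B x"
      proof (cases "x \<in> ?B")
        case True
        then show ?thesis using power_mono[OF L(2)[of "x + h" x], of 2] by simp
      next
        case False
        then have "norm x > R" "norm (x + h) > R" using h norm_diff_ineq[of x h] by auto
        then show ?thesis using z by simp
      qed
    qed
    also have "\<dots> = (L\<^sup>2 * measure lborel ?B) * (norm h)\<^sup>2" by (simp add: power_mult_distrib)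
    finally show ?thesis .
  qed
  show ?thesis by (rule that[OF _ le]) auto
qed

lemma norm2_fourier_translate_diff:
  fixes u :: "real ^ 'n \<Rightarrow> complex"
  assumes u: "integrable lborel u" "u \<in> L2_on lborel"
  shows "(\<integral>\<^sup>+\<xi>. ennreal ((norm (exp (\<i> * complex_of_real (h \<bullet> \<xi>)) - 1))\<^sup>2 * (norm (fourier_integral u \<xi>))\<^sup>2) \<partial>lborel)
    = ennreal (norm2_on lborel (\<lambda>x. u (x + h) - u x))"
proof -
  have [measurable]: "u \<in> borel_measurable borel" using u by auto
  have ut: "integrable lborel (\<lambda>x. u (x + h))" "(\<lambda>x. u (x + h)) \<in> L2_on lborel"
    using integrable_lborel_translate[OF u(1)] L2_on_translate[OF u(2)] by auto
  have "fourier_integral (\<lambda>x. u (x + h) - u x) \<xi> = (exp (\<i> * complex_of_real (h \<bullet> \<xi>)) - 1) * fourier_integral u \<xi>" for \<xi>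
    by (simp add: fourier_integral_diff[OF ut(1) u(1)] fourier_integral_translate ring_distribs)
  then have "(\<integral>\<^sup>+\<xi>. ennreal ((norm (exp (\<i> * complex_of_real (h \<bullet> \<xi>)) - 1))\<^sup>2 * (norm (fourier_integral u \<xi>))\<^sup>2) \<partial>lborel) =
     (\<integral>\<^sup>+\<xi>. ennreal ((norm (fourier_integral (\<lambda>x. u (x + h) - u x) \<xi>))\<^sup>2) \<partial>lborel)"
    by (simp add: norm_mult power_mult_distrib)
  also have "\<dots> = ennreal (norm2_on lborel (fourier_integral (\<lambda>x. u (x + h) - u x)))"
    by (intro nn_norm2_on Plancherel Bochner_Integration.integrable_diff L2_on_diff ut u)
  also have "norm2_on lborel (fourier_integral (\<lambda>x. u (x + h) - u x)) = norm2_on lborel (\<lambda>x. u (x + h) - u x)"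
    by (intro Plancherel Bochner_Integration.integrable_diff L2_on_diff ut u)
  finally show ?thesis .
qed

lemma difference_quotient_limit:
  fixes t :: real
  assumes "\<And>k. e k > 0" "e \<longlonglongrightarrow> 0"
  shows "(\<lambda>k. (norm (exp (\<i> * complex_of_real (e k * t)) - 1))\<^sup>2 / (e k)\<^sup>2) \<longlonglongrightarrow> t\<^sup>2"
proof -
  have "((\<lambda>x::complex. exp (\<i> * complex_of_real t * x)) has_field_derivative \<i> * complex_of_real t) (at 0)"
    by (auto intro!: derivative_eq_intros)
  then have "((\<lambda>x::complex. (exp (\<i> * complex_of_real t * x) - 1) / x) \<longlongrightarrow> \<i> * complex_of_real t) (at 0)"
    by (simp add: has_field_derivative_iff)
  moreover have "filterlim (\<lambda>k. complex_of_real (e k)) (at 0) sequentially"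
    using assms(1) tendsto_of_real[OF assms(2), where 'a=complex]
    by (auto simp: filterlim_at less_imp_neq intro!: always_eventually) (metis less_irrefl)
  ultimately have "(\<lambda>k. (exp (\<i> * complex_of_real t * complex_of_real (e k)) - 1) / complex_of_real (e k)) \<longlonglongrightarrow> \<i> * complex_of_real t"
    by (rule filterlim_compose)
  then have "(\<lambda>k. (norm ((exp (\<i> * complex_of_real t * complex_of_real (e k)) - 1) / complex_of_real (e k)))\<^sup>2) \<longlonglongrightarrow> (norm (\<i> * complex_of_real t))\<^sup>2"
    by (intro tendsto_intros)
  then show ?thesis by (simp add: norm_divide norm_mult power_divide mult_ac)
qed

text \<open>
  By Plancherel the transforms of the difference quotients of \<open>f\<close> in a coordinate direction are bounded in
  \<open>L\<^sup>2\<close>, since \<open>f\<close> is Lipschitz with compact support; the Fatou lemma passes to the limit of vanishing step.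
\<close>

lemma test_functions_gradient_fourier:
  fixes f :: "real ^ 'n \<Rightarrow> complex"
  assumes f: "f \<in> test_functions U"
  shows "(\<integral>\<^sup>+\<xi>. ennreal ((1 + (norm \<xi>)\<^sup>2) * (norm (fourier_integral f \<xi>))\<^sup>2) \<partial>lborel) < \<infinity>"
proof -
  note L = test_functions_L1_L2[OF f]
  have [measurable]: "f \<in> borel_measurable borel" using L by auto
  obtain C where C: "C \<ge> 0" "\<And>h. norm h \<le> 1 \<Longrightarrow> norm2_on lborel (\<lambda>x. f (x + h) - f x) \<le> C * (norm h)\<^sup>2"
    using test_functions_difference_quotient[OF f] by blast
  define e where "e = (\<lambda>k::nat. inverse (real (Suc k)))"
  have e: "e k > 0" "e k \<le> 1" for k by (auto simp: e_def inverse_le_1_iff)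
  have e0: "e \<longlonglongrightarrow> 0" unfolding e_def by (rule LIMSEQ_inverse_real_of_nat)
  have comp: "(\<integral>\<^sup>+\<xi>. ennreal ((\<xi> $ i)\<^sup>2 * (norm (fourier_integral f \<xi>))\<^sup>2) \<partial>lborel) \<le> ennreal C" for i
  proof -
    let ?g = "\<lambda>k \<xi>. ennreal ((norm (exp (\<i> * complex_of_real ((e k *\<^sub>R axis i 1) \<bullet> \<xi>)) - 1))\<^sup>2 / (e k)\<^sup>2 * (norm (fourier_integral f \<xi>))\<^sup>2)"
    have lim: "(\<lambda>k. ?g k \<xi>) \<longlonglongrightarrow> ennreal ((\<xi> $ i)\<^sup>2 * (norm (fourier_integral f \<xi>))\<^sup>2)" for \<xi>
    proof -
      have "axis i 1 \<bullet> \<xi> = \<xi> $ i" by (simp add: inner_axis')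
      then show ?thesis
        using difference_quotient_limit[OF e(1) e0, of "\<xi> $ i"] by (intro tendsto_ennrealI tendsto_mult tendsto_const) simp
    qed
    have "(\<integral>\<^sup>+\<xi>. ennreal ((\<xi> $ i)\<^sup>2 * (norm (fourier_integral f \<xi>))\<^sup>2) \<partial>lborel) = (\<integral>\<^sup>+\<xi>. liminf (\<lambda>k. ?g k \<xi>) \<partial>lborel)"
      using lim_imp_Liminf[OF _ lim] by (intro nn_integral_cong) simp
    also have "\<dots> \<le> liminf (\<lambda>k. \<integral>\<^sup>+\<xi>. ?g k \<xi> \<partial>lborel)" by (rule nn_integral_liminf) measurable
    also have "\<dots> \<le> limsup (\<lambda>k. \<integral>\<^sup>+\<xi>. ?g k \<xi> \<partial>lborel)" by (rule Liminf_le_Limsup) simp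
    also have "\<dots> \<le> ennreal C"
    proof (rule Limsup_bounded, rule always_eventually, rule allI)
      fix k
      have "(\<integral>\<^sup>+\<xi>. ?g k \<xi> \<partial>lborel) = (\<integral>\<^sup>+\<xi>. ennreal (1 / (e k)\<^sup>2) * ennreal ((norm (exp (\<i> * complex_of_real ((e k *\<^sub>R axis i 1) \<bullet> \<xi>)) - 1))\<^sup>2 * (norm (fourier_integral f \<xi>))\<^sup>2) \<partial>lborel)"
        by (intro nn_integral_cong) (simp add: ennreal_mult[symmetric])
      also have "\<dots> = ennreal (1 / (e k)\<^sup>2) * ennreal (norm2_on lborel (\<lambda>x. f (x + e k *\<^sub>R axis i 1) - f x))"
        unfolding norm2_fourier_translate_diff[OF L(2,1), symmetric] by (rule nn_integral_cmult) measurable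
      also have "\<dots> \<le> ennreal (1 / (e k)\<^sup>2) * ennreal (C * (e k)\<^sup>2)"
        using C(2)[of "e k *\<^sub>R axis i 1"] e[of k] by (intro mult_left_mono ennreal_leI) auto
      also have "\<dots> = ennreal C" using e(1)[of k] C by (simp add: ennreal_mult[symmetric])
      finally show "(\<integral>\<^sup>+\<xi>. ?g k \<xi> \<partial>lborel) \<le> ennreal C" .
    qed
    finally show ?thesis .
  qed
  have "(\<integral>\<^sup>+\<xi>. ennreal ((1 + (norm \<xi>)\<^sup>2) * (norm (fourier_integral f \<xi>))\<^sup>2) \<partial>lborel) =
    (\<integral>\<^sup>+\<xi>. ennreal ((norm (fourier_integral f \<xi>))\<^sup>2) + (\<Sum>i\<in>UNIV. ennreal ((\<xi> $ i)\<^sup>2 * (norm (fourier_integral f \<xi>))\<^sup>2)) \<partial>lborel)"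
  proof (rule nn_integral_cong)
    fix \<xi> :: "real^'n"
    let ?A = "(norm (fourier_integral f \<xi>))\<^sup>2"
    have "(norm \<xi>)\<^sup>2 = \<xi> \<bullet> \<xi>" by (rule power2_norm_eq_inner)
    also have "\<dots> = (\<Sum>i\<in>UNIV. (\<xi> $ i)\<^sup>2)" by (simp add: inner_vec_def power2_eq_square)
    finally have "(1 + (norm \<xi>)\<^sup>2) * ?A = ?A + (\<Sum>i\<in>UNIV. (\<xi> $ i)\<^sup>2 * ?A)"
      by (simp only: distrib_right sum_distrib_right mult_1_left)
    then show "ennreal ((1 + (norm \<xi>)\<^sup>2) * ?A) = ennreal ?A + (\<Sum>i\<in>UNIV. ennreal ((\<xi> $ i)\<^sup>2 * ?A))"
      by (simp only: sum_ennreal[symmetric] ennreal_plus zero_le_power2 sum_nonneg zero_le_mult_iff simp_thms)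
  qed
  also have "\<dots> = (\<integral>\<^sup>+\<xi>. ennreal ((norm (fourier_integral f \<xi>))\<^sup>2) \<partial>lborel) + (\<integral>\<^sup>+\<xi>. (\<Sum>i\<in>UNIV. ennreal ((\<xi> $ i)\<^sup>2 * (norm (fourier_integral f \<xi>))\<^sup>2)) \<partial>lborel)"
    by (rule nn_integral_add) measurable
  also have "(\<integral>\<^sup>+\<xi>. (\<Sum>i\<in>UNIV. ennreal ((\<xi> $ i)\<^sup>2 * (norm (fourier_integral f \<xi>))\<^sup>2)) \<partial>lborel) = (\<Sum>i\<in>UNIV. \<integral>\<^sup>+\<xi>. ennreal ((\<xi> $ i)\<^sup>2 * (norm (fourier_integral f \<xi>))\<^sup>2) \<partial>lborel)"
    by (rule nn_integral_sum) measurable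
  also have "(\<integral>\<^sup>+\<xi>. ennreal ((norm (fourier_integral f \<xi>))\<^sup>2) \<partial>lborel) = ennreal (norm2_on lborel f)"
    using nn_norm2_on[OF Plancherel(1)[OF L(2,1)]] unfolding Plancherel(2)[OF L(2,1)] .
  also have "ennreal (norm2_on lborel f) + (\<Sum>i\<in>UNIV. \<integral>\<^sup>+\<xi>. ennreal ((\<xi> $ i)\<^sup>2 * (norm (fourier_integral f \<xi>))\<^sup>2) \<partial>lborel) \<le> ennreal (norm2_on lborel f) + (\<Sum>i\<in>(UNIV :: 'n set). ennreal C)"
    by (intro add_left_mono sum_mono comp)
  also have "(\<Sum>i\<in>(UNIV :: 'n set). ennreal C) = ennreal (\<Sum>i\<in>(UNIV :: 'n set). C)"
    using C(1) by (intro sum_ennreal)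
  also have "ennreal (norm2_on lborel f) + ennreal (\<Sum>i\<in>(UNIV :: 'n set). C) < \<infinity>"
    by simp
  finally show ?thesis .
qed

section \<open>Integrable functions of finite Sobolev norm\<close>

definition weighted_fourier :: "real \<Rightarrow> (real ^ 'n \<Rightarrow> complex) \<Rightarrow> real ^ 'n \<Rightarrow> complex" where
  "weighted_fourier s u \<xi> = complex_of_real ((1 + (norm \<xi>)\<^sup>2) powr (s / 2)) * fourier_integral u \<xi>"

text \<open>
  Square integrable functions that vanish off a bounded set are integrable, and the Fourier integral then represents the
  Fourier transform. Unlike the latter it is defined pointwise, so that Fubini and pointwise limits apply. The functions
  to which the energy form is applied below lie in this class.
\<close>

definition Hs_L1 :: "real \<Rightarrow> (real ^ 'n \<Rightarrow> complex) set" where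
  "Hs_L1 s = {u \<in> L2_on lborel. integrable lborel u \<and> weighted_fourier s u \<in> L2_on lborel}"

lemma Hs_L1D: "u \<in> Hs_L1 s \<Longrightarrow> u \<in> L2_on lborel" "u \<in> Hs_L1 s \<Longrightarrow> integrable lborel u"
  "u \<in> Hs_L1 s \<Longrightarrow> weighted_fourier s u \<in> L2_on lborel"
  by (auto simp: Hs_L1_def)

lemma weighted_fourier_measurable [measurable]:
  "u \<in> borel_measurable borel \<Longrightarrow> weighted_fourier s u \<in> borel_measurable borel"
  unfolding weighted_fourier_def[abs_def] by measurable

lemma weighted_fourier_add_scale:
  assumes "integrable lborel u" "integrable lborel v"
  shows "weighted_fourier s (\<lambda>x. u x + c * v x) = (\<lambda>\<xi>. weighted_fourier s u \<xi> + c * weighted_fourier s v \<xi>)"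
  by (auto simp: weighted_fourier_def fourier_integral_add[OF assms] algebra_simps)

lemma weighted_fourier_diff:
  assumes "integrable lborel u" "integrable lborel v"
  shows "weighted_fourier s (\<lambda>x. u x - v x) = (\<lambda>\<xi>. weighted_fourier s u \<xi> - weighted_fourier s v \<xi>)"
  using weighted_fourier_add_scale[OF assms, of s "-1"] by simp

lemma Hs_L1_add_scale:
  assumes "u \<in> Hs_L1 s" "v \<in> Hs_L1 s" shows "(\<lambda>x. u x + c * v x) \<in> Hs_L1 s"
  using assms unfolding Hs_L1_def
  by (auto simp: weighted_fourier_add_scale intro!: L2_on_add L2_on_scale)

lemma Hs_L1_diff:
  assumes "u \<in> Hs_L1 s" "v \<in> Hs_L1 s" shows "(\<lambda>x. u x - v x) \<in> Hs_L1 s"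
  using Hs_L1_add_scale[OF assms, of "-1"] by simp

lemma sobolev_weight_L1:
  assumes u: "u \<in> L2_on lborel" "integrable lborel u"
  shows "AE \<xi> in lborel. (1 + (norm \<xi>)\<^sup>2) powr (s / 2) *\<^sub>R fourier u \<xi> = weighted_fourier s u \<xi>"
  using fourier_eq_fourier_integral[OF u]
  by eventually_elim (simp add: weighted_fourier_def scaleR_conv_of_real)

lemma L2_on_cong_AE:
  assumes ae: "AE x in M. f x = g x" and [measurable]: "f \<in> borel_measurable M" "g \<in> borel_measurable M"
  shows "f \<in> L2_on M \<longleftrightarrow> g \<in> L2_on M"
proof -
  have "(\<integral>\<^sup>+x. ennreal ((norm (f x))\<^sup>2) \<partial>M) = (\<integral>\<^sup>+x. ennreal ((norm (g x))\<^sup>2) \<partial>M)"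
    using ae by (intro nn_integral_cong_AE) auto
  then show ?thesis by (simp add: L2_on_iff_nn)
qed

lemma fourier_measurable: "u \<in> L2_on lborel \<Longrightarrow> (\<lambda>\<xi>. (1 + (norm \<xi>)\<^sup>2) powr (s / 2) *\<^sub>R fourier u \<xi>) \<in> borel_measurable lborel"
proof -
  assume "u \<in> L2_on lborel"
  from L2_onD[OF fourier_L2[OF this]] have [measurable]: "fourier u \<in> borel_measurable lborel" .
  show ?thesis by measurable
qed

lemma sobolev_iff_Hs_L1:
  assumes u: "u \<in> L2_on lborel" "integrable lborel u"
  shows "u \<in> sobolev s \<longleftrightarrow> u \<in> Hs_L1 s"
proof -
  have [measurable]: "u \<in> borel_measurable borel" using u by auto
  show ?thesis using u L2_on_cong_AE[OF sobolev_weight_L1[OF u] fourier_measurable[OF u(1)], of s]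
    by (simp add: sobolev_def Hs_L1_def L2_eq_L2_on)
qed

lemma sobolev_norm_sq: "(sobolev_norm t u)\<^sup>2 = norm2_on lborel (\<lambda>\<xi>. (1 + (norm \<xi>)\<^sup>2) powr (t / 2) *\<^sub>R fourier u \<xi>)"
  unfolding sobolev_norm_def norm2_on_def[symmetric] by simp

lemma sobolev_norm_L1:
  assumes u: "u \<in> L2_on lborel" "integrable lborel u"
  shows "(sobolev_norm s u)\<^sup>2 = norm2_on lborel (weighted_fourier s u)"
proof -
  have [measurable]: "u \<in> borel_measurable borel" using u by auto
  show ?thesis unfolding sobolev_norm_sq by (rule norm2_on_cong_AE[OF sobolev_weight_L1[OF u] fourier_measurable[OF u(1)]]) simp
qed

lemma norm2_le_sobolev_norm:
  assumes s: "s \<ge> 0" and u: "u \<in> sobolev s"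
  shows "norm2_on lborel u \<le> (sobolev_norm s u)\<^sup>2"
proof -
  have uL: "u \<in> L2_on lborel" and w: "(\<lambda>\<xi>. (1 + (norm \<xi>)\<^sup>2) powr (s / 2) *\<^sub>R fourier u \<xi>) \<in> L2_on lborel"
    using u by (auto simp: sobolev_def L2_eq_L2_on)
  have "norm2_on lborel (fourier u) \<le> norm2_on lborel (\<lambda>\<xi>. (1 + (norm \<xi>)\<^sup>2) powr (s / 2) *\<^sub>R fourier u \<xi>)"
    unfolding norm2_on_def
  proof (rule integral_mono)
    fix \<xi> :: "real^'a"
    have "1 \<le> (1 + (norm \<xi>)\<^sup>2) powr (s / 2)" using s by (intro ge_one_powr_ge_zero) auto
    then have "1 * norm (fourier u \<xi>) \<le> (1 + (norm \<xi>)\<^sup>2) powr (s / 2) * norm (fourier u \<xi>)" by (intro mult_right_mono) auto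
    then show "(norm (fourier u \<xi>))\<^sup>2 \<le> (norm ((1 + (norm \<xi>)\<^sup>2) powr (s / 2) *\<^sub>R fourier u \<xi>))\<^sup>2"
      by (intro power_mono) auto
  qed (use L2_on_integrable[OF fourier_L2[OF uL]] L2_on_integrable[OF w] in auto)
  then show ?thesis by (simp add: norm2_fourier[OF uL] sobolev_norm_sq)
qed

text \<open>
  For \<open>s < 1\<close> the Sobolev weight is at most \<open>1 + (norm \<xi>)\<^sup>2\<close>.
\<close>

lemma test_functions_Hs_L1:
  assumes s: "0 < s" "s < 1" and f: "f \<in> test_functions U" shows "f \<in> Hs_L1 s"
proof -
  note L = test_functions_L1_L2[OF f]
  have [measurable]: "f \<in> borel_measurable borel" using L by auto
  have "(\<integral>\<^sup>+\<xi>. ennreal ((norm (weighted_fourier s f \<xi>))\<^sup>2) \<partial>lborel) \<le> (\<integral>\<^sup>+\<xi>. ennreal ((1 + (norm \<xi>)\<^sup>2) * (norm (fourier_integral f \<xi>))\<^sup>2) \<partial>lborel)"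
  proof (intro nn_integral_mono ennreal_leI)
    fix \<xi> :: "real^'a"
    have "((1 + (norm \<xi>)\<^sup>2) powr (s / 2))\<^sup>2 = (1 + (norm \<xi>)\<^sup>2) powr s"
      by (simp add: power2_eq_square powr_add[symmetric])
    also have "\<dots> \<le> (1 + (norm \<xi>)\<^sup>2) powr 1" using s by (intro powr_mono) auto
    also have "\<dots> = 1 + (norm \<xi>)\<^sup>2" by (subst powr_one) (auto intro: add_nonneg_nonneg)
    finally show "(norm (weighted_fourier s f \<xi>))\<^sup>2 \<le> (1 + (norm \<xi>)\<^sup>2) * (norm (fourier_integral f \<xi>))\<^sup>2"
      unfolding weighted_fourier_def norm_mult power_mult_distrib by (intro mult_right_mono) auto
  qed
  also have "\<dots> < \<infinity>" by (rule test_functions_gradient_fourier[OF f])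
  finally show ?thesis using L by (simp add: Hs_L1_def L2_on_iff_nn)
qed

lemma sobolev_tildeI:
  assumes v: "v \<in> Hs_L1 s" and \<phi>: "\<And>k. \<phi> k \<in> test_functions U" "\<And>k. \<phi> k \<in> Hs_L1 s"
    and lim: "(\<lambda>k. norm2_on lborel (weighted_fourier s (\<lambda>x. v x - \<phi> k x))) \<longlonglongrightarrow> 0"
  shows "v \<in> sobolev_tilde s U"
  unfolding sobolev_tilde_def
proof (intro CollectI conjI allI impI)
  show "v \<in> sobolev s" using v sobolev_iff_Hs_L1 by (auto simp: Hs_L1_def)
  fix e :: real assume e: "e > 0"
  then have "\<forall>\<^sub>F k in sequentially. norm2_on lborel (weighted_fourier s (\<lambda>x. v x - \<phi> k x)) < e\<^sup>2"
    using lim by (intro order_tendstoD(2)) auto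
  then obtain k where k: "norm2_on lborel (weighted_fourier s (\<lambda>x. v x - \<phi> k x)) < e\<^sup>2" by (auto simp: eventually_sequentially)
  have "(sobolev_norm s (\<lambda>x. v x - \<phi> k x))\<^sup>2 < e\<^sup>2"
    using k Hs_L1_diff[OF v \<phi>(2)] by (subst sobolev_norm_L1) (auto simp: Hs_L1_def)
  then have "sobolev_norm s (\<lambda>x. v x - \<phi> k x) < e" by (rule power2_less_imp_less[OF _ less_imp_le[OF e]])
  then show "\<exists>\<phi>\<in>test_functions U. sobolev_norm s (\<lambda>x. v x - \<phi> x) < e" using \<phi>(1) by blast
qed

lemma norm2_on_zero [simp]: "norm2_on M (\<lambda>x. 0) = 0"
  by (simp add: norm2_on_def)

lemma test_functions_sobolev_tilde:
  assumes s: "0 < s" "s < 1" and f: "f \<in> test_functions U" shows "f \<in> sobolev_tilde s U"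
proof (rule sobolev_tildeI[where \<phi> = "\<lambda>_. f"])
  show "(\<lambda>k. norm2_on lborel (weighted_fourier s (\<lambda>x. f x - f x))) \<longlonglongrightarrow> 0"
    by (simp add: weighted_fourier_def[abs_def] fourier_integral_def)
qed (use f test_functions_Hs_L1[OF s] in auto)

text \<open>
  The bridge from the abstract closure to \<open>Hs_L1\<close>: the \<open>L\<^sup>2\<close> limit of test functions of \<open>U\<close> vanishes
  off \<open>U\<close>, hence is integrable. Comparing the \<open>L\<^sup>2\<close> norm with the Sobolev norm requires \<open>v - \<phi>\<close> to lie in
  \<open>sobolev s\<close> before \<open>v\<close> is known to be integrable, and so requires linearity of the transform on
  \<open>L\<^sup>2\<close>; this comes from linearity on the truncations.
\<close>

lemma sobolev_tildeD:
  fixes U :: "(real ^ 'n) set"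
  assumes s: "0 < s" "s < 1" and U: "open U" "bounded U" and v: "v \<in> sobolev_tilde s U"
  shows "v \<in> Hs_L1 s" "AE x in lborel. x \<notin> U \<longrightarrow> v x = 0"
    "\<exists>\<phi>. (\<forall>k. \<phi> k \<in> test_functions U) \<and> (\<lambda>k. norm2_on lborel (weighted_fourier s (\<lambda>x. v x - \<phi> k x))) \<longlonglongrightarrow> 0"
proof -
  have vs: "v \<in> sobolev s" and ap: "\<And>e. e > 0 \<Longrightarrow> \<exists>\<phi>\<in>test_functions U. sobolev_norm s (\<lambda>x. v x - \<phi> x) < e"
    using v by (auto simp: sobolev_tilde_def)
  have vL: "v \<in> L2_on lborel" using vs by (simp add: sobolev_def L2_eq_L2_on)
  have "\<exists>\<phi>\<in>test_functions U. sobolev_norm s (\<lambda>x. v x - \<phi> x) < inverse (real (Suc k))" for k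
    by (rule ap) simp
  then obtain \<phi> where \<phi>: "\<And>k. \<phi> k \<in> test_functions U" "\<And>k. sobolev_norm s (\<lambda>x. v x - \<phi> k x) < inverse (real (Suc k))"
    by metis
  note \<phi>L = test_functions_L1_L2[OF \<phi>(1)] and \<phi>H = test_functions_Hs_L1[OF s \<phi>(1)]
  have ae: "AE \<xi> in lborel. fourier (\<lambda>x. v x - \<phi> k x) \<xi> = fourier v \<xi> - fourier (\<phi> k) \<xi>" for k
  proof -
    let ?F = "\<lambda>R u. fourier_integral (truncation R u)"
    have hv: "has_fourier v (fourier v)" and h\<phi>: "has_fourier (\<phi> k) (fourier (\<phi> k))"
      using has_fourier_fourier vL \<phi>L by auto
    have le: "norm2_on lborel (\<lambda>\<xi>. ?F R (\<lambda>x. v x - \<phi> k x) \<xi> - (fourier v \<xi> - fourier (\<phi> k) \<xi>)) \<le>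
       2 * norm2_on lborel (\<lambda>\<xi>. ?F R v \<xi> - fourier v \<xi>) + 2 * norm2_on lborel (\<lambda>\<xi>. ?F R (\<phi> k) \<xi> - fourier (\<phi> k) \<xi>)" for R
    proof -
      have "truncation R (\<lambda>x. v x - \<phi> k x) = (\<lambda>x. truncation R v x - truncation R (\<phi> k) x)"
        by (auto simp: truncation_def scaleR_diff_right)
      then have "(\<lambda>\<xi>. ?F R (\<lambda>x. v x - \<phi> k x) \<xi> - (fourier v \<xi> - fourier (\<phi> k) \<xi>)) =
        (\<lambda>\<xi>. (?F R v \<xi> - fourier v \<xi>) - (?F R (\<phi> k) \<xi> - fourier (\<phi> k) \<xi>))"
        by (auto simp: fourier_integral_diff truncation_integrable vL \<phi>L)
      then show ?thesis
        using norm2_on_diff_le[of "\<lambda>\<xi>. ?F R v \<xi> - fourier v \<xi>" lborel "\<lambda>\<xi>. ?F R (\<phi> k) \<xi> - fourier (\<phi> k) \<xi>"]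
        by (simp add: L2_on_diff Plancherel truncation_integrable truncation_L2 fourier_L2 vL \<phi>L)
    qed
    have "((\<lambda>R. 2 * norm2_on lborel (\<lambda>\<xi>. ?F R v \<xi> - fourier v \<xi>) + 2 * norm2_on lborel (\<lambda>\<xi>. ?F R (\<phi> k) \<xi> - fourier (\<phi> k) \<xi>)) \<longlongrightarrow> 2 * 0 + 2 * 0) (at_top :: real filter)"
      using hv h\<phi> by (intro tendsto_intros) (auto simp: has_fourier_iff vL \<phi>L)
    then have lim: "((\<lambda>R. 2 * norm2_on lborel (\<lambda>\<xi>. ?F R v \<xi> - fourier v \<xi>) + 2 * norm2_on lborel (\<lambda>\<xi>. ?F R (\<phi> k) \<xi> - fourier (\<phi> k) \<xi>)) \<longlongrightarrow> 0) (at_top :: real filter)"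
      by simp
    have "has_fourier (\<lambda>x. v x - \<phi> k x) (\<lambda>\<xi>. fourier v \<xi> - fourier (\<phi> k) \<xi>)"
      unfolding has_fourier_iff[OF L2_on_diff[OF vL \<phi>L(1)]]
      using tendsto_zero_squeeze[OF lim norm2_on_nonneg le] by (auto intro!: L2_on_diff fourier_L2 vL \<phi>L)
    then show ?thesis
      by (intro has_fourier_unique[OF L2_on_diff[OF vL \<phi>L(1)] has_fourier_fourier[OF L2_on_diff[OF vL \<phi>L(1)]]])
  qed
  have ds: "(\<lambda>x. v x - \<phi> k x) \<in> sobolev s" for k
  proof -
    have \<phi>s: "\<phi> k \<in> sobolev s" using \<phi>H[of k] \<phi>L[of k] sobolev_iff_Hs_L1 by blast
    have "AE \<xi> in lborel. (1 + (norm \<xi>)\<^sup>2) powr (s / 2) *\<^sub>R fourier (\<lambda>x. v x - \<phi> k x) \<xi> =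
      (1 + (norm \<xi>)\<^sup>2) powr (s / 2) *\<^sub>R fourier v \<xi> - (1 + (norm \<xi>)\<^sup>2) powr (s / 2) *\<^sub>R fourier (\<phi> k) \<xi>"
      using ae[of k] by eventually_elim (simp add: scaleR_diff_right)
    moreover have "(\<lambda>\<xi>. (1 + (norm \<xi>)\<^sup>2) powr (s / 2) *\<^sub>R fourier v \<xi> - (1 + (norm \<xi>)\<^sup>2) powr (s / 2) *\<^sub>R fourier (\<phi> k) \<xi>) \<in> L2_on lborel"
      using vs \<phi>s by (intro L2_on_diff) (auto simp: sobolev_def L2_eq_L2_on)
    ultimately have "(\<lambda>\<xi>. (1 + (norm \<xi>)\<^sup>2) powr (s / 2) *\<^sub>R fourier (\<lambda>x. v x - \<phi> k x) \<xi>) \<in> L2_on lborel"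
      using fourier_measurable[OF L2_on_diff[OF vL \<phi>L(1)[of k]], of s] by (subst L2_on_cong_AE) (auto dest: L2_onD)
    then show ?thesis using L2_on_diff[OF vL \<phi>L(1)[of k]] by (simp add: sobolev_def L2_eq_L2_on)
  qed
  have sn: "(sobolev_norm s (\<lambda>x. v x - \<phi> k x))\<^sup>2 \<le> (inverse (real (Suc k)))\<^sup>2" for k
    using less_imp_le[OF \<phi>(2)[of k]] by (intro power_mono) (auto simp: sobolev_norm_def)
  have "AE x in lborel. x \<notin> U \<longrightarrow> v x = 0"
  proof -
    have [measurable]: "v \<in> borel_measurable borel" "U \<in> sets borel" "\<And>k. \<phi> k \<in> borel_measurable borel"
      using L2_onD[OF vL] U L2_onD[OF \<phi>L(1)] by simp_all
    let ?w = "\<lambda>x. indicator (- U) x * v x"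
    have wL: "?w \<in> L2_on lborel"
    proof -
      have "integrable lborel (\<lambda>x. (norm (?w x))\<^sup>2)"
        by (rule Bochner_Integration.integrable_bound[OF L2_on_integrable[OF vL]]) (auto simp: indicator_def)
      then show ?thesis by (auto simp: L2_on_def)
    qed
    have wle: "norm2_on lborel ?w \<le> (inverse (real (Suc k)))\<^sup>2" for k
    proof -
      have "norm2_on lborel ?w \<le> norm2_on lborel (\<lambda>x. v x - \<phi> k x)"
        unfolding norm2_on_def
        by (rule integral_mono[OF L2_on_integrable[OF wL] L2_on_integrable[OF L2_on_diff[OF vL \<phi>L(1)[of k]]]])
          (use test_functions_vanish[OF \<phi>(1)] in \<open>auto simp: indicator_def\<close>)
      also have "\<dots> \<le> (sobolev_norm s (\<lambda>x. v x - \<phi> k x))\<^sup>2" using s by (intro norm2_le_sobolev_norm ds) auto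
      finally show ?thesis using sn[of k] by linarith
    qed
    have lim: "(\<lambda>k. (inverse (real (Suc k)))\<^sup>2) \<longlonglongrightarrow> 0\<^sup>2" by (intro tendsto_power LIMSEQ_inverse_real_of_nat)
    have "norm2_on lborel ?w \<le> 0\<^sup>2" by (rule LIMSEQ_le_const[OF lim]) (use wle in blast)
    then have "norm2_on lborel ?w = 0" using norm2_on_nonneg[of lborel ?w] by simp
    from norm2_on_eq_0[OF wL this] show ?thesis by eventually_elim auto
  qed
  then show v0: "AE x in lborel. x \<notin> U \<longrightarrow> v x = 0" .
  have v1: "integrable lborel v" by (rule L2_on_bounded_integrable[OF vL _ U(2) v0]) (use U in auto)
  show "v \<in> Hs_L1 s" using sobolev_iff_Hs_L1[OF vL v1] vs by simp
  have "(sobolev_norm s (\<lambda>x. v x - \<phi> k x))\<^sup>2 = norm2_on lborel (weighted_fourier s (\<lambda>x. v x - \<phi> k x))" for k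
    by (intro sobolev_norm_L1 L2_on_diff vL \<phi>L Bochner_Integration.integrable_diff v1)
  then have le: "norm2_on lborel (weighted_fourier s (\<lambda>x. v x - \<phi> k x)) \<le> (inverse (real (Suc k)))\<^sup>2" for k using sn[of k] by simp
  have "(\<lambda>k. (inverse (real (Suc k)))\<^sup>2) \<longlonglongrightarrow> 0\<^sup>2" by (intro tendsto_power LIMSEQ_inverse_real_of_nat)
  then have l0: "(\<lambda>k. (inverse (real (Suc k)))\<^sup>2) \<longlonglongrightarrow> 0" by simp
  have "(\<lambda>k. norm2_on lborel (weighted_fourier s (\<lambda>x. v x - \<phi> k x))) \<longlonglongrightarrow> 0"
    by (rule tendsto_zero_squeeze[OF l0 norm2_on_nonneg le])
  then show "\<exists>\<phi>. (\<forall>k. \<phi> k \<in> test_functions U) \<and> (\<lambda>k. norm2_on lborel (weighted_fourier s (\<lambda>x. v x - \<phi> k x))) \<longlonglongrightarrow> 0"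
    using \<phi>(1) by blast
qed

section \<open>Coercivity and solvability for nonlocal energy forms\<close>

lemma L1_sq_le_L2:
  fixes u :: "'a::euclidean_space \<Rightarrow> complex"
  assumes B: "bounded B" "B \<in> sets borel" and u: "u \<in> L2_on lborel" and v: "AE x in lborel. x \<notin> B \<longrightarrow> u x = 0"
  shows "(LINT x|lborel. norm (u x))\<^sup>2 \<le> norm2_on lborel u * measure lborel B"
proof -
  have u1: "integrable lborel u" by (rule L2_on_bounded_integrable[OF u B(2,1) v])
  have [measurable]: "u \<in> borel_measurable borel" using u1 by auto
  have bfin: "emeasure lborel B < \<infinity>" using emeasure_bounded_finite[OF B(1)] by simp
  have indL: "indicator B \<in> L2_on lborel" using bfin B by (intro indicator_L2_on) auto
  have nL: "(\<lambda>x. complex_of_real (norm (u x))) \<in> L2_on lborel" using u by (auto simp: L2_on_def)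
  have "(LINT x|lborel. norm (u x)) = (LINT x|lborel. norm (u x) * indicator B x)"
    using v B by (intro integral_cong_AE) (auto simp: indicator_def elim: eventually_mono)
  then have "complex_of_real (LINT x|lborel. norm (u x)) = inner_on lborel (\<lambda>x. complex_of_real (norm (u x))) (indicator B)"
    unfolding inner_on_def by (simp add: integral_complex_of_real[symmetric] del: integral_complex_of_real)
      (auto intro!: Bochner_Integration.integral_cong simp: indicator_def)
  then have "(norm (complex_of_real (LINT x|lborel. norm (u x))))\<^sup>2 \<le> norm2_on lborel (\<lambda>x. complex_of_real (norm (u x))) * norm2_on lborel (indicator B)"
    using inner_on_Cauchy_Schwarz[OF nL indL] by simp
  moreover have "norm2_on lborel (\<lambda>x. complex_of_real (norm (u x))) = norm2_on lborel u" by (simp add: norm2_on_def)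
  moreover have "norm2_on lborel (indicator B) = measure lborel B"
  proof -
    have "norm2_on lborel (indicator B) = (LINT x|lborel. indicator B x)"
      unfolding norm2_on_def by (intro Bochner_Integration.integral_cong) (auto simp: indicator_def)
    then show ?thesis by simp
  qed
  ultimately show ?thesis by simp
qed

lemma fourier_integral_sq_le:
  fixes u :: "real ^ 'n \<Rightarrow> complex"
  assumes B: "bounded B" "B \<in> sets borel" and u: "u \<in> L2_on lborel" and v: "AE x in lborel. x \<notin> B \<longrightarrow> u x = 0"
  shows "(norm (fourier_integral u \<xi>))\<^sup>2 \<le> (fconst TYPE('n))\<^sup>2 * measure lborel B * norm2_on lborel u"
proof -
  have u1: "integrable lborel u" by (rule L2_on_bounded_integrable[OF u B(2,1) v])
  have "(norm (fourier_integral u \<xi>))\<^sup>2 \<le> (fconst TYPE('n) * (LINT x|lborel. norm (u x)))\<^sup>2"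
    by (intro power_mono norm_fourier_integral_le u1) simp
  also have "\<dots> \<le> (fconst TYPE('n))\<^sup>2 * (norm2_on lborel u * measure lborel B)"
    unfolding power_mult_distrib by (intro mult_left_mono L1_sq_le_L2[OF B u v]) simp
  finally show ?thesis by (simp add: mult_ac)
qed

text \<open>
  Ellipticity enters through the multiplier of \<open>K\<close>, which is twice the symbol when \<open>K\<close> is \<open>kernel s a\<close>.
\<close>

locale nonlocal_kernel =
  fixes K :: "real ^ 'n \<Rightarrow> real" and s l L :: real
  assumes s: "0 < s" "s < 1" and l: "0 < l"
    and K_measurable [measurable]: "K \<in> borel_measurable borel"
    and K_nonneg: "\<And>z. 0 \<le> K z"
    and multiplier_ge: "\<And>\<xi>. ennreal (l * norm \<xi> powr (2 * s)) \<le>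
      (\<integral>\<^sup>+h. ennreal (K h * (norm (exp (\<i> * complex_of_real (h \<bullet> \<xi>)) - 1))\<^sup>2) \<partial>lborel)"
    and multiplier_le: "\<And>\<xi>. (\<integral>\<^sup>+h. ennreal (K h * (norm (exp (\<i> * complex_of_real (h \<bullet> \<xi>)) - 1))\<^sup>2) \<partial>lborel)
      \<le> ennreal (L * norm \<xi> powr (2 * s))"
begin

abbreviation P :: "((real ^ 'n) \<times> (real ^ 'n)) measure" where "P \<equiv> lborel \<Otimes>\<^sub>M lborel"

text \<open>
  Normalized so that the energy form is half the \<open>L\<^sup>2\<close> inner product of increments; the Hilbert space
  arguments then apply on the product space.
\<close>

definition increments :: "(real ^ 'n \<Rightarrow> complex) \<Rightarrow> (real ^ 'n) \<times> (real ^ 'n) \<Rightarrow> complex" where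
  "increments u = (\<lambda>(x, y). (u x - u y) * complex_of_real (sqrt (K (x - y))))"

definition form :: "(real ^ 'n \<Rightarrow> complex) \<Rightarrow> (real ^ 'n \<Rightarrow> complex) \<Rightarrow> complex" where
  "form u v = (1 / 2) * (LINT (x, y)|P. (u x - u y) * cnj (v x - v y) * complex_of_real (K (x - y)))"

lemma form_eq: "form u v = (1 / 2) * inner_on P (increments u) (increments v)"
proof -
  have "(u x - u y) * cnj (v x - v y) * complex_of_real (K (x - y)) = increments u (x, y) * cnj (increments v (x, y))" for x y
  proof -
    have "complex_of_real (K (x - y)) = complex_of_real (sqrt (K (x - y))) * complex_of_real (sqrt (K (x - y)))"
      using K_nonneg[of "x - y"] by (simp flip: of_real_mult)
    then show ?thesis by (simp add: increments_def mult_ac)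
  qed
  then show ?thesis by (simp add: form_def inner_on_def case_prod_unfold)
qed

lemma increments_measurable [measurable]:
  assumes [measurable]: "u \<in> borel_measurable borel" shows "increments u \<in> borel_measurable P"
  unfolding increments_def by measurable

lemma increments_add_scale: "increments (\<lambda>x. u x + c * v x) = (\<lambda>z. increments u z + c * increments v z)"
  by (auto simp: increments_def algebra_simps)

lemma increments_diff: "increments (\<lambda>x. u x - v x) = (\<lambda>z. increments u z - increments v z)"
  using increments_add_scale[of u "-1" v] by simp

text \<open>
  Substitution \<open>x = y + h\<close>, and then Plancherel in \<open>y\<close> for each fixed \<open>h\<close>.
\<close>

theorem energy_identity:
  assumes u: "u \<in> L2_on lborel" "integrable lborel u"
  shows "(\<integral>\<^sup>+z. ennreal ((norm (increments u z))\<^sup>2) \<partial>P) =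
    (\<integral>\<^sup>+\<xi>. (\<integral>\<^sup>+h. ennreal (K h * (norm (exp (\<i> * complex_of_real (h \<bullet> \<xi>)) - 1))\<^sup>2) \<partial>lborel) * ennreal ((norm (fourier_integral u \<xi>))\<^sup>2) \<partial>lborel)"
proof -
  have [measurable]: "u \<in> borel_measurable borel" using u by auto
  let ?e = "\<lambda>h \<xi>. (norm (exp (\<i> * complex_of_real (h \<bullet> \<xi>)) - 1))\<^sup>2"
  have "(\<integral>\<^sup>+z. ennreal ((norm (increments u z))\<^sup>2) \<partial>P) = (\<integral>\<^sup>+y. \<integral>\<^sup>+x. ennreal ((norm (increments u (x, y)))\<^sup>2) \<partial>lborel \<partial>lborel)"
    by (rule lborel_pair.nn_integral_snd[symmetric]) measurable
  also have "\<dots> = (\<integral>\<^sup>+y. \<integral>\<^sup>+x. ennreal (K (x - y) * (norm (u x - u y))\<^sup>2) \<partial>lborel \<partial>lborel)"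
    using K_nonneg by (simp add: increments_def norm_mult power_mult_distrib mult.commute)
  also have "\<dots> = (\<integral>\<^sup>+y. \<integral>\<^sup>+h. ennreal (K h * (norm (u (y + h) - u y))\<^sup>2) \<partial>lborel \<partial>lborel)"
  proof (rule nn_integral_cong)
    fix y :: "real^'n"
    have "(\<integral>\<^sup>+h. ennreal (K (h + y - y) * (norm (u (h + y) - u y))\<^sup>2) \<partial>lborel) = (\<integral>\<^sup>+x. ennreal (K (x - y) * (norm (u x - u y))\<^sup>2) \<partial>lborel)"
      by (rule nn_integral_lborel_translate[of "\<lambda>x. ennreal (K (x - y) * (norm (u x - u y))\<^sup>2)"]) measurable
    then show "(\<integral>\<^sup>+x. ennreal (K (x - y) * (norm (u x - u y))\<^sup>2) \<partial>lborel) = (\<integral>\<^sup>+h. ennreal (K h * (norm (u (y + h) - u y))\<^sup>2) \<partial>lborel)"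
      by (simp add: add.commute)
  qed
  also have "\<dots> = (\<integral>\<^sup>+h. \<integral>\<^sup>+y. ennreal (K h * (norm (u (y + h) - u y))\<^sup>2) \<partial>lborel \<partial>lborel)"
    by (rule lborel_pair.Fubini') measurable
  also have "\<dots> = (\<integral>\<^sup>+h. \<integral>\<^sup>+\<xi>. ennreal (K h * ?e h \<xi>) * ennreal ((norm (fourier_integral u \<xi>))\<^sup>2) \<partial>lborel \<partial>lborel)"
  proof (rule nn_integral_cong)
    fix h :: "real^'n"
    have ut: "(\<lambda>x. u (x + h) - u x) \<in> L2_on lborel" by (intro L2_on_diff L2_on_translate u)
    have "(\<integral>\<^sup>+y. ennreal (K h * (norm (u (y + h) - u y))\<^sup>2) \<partial>lborel) = (\<integral>\<^sup>+y. ennreal (K h) * ennreal ((norm (u (y + h) - u y))\<^sup>2) \<partial>lborel)"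
      using K_nonneg[of h] by (simp add: ennreal_mult)
    also have "\<dots> = ennreal (K h) * ennreal (norm2_on lborel (\<lambda>x. u (x + h) - u x))"
      unfolding nn_norm2_on[OF ut, symmetric] by (rule nn_integral_cmult) measurable
    also have "\<dots> = ennreal (K h) * (\<integral>\<^sup>+\<xi>. ennreal (?e h \<xi> * (norm (fourier_integral u \<xi>))\<^sup>2) \<partial>lborel)"
      unfolding norm2_fourier_translate_diff[OF u(2,1)] ..
    also have "\<dots> = (\<integral>\<^sup>+\<xi>. ennreal (K h) * ennreal (?e h \<xi> * (norm (fourier_integral u \<xi>))\<^sup>2) \<partial>lborel)"
      by (rule nn_integral_cmult[symmetric]) measurable
    also have "\<dots> = (\<integral>\<^sup>+\<xi>. ennreal (K h * ?e h \<xi>) * ennreal ((norm (fourier_integral u \<xi>))\<^sup>2) \<partial>lborel)"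
      using K_nonneg[of h] by (simp add: ennreal_mult mult.assoc)
    finally show "(\<integral>\<^sup>+y. ennreal (K h * (norm (u (y + h) - u y))\<^sup>2) \<partial>lborel) = \<dots>" .
  qed
  also have "\<dots> = (\<integral>\<^sup>+\<xi>. \<integral>\<^sup>+h. ennreal (K h * ?e h \<xi>) * ennreal ((norm (fourier_integral u \<xi>))\<^sup>2) \<partial>lborel \<partial>lborel)"
    by (rule lborel_pair.Fubini') measurable
  also have "\<dots> = (\<integral>\<^sup>+\<xi>. (\<integral>\<^sup>+h. ennreal (K h * ?e h \<xi>) \<partial>lborel) * ennreal ((norm (fourier_integral u \<xi>))\<^sup>2) \<partial>lborel)"
    by (intro nn_integral_cong nn_integral_multc) measurable
  finally show ?thesis .
qed

lemma increments_L2: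
  assumes u: "u \<in> Hs_L1 s"
  shows "increments u \<in> L2_on P" "norm2_on P (increments u) \<le> \<bar>L\<bar> * norm2_on lborel (weighted_fourier s u)"
proof -
  note D = Hs_L1D[OF u]
  have [measurable]: "u \<in> borel_measurable borel" using D by auto
  have "(\<integral>\<^sup>+z. ennreal ((norm (increments u z))\<^sup>2) \<partial>P) \<le> (\<integral>\<^sup>+\<xi>. ennreal \<bar>L\<bar> * ennreal ((norm (weighted_fourier s u \<xi>))\<^sup>2) \<partial>lborel)"
    unfolding energy_identity[OF D(1,2)]
  proof (rule nn_integral_mono)
    fix \<xi> :: "real^'n"
    have "norm \<xi> powr (2 * s) = (norm \<xi> powr 2) powr s" by (rule powr_powr[symmetric])
    also have "norm \<xi> powr 2 = (norm \<xi>)\<^sup>2" by (simp add: powr_numeral)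
    also have "((norm \<xi>)\<^sup>2) powr s \<le> (1 + (norm \<xi>)\<^sup>2) powr s" using s by (intro powr_mono2) auto
    also have "\<dots> = ((1 + (norm \<xi>)\<^sup>2) powr (s / 2))\<^sup>2" by (simp add: power2_eq_square powr_add[symmetric])
    finally have w: "norm \<xi> powr (2 * s) \<le> ((1 + (norm \<xi>)\<^sup>2) powr (s / 2))\<^sup>2" .
    have "L * norm \<xi> powr (2 * s) \<le> \<bar>L\<bar> * ((1 + (norm \<xi>)\<^sup>2) powr (s / 2))\<^sup>2" by (intro mult_mono w) auto
    then have "(\<integral>\<^sup>+h. ennreal (K h * (norm (exp (\<i> * complex_of_real (h \<bullet> \<xi>)) - 1))\<^sup>2) \<partial>lborel) \<le> ennreal (\<bar>L\<bar> * ((1 + (norm \<xi>)\<^sup>2) powr (s / 2))\<^sup>2)"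
      using multiplier_le[of \<xi>] ennreal_leI order_trans by blast
    then have "(\<integral>\<^sup>+h. ennreal (K h * (norm (exp (\<i> * complex_of_real (h \<bullet> \<xi>)) - 1))\<^sup>2) \<partial>lborel) * ennreal ((norm (fourier_integral u \<xi>))\<^sup>2)
       \<le> ennreal (\<bar>L\<bar> * ((1 + (norm \<xi>)\<^sup>2) powr (s / 2))\<^sup>2) * ennreal ((norm (fourier_integral u \<xi>))\<^sup>2)"
      by (rule mult_right_mono) simp
    also have "\<dots> = ennreal \<bar>L\<bar> * ennreal ((norm (weighted_fourier s u \<xi>))\<^sup>2)"
      by (simp add: weighted_fourier_def norm_mult power_mult_distrib ennreal_mult mult.assoc)
    finally show "(\<integral>\<^sup>+h. ennreal (K h * (norm (exp (\<i> * complex_of_real (h \<bullet> \<xi>)) - 1))\<^sup>2) \<partial>lborel) * ennreal ((norm (fourier_integral u \<xi>))\<^sup>2)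
       \<le> ennreal \<bar>L\<bar> * ennreal ((norm (weighted_fourier s u \<xi>))\<^sup>2)" .
  qed
  also have "\<dots> = ennreal \<bar>L\<bar> * ennreal (norm2_on lborel (weighted_fourier s u))"
    unfolding nn_norm2_on[OF D(3), symmetric] by (rule nn_integral_cmult) measurable
  also have "\<dots> = ennreal (\<bar>L\<bar> * norm2_on lborel (weighted_fourier s u))" by (simp add: ennreal_mult)
  finally have le: "(\<integral>\<^sup>+z. ennreal ((norm (increments u z))\<^sup>2) \<partial>P) \<le> ennreal (\<bar>L\<bar> * norm2_on lborel (weighted_fourier s u))" .
  have "increments u \<in> borel_measurable P" by measurable
  then show G: "increments u \<in> L2_on P" using le by (auto simp: L2_on_iff_nn le_less_trans)
  show "norm2_on P (increments u) \<le> \<bar>L\<bar> * norm2_on lborel (weighted_fourier s u)"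
    using le unfolding nn_norm2_on[OF G] by (subst (asm) ennreal_le_iff) auto
qed

lemma seminorm_le_energy:
  assumes u: "u \<in> L2_on lborel" "integrable lborel u" and G: "increments u \<in> L2_on P"
  shows "(\<integral>\<^sup>+\<xi>. ennreal (norm \<xi> powr (2 * s) * (norm (fourier_integral u \<xi>))\<^sup>2) \<partial>lborel) \<le> ennreal (norm2_on P (increments u) / l)"
proof -
  have [measurable]: "u \<in> borel_measurable borel" using u by auto
  let ?S = "\<integral>\<^sup>+\<xi>. ennreal (norm \<xi> powr (2 * s) * (norm (fourier_integral u \<xi>))\<^sup>2) \<partial>lborel"
  have "ennreal l * ?S = (\<integral>\<^sup>+\<xi>. ennreal l * ennreal (norm \<xi> powr (2 * s) * (norm (fourier_integral u \<xi>))\<^sup>2) \<partial>lborel)"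
    by (rule nn_integral_cmult[symmetric]) measurable
  also have "\<dots> = (\<integral>\<^sup>+\<xi>. ennreal (l * norm \<xi> powr (2 * s)) * ennreal ((norm (fourier_integral u \<xi>))\<^sup>2) \<partial>lborel)"
    using l by (simp add: ennreal_mult mult.assoc)
  also have "\<dots> \<le> (\<integral>\<^sup>+z. ennreal ((norm (increments u z))\<^sup>2) \<partial>P)"
    unfolding energy_identity[OF u] by (intro nn_integral_mono mult_right_mono multiplier_ge) simp
  also have "\<dots> = ennreal (norm2_on P (increments u))" by (rule nn_norm2_on[OF G])
  finally have "ennreal (1 / l) * (ennreal l * ?S) \<le> ennreal (1 / l) * ennreal (norm2_on P (increments u))"
    by (rule mult_left_mono) simp
  moreover have "ennreal (1 / l) * (ennreal l * ?S) = ?S"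
    unfolding mult.assoc[symmetric] using l by (subst ennreal_mult[symmetric]) auto
  ultimately show ?thesis using l by (simp add: ennreal_mult[symmetric])
qed

text \<open>
  If \<open>u\<close> vanishes off \<open>B\<close>, then \<open>(norm (fourier_integral u \<xi>))\<^sup>2 \<le> q * \<parallel>u\<parallel>\<^sup>2\<close> for all \<open>\<xi>\<close>, so
  a small ball of frequencies carries at most half of \<open>\<parallel>u\<parallel>\<^sup>2\<close>. Outside of it \<open>norm \<xi> powr (2 * s)\<close> is
  bounded below, and the energy controls the rest.
\<close>

theorem Poincare:
  fixes B :: "(real ^ 'n) set"
  assumes B: "bounded B" "B \<in> sets borel"
  obtains C where "C > 0" "\<And>u. u \<in> L2_on lborel \<Longrightarrow> (AE x in lborel. x \<notin> B \<longrightarrow> u x = 0) \<Longrightarrow> increments u \<in> L2_on P \<Longrightarrow>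
     norm2_on lborel u \<le> C * norm2_on P (increments u)"
proof -
  define b where "b = measure lborel B"
  have b0: "b \<ge> 0" by (simp add: b_def)
  define c where "c = fconst TYPE('n)"
  define q where "q = c\<^sup>2 * b"
  have q0: "q \<ge> 0" by (simp add: q_def b0)
  obtain r where r: "r > 0" "r \<le> 1" "q * measure lborel (ball (0::real^'n) r) \<le> 1 / 2"
  proof -
    have half: "t / (2 * (t + 1)) \<le> 1 / 2" if "t \<ge> 0" for t :: real
      using that by (simp add: divide_simps)
    define M where "M = measure lborel (ball (0::real^'n) 1)"
    have M0: "M \<ge> 0" by (simp add: M_def)
    (* As r <= 1, the ball of radius r has volume at most r * M, and q * (r * M) <= 1/2. *)
    define r where "r = 1 / (2 * (q * M + 1))"
    have r: "r > 0" "r \<le> 1" using q0 M0 by (auto simp: r_def divide_le_eq add_nonneg_pos mult_nonneg_nonneg)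
    have "ennreal (measure lborel (ball (0::real^'n) r)) \<le> ennreal (r * M)"
    proof -
      have fin: "emeasure lborel (ball (0::real^'n) t) = ennreal (measure lborel (ball (0::real^'n) t))" for t
        using emeasure_bounded_finite[OF bounded_ball, of "0::real^'n" t] by (intro emeasure_eq_ennreal_measure) auto
      have "emeasure lborel (ball (0::real^'n) r) = (\<integral>\<^sup>+x. indicator (ball (0::real^'n) r) x \<partial>lborel)" by simp
      also have "\<dots> = ennreal (\<bar>r\<bar> ^ DIM(real^'n)) * (\<integral>\<^sup>+x. indicator (ball (0::real^'n) r) (r *\<^sub>R x) \<partial>lborel)"
        using r by (intro nn_integral_lborel_scale borel_measurable_indicator) auto
      also have "(\<lambda>x. indicator (ball (0::real^'n) r) (r *\<^sub>R x) :: ennreal) = indicator (ball 0 1)"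
        using r by (auto simp: indicator_def)
      also have "(\<integral>\<^sup>+x. indicator (ball (0::real^'n) 1) x \<partial>lborel) = ennreal M" by (simp add: fin M_def)
      also have "ennreal (\<bar>r\<bar> ^ DIM(real^'n)) * ennreal M \<le> ennreal r * ennreal M"
        using r by (intro mult_right_mono ennreal_leI) (auto intro: power_le_one_iff power_decreasing[of 1 _ r, simplified])
      finally show ?thesis using r M0 by (simp add: fin ennreal_mult)
    qed
    then have "measure lborel (ball (0::real^'n) r) \<le> r * M" using r M0 by (subst (asm) ennreal_le_iff) auto
    then have "q * measure lborel (ball (0::real^'n) r) \<le> q * (r * M)" using q0 by (rule mult_left_mono)
    also have "\<dots> = (q * M) / (2 * (q * M + 1))" by (simp add: r_def)
    also have "\<dots> \<le> 1 / 2" by (rule half) (use q0 M0 in simp)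
    finally show ?thesis using r that by blast
  qed
  define C where "C = 2 / (r powr (2 * s) * l)"
  have "norm2_on lborel u \<le> C * norm2_on P (increments u)"
    if u: "u \<in> L2_on lborel" and v: "AE x in lborel. x \<notin> B \<longrightarrow> u x = 0" and G: "increments u \<in> L2_on P" for u
  proof -
    have u1: "integrable lborel u" by (rule L2_on_bounded_integrable[OF u B(2,1) v])
    have [measurable]: "u \<in> borel_measurable borel" using u1 by auto
    have pt: "(norm (fourier_integral u \<xi>))\<^sup>2 \<le> q * norm2_on lborel u" for \<xi>
      unfolding q_def c_def b_def by (rule fourier_integral_sq_le[OF B u v])
    have [measurable]: "ball (0::real^'n) r \<in> sets borel" by simp
    have "ennreal (norm2_on lborel u) = (\<integral>\<^sup>+\<xi>. ennreal ((norm (fourier_integral u \<xi>))\<^sup>2) \<partial>lborel)"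
      using nn_norm2_on[OF Plancherel(1)[OF u1 u]] unfolding Plancherel(2)[OF u1 u] by simp
    also have "\<dots> \<le> (\<integral>\<^sup>+\<xi>. ennreal (q * norm2_on lborel u) * indicator (ball 0 r) \<xi> +
        ennreal (1 / r powr (2 * s)) * ennreal (norm \<xi> powr (2 * s) * (norm (fourier_integral u \<xi>))\<^sup>2) \<partial>lborel)"
    proof (rule nn_integral_mono)
      fix \<xi> :: "real^'n"
      show "ennreal ((norm (fourier_integral u \<xi>))\<^sup>2) \<le> ennreal (q * norm2_on lborel u) * indicator (ball 0 r) \<xi> +
        ennreal (1 / r powr (2 * s)) * ennreal (norm \<xi> powr (2 * s) * (norm (fourier_integral u \<xi>))\<^sup>2)"
      proof (cases "\<xi> \<in> ball 0 r")
        case True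
        then show ?thesis using ennreal_leI[OF pt[of \<xi>]] by (simp add: add_increasing2)
      next
        case False
        then have "r powr (2 * s) \<le> norm \<xi> powr (2 * s)" using r s by (intro powr_mono2) auto
        then have "1 * (norm (fourier_integral u \<xi>))\<^sup>2 \<le> (1 / r powr (2 * s) * norm \<xi> powr (2 * s)) * (norm (fourier_integral u \<xi>))\<^sup>2"
          using r by (intro mult_right_mono) (auto simp: field_simps)
        then have "ennreal ((norm (fourier_integral u \<xi>))\<^sup>2) \<le> ennreal (1 / r powr (2 * s)) * ennreal (norm \<xi> powr (2 * s) * (norm (fourier_integral u \<xi>))\<^sup>2)"
          by (subst ennreal_mult[symmetric]) (auto intro!: ennreal_leI simp: mult.assoc)
        then show ?thesis using False by simp
      qed
    qed
    also have "\<dots> = (\<integral>\<^sup>+\<xi>. ennreal (q * norm2_on lborel u) * indicator (ball 0 r) (\<xi> :: real^'n) \<partial>lborel) +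
        (\<integral>\<^sup>+\<xi>. ennreal (1 / r powr (2 * s)) * ennreal (norm \<xi> powr (2 * s) * (norm (fourier_integral u \<xi>))\<^sup>2) \<partial>lborel)"
      by (rule nn_integral_add) measurable
    also have "(\<integral>\<^sup>+\<xi>. ennreal (q * norm2_on lborel u) * indicator (ball 0 r) (\<xi> :: real^'n) \<partial>lborel) = ennreal (q * norm2_on lborel u * measure lborel (ball (0::real^'n) r))"
    proof -
      have "emeasure lborel (ball (0::real^'n) r) = ennreal (measure lborel (ball (0::real^'n) r))"
        using emeasure_bounded_finite[OF bounded_ball, of "0::real^'n" r] by (intro emeasure_eq_ennreal_measure) auto
      then show ?thesis using q0 by (simp add: nn_integral_cmult_indicator ennreal_mult)
    qed
    also have "(\<integral>\<^sup>+\<xi>. ennreal (1 / r powr (2 * s)) * ennreal (norm \<xi> powr (2 * s) * (norm (fourier_integral u \<xi>))\<^sup>2) \<partial>lborel) =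
        ennreal (1 / r powr (2 * s)) * (\<integral>\<^sup>+\<xi>. ennreal (norm \<xi> powr (2 * s) * (norm (fourier_integral u \<xi>))\<^sup>2) \<partial>lborel)"
      by (rule nn_integral_cmult) measurable
    also have "ennreal (q * norm2_on lborel u * measure lborel (ball (0::real^'n) r)) + \<dots> \<le>
       ennreal (norm2_on lborel u / 2) + ennreal (1 / r powr (2 * s)) * ennreal (norm2_on P (increments u) / l)"
    proof (intro add_mono mult_left_mono ennreal_leI seminorm_le_energy u u1 G)
      have "(q * measure lborel (ball (0::real^'n) r)) * norm2_on lborel u \<le> (1 / 2) * norm2_on lborel u"
        using r(3) by (rule mult_right_mono) simp
      then show "q * norm2_on lborel u * measure lborel (ball (0::real^'n) r) \<le> norm2_on lborel u / 2"
        by (simp add: mult_ac)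
    qed simp
    also have "\<dots> = ennreal (norm2_on lborel u / 2 + 1 / r powr (2 * s) * (norm2_on P (increments u) / l))"
      using l by (simp add: ennreal_mult[symmetric] ennreal_plus[symmetric] del: ennreal_plus)
    finally have "norm2_on lborel u \<le> norm2_on lborel u / 2 + 1 / r powr (2 * s) * (norm2_on P (increments u) / l)"
      using l by (subst (asm) ennreal_le_iff) (auto intro!: add_nonneg_nonneg)
    then show ?thesis by (simp add: C_def field_simps)
  qed
  moreover have "C > 0" using r l by (simp add: C_def)
  ultimately show ?thesis using that by blast
qed

end

lemma one_plus_powr_le:
  fixes x s :: real
  assumes "0 \<le> x" "0 < s" "s < 1" shows "(1 + x) powr s \<le> 2 * (1 + x powr s)"
proof -
  have two: "2 powr s \<le> (2::real)" using assms powr_mono[of s 1 2] by simp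
  show ?thesis
  proof (cases "x \<le> 1")
    case True
    then have "(1 + x) powr s \<le> 2 powr s" using assms by (intro powr_mono2) auto
    also note two
    also have "2 \<le> 2 * (1 + x powr s)" by simp
    finally show ?thesis .
  next
    case False
    then have "(1 + x) powr s \<le> (2 * x) powr s" using assms by (intro powr_mono2) auto
    also have "\<dots> = 2 powr s * x powr s" using assms by (simp add: powr_mult)
    also have "\<dots> \<le> 2 * x powr s" using two by (intro mult_right_mono) auto
    finally show ?thesis by simp
  qed
qed

context nonlocal_kernel
begin

lemma Hs_le_energy:
  fixes B :: "(real ^ 'n) set"
  assumes B: "bounded B" "B \<in> sets borel"
  obtains D where "D > 0" "\<And>u. u \<in> L2_on lborel \<Longrightarrow> (AE x in lborel. x \<notin> B \<longrightarrow> u x = 0) \<Longrightarrow> increments u \<in> L2_on P \<Longrightarrow>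
     (\<integral>\<^sup>+\<xi>. ennreal ((norm (weighted_fourier s u \<xi>))\<^sup>2) \<partial>lborel) \<le> ennreal (D * norm2_on P (increments u))"
proof -
  obtain C where C: "C > 0" "\<And>u. u \<in> L2_on lborel \<Longrightarrow> (AE x in lborel. x \<notin> B \<longrightarrow> u x = 0) \<Longrightarrow> increments u \<in> L2_on P \<Longrightarrow>
     norm2_on lborel u \<le> C * norm2_on P (increments u)"
    using Poincare[OF B] by blast
  have "(\<integral>\<^sup>+\<xi>. ennreal ((norm (weighted_fourier s u \<xi>))\<^sup>2) \<partial>lborel) \<le> ennreal ((2 * C + 2 / l) * norm2_on P (increments u))"
    if u: "u \<in> L2_on lborel" and v: "AE x in lborel. x \<notin> B \<longrightarrow> u x = 0" and G: "increments u \<in> L2_on P" for u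
  proof -
    have u1: "integrable lborel u" by (rule L2_on_bounded_integrable[OF u B(2,1) v])
    have [measurable]: "u \<in> borel_measurable borel" using u1 by auto
    have "(\<integral>\<^sup>+\<xi>. ennreal ((norm (weighted_fourier s u \<xi>))\<^sup>2) \<partial>lborel) \<le>
      (\<integral>\<^sup>+\<xi>. 2 * ennreal ((norm (fourier_integral u \<xi>))\<^sup>2) + 2 * ennreal (norm \<xi> powr (2 * s) * (norm (fourier_integral u \<xi>))\<^sup>2) \<partial>lborel)"
    proof (rule nn_integral_mono)
      fix \<xi> :: "real^'n"
      let ?A = "(norm (fourier_integral u \<xi>))\<^sup>2"
      have "((norm \<xi>)\<^sup>2) powr s = (norm \<xi> powr 2) powr s" by (simp add: powr_numeral)
      also have "\<dots> = norm \<xi> powr (2 * s)" by (rule powr_powr)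
      finally have e: "((norm \<xi>)\<^sup>2) powr s = norm \<xi> powr (2 * s)" .
      have "((1 + (norm \<xi>)\<^sup>2) powr (s / 2))\<^sup>2 = (1 + (norm \<xi>)\<^sup>2) powr s" by (simp add: power2_eq_square powr_add[symmetric])
      also have "\<dots> \<le> 2 * (1 + norm \<xi> powr (2 * s))" using one_plus_powr_le[OF _ s, of "(norm \<xi>)\<^sup>2"] unfolding e by simp
      finally have "((1 + (norm \<xi>)\<^sup>2) powr (s / 2))\<^sup>2 * ?A \<le> (2 * (1 + norm \<xi> powr (2 * s))) * ?A" by (rule mult_right_mono) simp
      then have "ennreal ((norm (weighted_fourier s u \<xi>))\<^sup>2) \<le> ennreal (2 * ?A + 2 * (norm \<xi> powr (2 * s) * ?A))"
        by (intro ennreal_leI) (simp add: weighted_fourier_def norm_mult power_mult_distrib algebra_simps)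
      also have "\<dots> = 2 * ennreal ?A + 2 * ennreal (norm \<xi> powr (2 * s) * ?A)"
        by (subst ennreal_plus) (auto simp: ennreal_mult)
      finally show "ennreal ((norm (weighted_fourier s u \<xi>))\<^sup>2) \<le> 2 * ennreal ?A + 2 * ennreal (norm \<xi> powr (2 * s) * ?A)" .
    qed
    also have "\<dots> = (\<integral>\<^sup>+\<xi>. 2 * ennreal ((norm (fourier_integral u \<xi>))\<^sup>2) \<partial>lborel) + (\<integral>\<^sup>+\<xi>. 2 * ennreal (norm \<xi> powr (2 * s) * (norm (fourier_integral u \<xi>))\<^sup>2) \<partial>lborel)"
      by (rule nn_integral_add) measurable
    also have "(\<integral>\<^sup>+\<xi>. 2 * ennreal ((norm (fourier_integral u \<xi>))\<^sup>2) \<partial>lborel) = 2 * (\<integral>\<^sup>+\<xi>. ennreal ((norm (fourier_integral u \<xi>))\<^sup>2) \<partial>lborel)"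
      by (rule nn_integral_cmult) measurable
    also have "(\<integral>\<^sup>+\<xi>. 2 * ennreal (norm \<xi> powr (2 * s) * (norm (fourier_integral u \<xi>))\<^sup>2) \<partial>lborel) = 2 * (\<integral>\<^sup>+\<xi>. ennreal (norm \<xi> powr (2 * s) * (norm (fourier_integral u \<xi>))\<^sup>2) \<partial>lborel)"
      by (rule nn_integral_cmult) measurable
    also have "(\<integral>\<^sup>+\<xi>. ennreal ((norm (fourier_integral u \<xi>))\<^sup>2) \<partial>lborel) = ennreal (norm2_on lborel u)"
      using nn_norm2_on[OF Plancherel(1)[OF u1 u]] unfolding Plancherel(2)[OF u1 u] .
    also have "2 * ennreal (norm2_on lborel u) + 2 * (\<integral>\<^sup>+\<xi>. ennreal (norm \<xi> powr (2 * s) * (norm (fourier_integral u \<xi>))\<^sup>2) \<partial>lborel) \<le>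
       2 * ennreal (C * norm2_on P (increments u)) + 2 * ennreal (norm2_on P (increments u) / l)"
      by (intro add_mono mult_left_mono ennreal_leI C(2) seminorm_le_energy u u1 v G) auto
    also have "\<dots> = ennreal (2 * (C * norm2_on P (increments u))) + ennreal (2 * (norm2_on P (increments u) / l))"
      using C l by (simp only: ennreal_mult ennreal_numeral zero_le_numeral mult_nonneg_nonneg divide_nonneg_nonneg norm2_on_nonneg less_imp_le)
    also have "\<dots> = ennreal (2 * (C * norm2_on P (increments u)) + 2 * (norm2_on P (increments u) / l))"
      using C l by (intro ennreal_plus[symmetric]) auto
    also have "2 * (C * norm2_on P (increments u)) + 2 * (norm2_on P (increments u) / l) = (2 * C + 2 / l) * norm2_on P (increments u)"
      by (simp add: algebra_simps)
    finally show ?thesis .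
  qed
  moreover have "2 * C + 2 / l > 0" using C l by (simp add: add_pos_pos)
  ultimately show ?thesis using that by blast
qed

text \<open>
  The Dirichlet principle: the increments of a sequence \<open>\<phi>\<close> of test functions that minimizes the energy
  of \<open>f + \<phi> k\<close> are Cauchy, so by \<open>Poincare\<close> the sequence converges in \<open>L\<^sup>2\<close> to a function \<open>v\<close>
  that vanishes off \<open>\<Omega>\<close>. The supports stay bounded, so the Fourier integrals converge pointwise, and the Fatou
  lemma with \<open>Hs_le_energy\<close> lifts the convergence to the Sobolev norm. The increments then converge too, and the
  asymptotic orthogonality of \<open>projection_sequence\<close> becomes the weak equation, first for test functions and by density
  on \<open>sobolev_tilde s \<Omega>\<close>.
\<close>

theorem weak_form_solvable:
  assumes \<Omega>: "open \<Omega>" "bounded \<Omega>" and f: "f \<in> Hs_L1 s"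
  shows "\<exists>v\<in>sobolev_tilde s \<Omega>. \<forall>\<psi>\<in>sobolev_tilde s \<Omega>. form (\<lambda>x. f x + v x) \<psi> = 0"
proof -
  have \<Omega>b: "\<Omega> \<in> sets borel" using \<Omega> by simp
  let ?T = "test_functions \<Omega>"
  have TH: "\<phi> \<in> Hs_L1 s" if "\<phi> \<in> ?T" for \<phi> by (rule test_functions_Hs_L1[OF s that])
  have Tz: "AE x in lborel. x \<notin> \<Omega> \<longrightarrow> \<phi> x = 0" if "\<phi> \<in> ?T" for \<phi>
    by (intro AE_I2 impI test_functions_vanish[OF that])
  have Gf: "increments f \<in> L2_on P" by (rule increments_L2(1)[OF f])
  have Vsub: "increments ` ?T \<subseteq> L2_on P" using TH increments_L2(1) by blast
  have V0: "(\<lambda>x. 0) \<in> increments ` ?T"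
    by (rule image_eqI[where x = "\<lambda>x. 0"]) (auto simp: increments_def test_functions_zero)
  have Vadd: "(\<lambda>x. g x + c * h x) \<in> increments ` ?T" if "g \<in> increments ` ?T" "h \<in> increments ` ?T" for g h c
    using that by (auto simp: increments_add_scale[symmetric] intro!: imageI test_functions_add_scale)
  obtain g where g: "\<forall>k. g k \<in> increments ` ?T" "L2_Cauchy P g"
      "\<forall>w\<in>increments ` ?T. (\<lambda>k. inner_on P (\<lambda>x. increments f x + g k x) w) \<longlonglongrightarrow> 0"
    using projection_sequence[OF Gf Vsub V0 Vadd] by blast
  have "\<forall>k. \<exists>\<phi>. \<phi> \<in> ?T \<and> g k = increments \<phi>" using g(1) by blast
  then obtain \<phi> where \<phi>: "\<And>k. \<phi> k \<in> ?T" and g_eq: "\<And>k. g k = increments (\<phi> k)" by metis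
  have gL: "increments (\<phi> k) \<in> L2_on P" for k by (rule increments_L2(1)[OF TH[OF \<phi>]])
  note \<phi>H = TH[OF \<phi>] and \<phi>D = Hs_L1D[OF TH[OF \<phi>]]
  obtain C where C: "C > 0" "\<And>u. u \<in> L2_on lborel \<Longrightarrow> (AE x in lborel. x \<notin> \<Omega> \<longrightarrow> u x = 0) \<Longrightarrow> increments u \<in> L2_on P \<Longrightarrow>
     norm2_on lborel u \<le> C * norm2_on P (increments u)"
    using Poincare[OF \<Omega>(2) \<Omega>b] by blast
  obtain D where D: "D > 0" "\<And>u. u \<in> L2_on lborel \<Longrightarrow> (AE x in lborel. x \<notin> \<Omega> \<longrightarrow> u x = 0) \<Longrightarrow> increments u \<in> L2_on P \<Longrightarrow>
     (\<integral>\<^sup>+\<xi>. ennreal ((norm (weighted_fourier s u \<xi>))\<^sup>2) \<partial>lborel) \<le> ennreal (D * norm2_on P (increments u))"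
    using Hs_le_energy[OF \<Omega>(2) \<Omega>b] by blast
  have dz: "AE x in lborel. x \<notin> \<Omega> \<longrightarrow> \<phi> k x - \<phi> j x = 0" for k j
    by (intro AE_I2) (simp add: test_functions_vanish[OF \<phi>])
  have dL: "(\<lambda>x. \<phi> k x - \<phi> j x) \<in> L2_on lborel" for k j by (intro L2_on_diff \<phi>D)
  have dG: "increments (\<lambda>x. \<phi> k x - \<phi> j x) \<in> L2_on P" for k j
    unfolding increments_diff by (intro L2_on_diff gL)
  have "L2_Cauchy lborel \<phi>"
    unfolding L2_Cauchy_def
  proof (intro allI impI)
    fix e :: real assume "e > 0"
    then have "e / C > 0" using C by simp
    then obtain N where N: "\<And>k j. k \<ge> N \<Longrightarrow> j \<ge> N \<Longrightarrow> norm2_on P (\<lambda>x. g k x - g j x) < e / C"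
      using g(2) unfolding L2_Cauchy_def by blast
    have "norm2_on lborel (\<lambda>x. \<phi> k x - \<phi> j x) < e" if "k \<ge> N" "j \<ge> N" for k j
    proof -
      have "norm2_on lborel (\<lambda>x. \<phi> k x - \<phi> j x) \<le> C * norm2_on P (\<lambda>x. g k x - g j x)"
        using C(2)[OF dL dz dG, of k j] by (simp add: g_eq increments_diff)
      also have "\<dots> < C * (e / C)" using N[OF that] C(1) by (intro mult_strict_left_mono)
      finally show ?thesis using C(1) by simp
    qed
    then show "\<exists>N. \<forall>k\<ge>N. \<forall>l\<ge>N. norm2_on lborel (\<lambda>x. \<phi> k x - \<phi> l x) < e" by blast
  qed
  then obtain v r where v: "v \<in> L2_on lborel" "(\<lambda>k. norm2_on lborel (\<lambda>x. \<phi> k x - v x)) \<longlonglongrightarrow> 0"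
    and r: "strict_mono (r :: nat \<Rightarrow> nat)" "AE x in lborel. (\<lambda>j. \<phi> (r j) x) \<longlonglongrightarrow> v x"
    using L2_complete[where f = \<phi>, OF \<phi>D(1)] by blast
  have vz: "AE x in lborel. x \<notin> \<Omega> \<longrightarrow> v x = 0"
    using r(2)
  proof eventually_elim
    case (elim x)
    then show ?case using test_functions_vanish[OF \<phi>] LIMSEQ_unique[OF _ tendsto_const] by auto
  qed
  have v1: "integrable lborel v" by (rule L2_on_bounded_integrable[OF v(1) \<Omega>b \<Omega>(2) vz])
  have [measurable]: "v \<in> borel_measurable borel" "\<And>k. \<phi> k \<in> borel_measurable borel" using v1 \<phi>D(2) by auto
  have Flim: "(\<lambda>j. fourier_integral (\<phi> j) \<xi>) \<longlonglongrightarrow> fourier_integral v \<xi>" for \<xi>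
  proof -
    let ?q = "(fconst TYPE('n))\<^sup>2 * measure lborel \<Omega>"
    have le: "(norm (fourier_integral (\<phi> j) \<xi> - fourier_integral v \<xi>))\<^sup>2 \<le> ?q * norm2_on lborel (\<lambda>x. \<phi> j x - v x)" for j
    proof -
      have "AE x in lborel. x \<notin> \<Omega> \<longrightarrow> \<phi> j x - v x = 0"
        using vz by eventually_elim (simp add: test_functions_vanish[OF \<phi>])
      from fourier_integral_sq_le[OF \<Omega>(2) \<Omega>b L2_on_diff[OF \<phi>D(1) v(1)] this, of \<xi>]
      show ?thesis by (simp add: fourier_integral_diff \<phi>D v1)
    qed
    have "(\<lambda>j. ?q * norm2_on lborel (\<lambda>x. \<phi> j x - v x)) \<longlonglongrightarrow> ?q * 0" by (intro tendsto_intros v)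
    then have z: "(\<lambda>j. ?q * norm2_on lborel (\<lambda>x. \<phi> j x - v x)) \<longlonglongrightarrow> 0" by simp
    have "(\<lambda>j. (norm (fourier_integral (\<phi> j) \<xi> - fourier_integral v \<xi>))\<^sup>2) \<longlonglongrightarrow> 0"
      by (rule tendsto_zero_squeeze[OF z _ le]) simp
    then have "(\<lambda>j. sqrt ((norm (fourier_integral (\<phi> j) \<xi> - fourier_integral v \<xi>))\<^sup>2)) \<longlonglongrightarrow> sqrt 0" by (rule tendsto_real_sqrt)
    then show ?thesis by (simp add: tendsto_norm_zero_iff LIM_zero_iff)
  qed
  have Hb: "(\<integral>\<^sup>+\<xi>. ennreal ((norm (weighted_fourier s (\<lambda>x. \<phi> k x - v x) \<xi>))\<^sup>2) \<partial>lborel) \<le> ennreal (D * e)"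
    if e: "\<forall>j\<ge>N. norm2_on P (\<lambda>x. g k x - g j x) \<le> e" for k N e
  proof -
    have lim: "(\<lambda>j. ennreal ((norm (weighted_fourier s (\<lambda>x. \<phi> k x - \<phi> j x) \<xi>))\<^sup>2)) \<longlonglongrightarrow> ennreal ((norm (weighted_fourier s (\<lambda>x. \<phi> k x - v x) \<xi>))\<^sup>2)" for \<xi>
      unfolding weighted_fourier_def fourier_integral_diff[OF \<phi>D(2) \<phi>D(2)] fourier_integral_diff[OF \<phi>D(2) v1]
      by (intro tendsto_ennrealI tendsto_intros Flim)
    have "(\<integral>\<^sup>+\<xi>. ennreal ((norm (weighted_fourier s (\<lambda>x. \<phi> k x - v x) \<xi>))\<^sup>2) \<partial>lborel) =
       (\<integral>\<^sup>+\<xi>. liminf (\<lambda>j. ennreal ((norm (weighted_fourier s (\<lambda>x. \<phi> k x - \<phi> j x) \<xi>))\<^sup>2)) \<partial>lborel)"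
      using lim_imp_Liminf[OF _ lim] by (intro nn_integral_cong) simp
    also have "\<dots> \<le> liminf (\<lambda>j. \<integral>\<^sup>+\<xi>. ennreal ((norm (weighted_fourier s (\<lambda>x. \<phi> k x - \<phi> j x) \<xi>))\<^sup>2) \<partial>lborel)"
      by (rule nn_integral_liminf) measurable
    also have "\<dots> \<le> limsup (\<lambda>j. \<integral>\<^sup>+\<xi>. ennreal ((norm (weighted_fourier s (\<lambda>x. \<phi> k x - \<phi> j x) \<xi>))\<^sup>2) \<partial>lborel)"
      by (rule Liminf_le_Limsup) simp
    also have "\<dots> \<le> ennreal (D * e)"
    proof (rule Limsup_bounded)
      show "\<forall>\<^sub>F j in sequentially. (\<integral>\<^sup>+\<xi>. ennreal ((norm (weighted_fourier s (\<lambda>x. \<phi> k x - \<phi> j x) \<xi>))\<^sup>2) \<partial>lborel) \<le> ennreal (D * e)"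
        using eventually_ge_at_top[of N]
      proof eventually_elim
        case (elim j)
        have "ennreal (D * norm2_on P (increments (\<lambda>x. \<phi> k x - \<phi> j x))) \<le> ennreal (D * e)"
          using e elim D(1) by (intro ennreal_leI mult_left_mono) (auto simp: increments_diff g_eq)
        with D(2)[OF dL dz dG, of k j] show ?case by (rule order_trans)
      qed
    qed
    finally show ?thesis .
  qed
  have dHs: "(\<lambda>x. \<phi> k x - v x) \<in> Hs_L1 s" if e: "\<forall>j\<ge>N. norm2_on P (\<lambda>x. g k x - g j x) \<le> e" for k N e
  proof -
    have "weighted_fourier s (\<lambda>x. \<phi> k x - v x) \<in> L2_on lborel"
      using Hb[OF e] by (auto simp: L2_on_iff_nn le_less_trans)
    then show ?thesis
      using L2_on_diff[OF \<phi>D(1) v(1)] Bochner_Integration.integrable_diff[OF \<phi>D(2) v1] by (simp add: Hs_L1_def)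
  qed
  have vH: "v \<in> Hs_L1 s"
  proof -
    obtain N where N: "\<And>k j. k \<ge> N \<Longrightarrow> j \<ge> N \<Longrightarrow> norm2_on P (\<lambda>x. g k x - g j x) < 1"
      using g(2) unfolding L2_Cauchy_def by (meson zero_less_one)
    have "(\<lambda>x. \<phi> N x - v x) \<in> Hs_L1 s" using N by (intro dHs[of N N 1]) (auto intro: less_imp_le)
    from Hs_L1_diff[OF \<phi>H[of N] this] show ?thesis by simp
  qed
  have wlim: "(\<lambda>k. norm2_on lborel (weighted_fourier s (\<lambda>x. v x - \<phi> k x))) \<longlonglongrightarrow> 0"
  proof (rule LIMSEQ_I)
    fix e :: real assume e: "e > 0"
    then have "e / (2 * D) > 0" using D by simp
    then obtain N where N: "\<And>k j. k \<ge> N \<Longrightarrow> j \<ge> N \<Longrightarrow> norm2_on P (\<lambda>x. g k x - g j x) < e / (2 * D)"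
      using g(2) unfolding L2_Cauchy_def by blast
    have "norm (norm2_on lborel (weighted_fourier s (\<lambda>x. v x - \<phi> k x)) - 0) < e" if k: "k \<ge> N" for k
    proof -
      have bd: "\<forall>j\<ge>N. norm2_on P (\<lambda>x. g k x - g j x) \<le> e / (2 * D)" using N[OF k] by (auto intro: less_imp_le)
      have "ennreal (norm2_on lborel (weighted_fourier s (\<lambda>x. \<phi> k x - v x))) \<le> ennreal (D * (e / (2 * D)))"
        using Hb[OF bd] unfolding nn_norm2_on[OF Hs_L1D(3)[OF dHs[OF bd]]] .
      then have "norm2_on lborel (weighted_fourier s (\<lambda>x. \<phi> k x - v x)) \<le> e / 2"
        using e D by (simp add: ennreal_le_iff)
      moreover have "norm2_on lborel (weighted_fourier s (\<lambda>x. v x - \<phi> k x)) = norm2_on lborel (weighted_fourier s (\<lambda>x. \<phi> k x - v x))"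
        by (simp only: weighted_fourier_diff \<phi>D v1 norm2_on_commute)
      ultimately show ?thesis using e by simp
    qed
    then show "\<exists>no. \<forall>n\<ge>no. norm (norm2_on lborel (weighted_fourier s (\<lambda>x. v x - \<phi> n x)) - 0) < e" by blast
  qed
  have vT: "v \<in> sobolev_tilde s \<Omega>" by (rule sobolev_tildeI[OF vH \<phi> \<phi>H wlim])
  have Glim: "(\<lambda>k. norm2_on P (\<lambda>z. increments w z - increments (\<psi> k) z)) \<longlonglongrightarrow> 0"
    if w: "w \<in> Hs_L1 s" "\<And>k. \<psi> k \<in> Hs_L1 s" and lim: "(\<lambda>k. norm2_on lborel (weighted_fourier s (\<lambda>x. w x - \<psi> k x))) \<longlonglongrightarrow> 0" for w \<psi>
  proof -
    have "(\<lambda>k. \<bar>L\<bar> * norm2_on lborel (weighted_fourier s (\<lambda>x. w x - \<psi> k x))) \<longlonglongrightarrow> \<bar>L\<bar> * 0" by (intro tendsto_intros lim)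
    then have z: "(\<lambda>k. \<bar>L\<bar> * norm2_on lborel (weighted_fourier s (\<lambda>x. w x - \<psi> k x))) \<longlonglongrightarrow> 0" by simp
    show ?thesis
      using increments_L2(2)[OF Hs_L1_diff[OF w(1) w(2)]]
      by (intro tendsto_zero_squeeze[OF z]) (auto simp: increments_diff)
  qed
  have Gv: "increments v \<in> L2_on P" by (rule increments_L2(1)[OF vH])
  let ?u = "\<lambda>x. f x + v x"
  have u_eq: "increments ?u = (\<lambda>z. increments f z + increments v z)" using increments_add_scale[of f 1 v] by simp
  have Gu: "increments ?u \<in> L2_on P" unfolding u_eq by (rule L2_on_add[OF Gf Gv])
  have testz: "inner_on P (increments ?u) (increments \<psi>) = 0" if \<psi>: "\<psi> \<in> ?T" for \<psi>
  proof -
    have G\<psi>: "increments \<psi> \<in> L2_on P" using Vsub \<psi> by blast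
    have "(\<lambda>k. cnj (inner_on P (increments \<psi>) (increments (\<phi> k)))) \<longlonglongrightarrow> cnj (inner_on P (increments \<psi>) (increments v))"
      by (intro tendsto_cnj inner_on_tendsto_right[OF G\<psi> gL Gv] Glim[OF vH \<phi>H wlim])
    then have "(\<lambda>k. inner_on P (increments (\<phi> k)) (increments \<psi>)) \<longlonglongrightarrow> inner_on P (increments v) (increments \<psi>)"
      unfolding inner_on_commute[symmetric] .
    then have "(\<lambda>k. inner_on P (increments f) (increments \<psi>) + inner_on P (increments (\<phi> k)) (increments \<psi>)) \<longlonglongrightarrow> inner_on P (increments f) (increments \<psi>) + inner_on P (increments v) (increments \<psi>)"
      by (intro tendsto_intros)
    then have "(\<lambda>k. inner_on P (\<lambda>x. increments f x + g k x) (increments \<psi>)) \<longlonglongrightarrow> inner_on P (increments ?u) (increments \<psi>)"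
      unfolding u_eq g_eq by (simp only: inner_on_add_left[OF Gf Gv G\<psi>] inner_on_add_left[OF Gf gL G\<psi>])
    moreover have "(\<lambda>k. inner_on P (\<lambda>x. increments f x + g k x) (increments \<psi>)) \<longlonglongrightarrow> 0" using g(3) \<psi> by blast
    ultimately show ?thesis by (rule LIMSEQ_unique)
  qed
  have "form ?u \<psi> = 0" if \<psi>: "\<psi> \<in> sobolev_tilde s \<Omega>" for \<psi>
  proof -
    have \<psi>H: "\<psi> \<in> Hs_L1 s" by (rule sobolev_tildeD(1)[OF s \<Omega> \<psi>])
    obtain p where p: "\<And>k. p k \<in> ?T" "(\<lambda>k. norm2_on lborel (weighted_fourier s (\<lambda>x. \<psi> x - p k x))) \<longlonglongrightarrow> 0"
      using sobolev_tildeD(3)[OF s \<Omega> \<psi>] by blast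
    have "(\<lambda>k. inner_on P (increments ?u) (increments (p k))) \<longlonglongrightarrow> inner_on P (increments ?u) (increments \<psi>)"
      by (intro inner_on_tendsto_right Gu increments_L2(1) TH p \<psi>H Glim)
    then have "inner_on P (increments ?u) (increments \<psi>) = 0"
      unfolding testz[OF p(1)] using LIMSEQ_unique[OF _ tendsto_const] by blast
    then show ?thesis by (simp add: form_eq)
  qed
  then show ?thesis using vT by blast
qed

end

section \<open>Analyticity of the kernel and of its potentials\<close>

text \<open>
  In this part \<open>$\<close> is the component of a vector, not the coefficient of a formal power series.
\<close>

no_notation fps_nth (infixl "$" 75)

definition complex_vec :: "real ^ 'n \<Rightarrow> complex ^ 'n" where
  "complex_vec x = (\<chi> i. complex_of_real (x $ i))"

text \<open>
  The holomorphic continuation of the squared Euclidean norm, not the Hermitian one.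
\<close>

definition complex_sq :: "complex ^ 'n \<Rightarrow> complex" where
  "complex_sq \<zeta> = (\<Sum>i\<in>UNIV. (\<zeta> $ i)\<^sup>2)"

lemma complex_sq_real: "complex_sq (complex_vec x) = complex_of_real ((norm x)\<^sup>2)"
proof -
  have "(norm x)\<^sup>2 = x \<bullet> x" by (rule power2_norm_eq_inner)
  also have "\<dots> = (\<Sum>i\<in>UNIV. (x $ i)\<^sup>2)" by (simp add: inner_vec_def power2_eq_square)
  finally show ?thesis by (simp add: complex_sq_def complex_vec_def)
qed

lemma norm_scaled_complex_vec: "norm (\<chi> i. t * complex_of_real (v $ i)) = norm t * norm v"
  unfolding norm_vec_def by (simp add: norm_mult L2_set_right_distrib)

text \<open>
  Thus powers of the norm continue holomorphically to the complex vectors for which \<open>complex_sq\<close> avoids the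
  cut of the logarithm.
\<close>

lemma exp_Ln_norm:
  fixes x :: "real ^ 'n" assumes "x \<noteq> 0"
  shows "exp (- complex_of_real c * Ln (complex_sq (complex_vec x)) / 2) = complex_of_real (norm x powr (- c))"
proof -
  have "Ln (complex_of_real ((norm x)\<^sup>2)) = complex_of_real (ln ((norm x)\<^sup>2))" using assms by (intro Ln_of_real) auto
  also have "ln ((norm x)\<^sup>2) = 2 * ln (norm x)" using assms by (simp add: ln_realpow)
  finally have "exp (- complex_of_real c * Ln (complex_sq (complex_vec x)) / 2) = exp (complex_of_real (- c * ln (norm x)))"
    by (simp add: complex_sq_real)
  then show ?thesis using assms by (simp only: exp_of_real powr_def) simp
qed

text \<open>
  Near \<open>p \<noteq> 0\<close> the kernel continues to complex vectors: the direction \<open>x /\<^sub>R norm x\<close> and the power of the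
  norm by \<open>exp_Ln_norm\<close>, and \<open>a\<close> by its power series \<open>Gc\<close> at the direction \<open>\<theta>\<close> of \<open>p\<close>.
  Along the complex line through \<open>z\<close> and \<open>y\<close> the continuation is a bounded holomorphic function of the parameter
  \<open>t\<close> in the disc of radius \<open>2\<close>, and the Cauchy inequality on the circle of radius \<open>3/2\<close> gives coefficients of order
  \<open>(2/3)\<^sup>k\<close>. The bound holds with the same \<open>r\<close> and \<open>M\<close> for all segments near \<open>p\<close>.
\<close>

lemma kernel_segment_power_series:
  fixes a :: "real ^ 'n \<Rightarrow> real" and p :: "real ^ 'n"
  assumes a: "real_analytic_on_sphere a" and p: "p \<noteq> 0"
  obtains r M where "r > 0" "\<And>z y. z \<in> ball p r \<Longrightarrow> y \<in> ball p r \<Longrightarrow> \<exists>b. (\<forall>k. norm (b k) \<le> M * (2/3) ^ k) \<and>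
     (\<forall>t. \<bar>t\<bar> \<le> 1 \<longrightarrow> (\<lambda>k. b k * complex_of_real t ^ k) sums complex_of_real (kernel s a (z + t *\<^sub>R (y - z))))"
proof -
  define \<theta> where "\<theta> = p /\<^sub>R norm p"
  have "\<theta> \<in> sphere 0 1" using p by (simp add: \<theta>_def)
  then obtain V F where V: "open V" "\<theta> \<in> V" "\<forall>x\<in>V. real_analytic_at F x" "\<forall>x\<in>V \<inter> sphere 0 1. F x = a x"
    using a unfolding real_analytic_on_sphere_def by blast
  then obtain r0 c where r0: "r0 > 0" "\<And>x. x \<in> ball \<theta> r0 \<Longrightarrow>
     ((\<lambda>\<alpha>. c \<alpha> * (\<Prod>i\<in>UNIV. ((x - \<theta>) $ i) ^ \<alpha> i)) has_sum F x) UNIV"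
    unfolding real_analytic_at_def by blast
  obtain rV where rV: "rV > 0" "ball \<theta> rV \<subseteq> V" using V(1,2) open_contains_ball by blast
  (* A cube of this half side lies in the ball of convergence and in V. *)
  define R where "R = min r0 rV / (2 * real CARD('n))"
  have R: "R > 0" using r0 rV by (simp add: R_def)
  have small: "norm w < min r0 rV" if "\<And>i. \<bar>w $ i\<bar> \<le> R" for w :: "real^'n"
  proof -
    have "norm w \<le> (\<Sum>i\<in>UNIV. \<bar>w $ i\<bar>)" by (rule norm_le_l1_cart)
    also have "\<dots> \<le> (\<Sum>i\<in>(UNIV :: 'n set). R)" by (intro sum_mono that)
    also have "\<dots> = min r0 rV / 2" by (simp add: R_def)
    also have "\<dots> < min r0 rV" using r0(1) rV(1) by (simp only: min_def split: if_splits) simp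
    finally show ?thesis .
  qed
  let ?m = "\<lambda>\<alpha>. \<bar>c \<alpha>\<bar> * (\<Prod>i\<in>(UNIV :: 'n set). R ^ \<alpha> i)"
  (* Convergence at the corner of the cube bounds the series on the whole complex polydisc of radius R. *)
  have msum: "?m summable_on UNIV"
  proof -
    let ?w = "(\<chi> i. R) :: real^'n"
    have "\<theta> + ?w \<in> ball \<theta> r0" using small[of ?w] R by (simp add: dist_norm)
    from r0(2)[OF this] have "(\<lambda>\<alpha>. c \<alpha> * (\<Prod>i\<in>(UNIV :: 'n set). R ^ \<alpha> i)) summable_on UNIV"
      by (auto simp: summable_on_def)
    then have "(\<lambda>\<alpha>. norm (c \<alpha> * (\<Prod>i\<in>(UNIV :: 'n set). R ^ \<alpha> i))) summable_on UNIV"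
      by (subst (asm) summable_on_iff_abs_summable_on_real)
    then show ?thesis using R by (simp add: abs_mult abs_prod power_abs)
  qed
  define f where "f = (\<lambda>\<alpha> (w :: complex^'n). complex_of_real (c \<alpha>) * (\<Prod>i\<in>UNIV. (w $ i) ^ \<alpha> i))"
  have fle: "norm (f \<alpha> w) \<le> ?m \<alpha>" if "\<And>i. norm (w $ i) \<le> R" for \<alpha> w
    unfolding f_def norm_mult prod_norm[symmetric] norm_power
    using that by (auto intro!: mult_left_mono prod_mono power_mono)
  define Gc where "Gc = (\<lambda>w. \<Sum>\<^sub>\<infinity>\<alpha>. f \<alpha> w)"
  define M0 where "M0 = (\<Sum>\<^sub>\<infinity>\<alpha>. ?m \<alpha>)"
  have fabs: "(\<lambda>\<alpha>. norm (f \<alpha> w)) summable_on UNIV" if "\<And>i. norm (w $ i) \<le> R" for w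
    by (rule summable_on_comparison_test[OF msum]) (use fle[OF that] in auto)
  have Gcle: "norm (Gc w) \<le> M0" if "\<And>i. norm (w $ i) \<le> R" for w
  proof -
    have "norm (Gc w) \<le> (\<Sum>\<^sub>\<infinity>\<alpha>. norm (f \<alpha> w))" unfolding Gc_def by (rule norm_infsum_bound[OF fabs[OF that]])
    also have "\<dots> \<le> M0" unfolding M0_def by (intro infsum_mono fabs[OF that] msum fle that)
    finally show ?thesis .
  qed
  have Gcreal: "Gc (complex_vec w) = complex_of_real (F (\<theta> + w))" if "\<And>i. \<bar>w $ i\<bar> \<le> R" for w :: "real^'n"
  proof -
    have "\<theta> + w \<in> ball \<theta> r0" using small[OF that] by (simp add: dist_norm)
    from r0(2)[OF this] have "((\<lambda>\<alpha>. complex_of_real (c \<alpha> * (\<Prod>i\<in>UNIV. ((\<theta> + w - \<theta>) $ i) ^ \<alpha> i))) has_sum complex_of_real (F (\<theta> + w))) UNIV"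
      by (rule has_sum_of_real)
    then have "((\<lambda>\<alpha>. f \<alpha> (complex_vec w)) has_sum complex_of_real (F (\<theta> + w))) UNIV"
      by (simp add: f_def complex_vec_def)
    then show ?thesis unfolding Gc_def by (rule infsumI)
  qed
  define q where "q = real CARD('n) + 2 * s"
  define iv where "iv = (\<lambda>\<zeta> :: complex^'n. exp (- complex_of_real 1 * Ln (complex_sq \<zeta>) / 2))"
  define pw where "pw = (\<lambda>\<zeta> :: complex^'n. exp (- complex_of_real q * Ln (complex_sq \<zeta>) / 2))"
  let ?p = "complex_vec p"
  have sq0: "complex_sq ?p \<notin> \<real>\<^sub>\<le>\<^sub>0" using p unfolding complex_sq_real nonpos_Reals_of_real_iff by simp
  have id0: "((\<lambda>\<zeta>. \<zeta>) \<longlongrightarrow> ?p) (nhds ?p)" by (rule filterlim_ident)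
  have sqlim: "(complex_sq \<longlongrightarrow> complex_sq ?p) (nhds ?p)"
    unfolding complex_sq_def[abs_def] by (intro tendsto_intros id0)
  have ivlim: "(iv \<longlongrightarrow> iv ?p) (nhds ?p)" and pwlim: "(pw \<longlongrightarrow> pw ?p) (nhds ?p)"
    unfolding iv_def pw_def
    by (intro tendsto_intros isCont_tendsto_compose[OF continuous_at_Ln[OF sq0] sqlim]; simp)+
  have ivp: "iv ?p = complex_of_real (1 / norm p)"
    unfolding iv_def exp_Ln_norm[OF p] by (simp add: powr_minus_divide)
  have wlim: "((\<lambda>\<zeta>. \<zeta> $ i * iv \<zeta> - complex_of_real (\<theta> $ i)) \<longlongrightarrow> 0) (nhds ?p)" for i
  proof -
    have "((\<lambda>\<zeta>. \<zeta> $ i * iv \<zeta> - complex_of_real (\<theta> $ i)) \<longlongrightarrow> ?p $ i * iv ?p - complex_of_real (\<theta> $ i)) (nhds ?p)"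
      by (intro tendsto_intros id0 ivlim)
    moreover have "?p $ i * iv ?p - complex_of_real (\<theta> $ i) = 0"
      unfolding ivp by (simp add: complex_vec_def \<theta>_def divide_inverse mult.commute)
    ultimately show ?thesis by simp
  qed
  (* Three conditions that hold at p and are open: off the cut, bounded power of the norm,
     direction inside the polydisc. *)
  define Bd where "Bd = norm (pw ?p) + 1"
  have "\<forall>\<^sub>F \<zeta> in nhds ?p. 0 < Re (complex_sq \<zeta>)"
    using tendsto_Re[OF sqlim] p by (intro order_tendstoD(1)[where y = "Re (complex_sq ?p)"]) (auto simp: complex_sq_real)
  moreover have "\<forall>\<^sub>F \<zeta> in nhds ?p. norm (pw \<zeta>) < Bd"
    using tendsto_norm[OF pwlim] by (intro order_tendstoD(2)[where y = "norm (pw ?p)"]) (auto simp: Bd_def)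
  moreover have "\<forall>\<^sub>F \<zeta> in nhds ?p. \<forall>i. norm (\<zeta> $ i * iv \<zeta> - complex_of_real (\<theta> $ i)) < R"
    using tendsto_norm_zero[OF wlim] R by (intro eventually_all_finite order_tendstoD(2)[where y = 0]) auto
  ultimately have "\<forall>\<^sub>F \<zeta> in nhds ?p. 0 < Re (complex_sq \<zeta>) \<and> norm (pw \<zeta>) < Bd \<and> (\<forall>i. norm (\<zeta> $ i * iv \<zeta> - complex_of_real (\<theta> $ i)) < R)"
    by (intro eventually_conj)
  then obtain d where d: "d > 0" "\<And>\<zeta>. dist \<zeta> ?p < d \<Longrightarrow> 0 < Re (complex_sq \<zeta>) \<and> norm (pw \<zeta>) < Bd \<and> (\<forall>i. norm (\<zeta> $ i * iv \<zeta> - complex_of_real (\<theta> $ i)) < R)"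
    unfolding eventually_nhds_metric by blast
  have Bd0: "Bd > 0" by (simp add: Bd_def add_nonneg_pos)
  have main: "\<exists>b. (\<forall>k. norm (b k) \<le> (M0 * Bd) * (2/3) ^ k) \<and>
     (\<forall>t. \<bar>t\<bar> \<le> 1 \<longrightarrow> (\<lambda>k. b k * complex_of_real t ^ k) sums complex_of_real (kernel s a (z + t *\<^sub>R (y - z))))"
    (* The complex segment with norm t <= 2 stays within norm (z - p) + 2 * norm (y - z) < 5 * (d / 5) of p. *)
    if z: "z \<in> ball p (d / 5)" and y: "y \<in> ball p (d / 5)" for z y
  proof -
    define seg where "seg = (\<lambda>t. complex_vec z + (\<chi> i. t * complex_of_real ((y - z) $ i)))"
    have seg_real: "seg (complex_of_real t) = complex_vec (z + t *\<^sub>R (y - z))" for t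
      by (simp add: seg_def complex_vec_def vec_eq_iff)
    have segd: "dist (seg t) ?p < d" if t: "norm t \<le> 2" for t
    proof -
      have nt: "norm (\<chi> i. t * complex_of_real ((y - z) $ i)) = norm t * norm (y - z)"
        by (rule norm_scaled_complex_vec)
      have nz: "norm (complex_vec z - ?p) = norm (z - p)"
        using norm_scaled_complex_vec[of 1 "z - p"] by (simp add: complex_vec_def vec_eq_iff minus_vec_def)
      have "dist (seg t) ?p = norm ((complex_vec z - ?p) + (\<chi> i. t * complex_of_real ((y - z) $ i)))"
        by (simp add: dist_norm seg_def algebra_simps)
      also have "\<dots> \<le> norm (z - p) + norm t * norm (y - z)"
        using norm_triangle_ineq[of "complex_vec z - ?p" "\<chi> i. t * complex_of_real ((y - z) $ i)"] by (simp only: nt nz)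
      also have "\<dots> \<le> norm (z - p) + 2 * norm (y - z)" using t by (intro add_left_mono mult_right_mono) auto
      also have "\<dots> < d"
        using z y norm_triangle_ineq4[of "y - p" "z - p"] by (simp add: dist_norm norm_minus_commute)
      finally show ?thesis .
    qed
    have comp_hol: "(\<lambda>t. seg t $ i) holomorphic_on A" for i A
      unfolding seg_def by (simp, intro holomorphic_intros)
    have sq_hol: "(\<lambda>t. complex_sq (seg t)) holomorphic_on A" for A
      unfolding complex_sq_def by (intro holomorphic_intros comp_hol)
    have Ln_hol: "(\<lambda>t. Ln (complex_sq (seg t))) holomorphic_on cball 0 2"
    proof (rule holomorphic_on_Ln'[OF _ sq_hol])
      show "complex_sq (seg t) \<notin> \<real>\<^sub>\<le>\<^sub>0" if "t \<in> cball 0 2" for t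
        using d(2)[OF segd, of t] that by (auto simp: complex_nonpos_Reals_iff)
    qed
    have iv_hol: "(\<lambda>t. iv (seg t)) holomorphic_on cball 0 2" and pw_hol: "(\<lambda>t. pw (seg t)) holomorphic_on cball 0 2"
      unfolding iv_def pw_def by (intro holomorphic_intros Ln_hol; simp)+
    define w where "w = (\<lambda>t. (\<chi> i. seg t $ i * iv (seg t) - complex_of_real (\<theta> $ i)) :: complex^'n)"
    have wle: "norm (w t $ i) \<le> R" if "norm t \<le> 2" for t i
      using d(2)[OF segd[OF that]] by (auto simp: w_def intro: less_imp_le)
    have w_hol: "(\<lambda>t. w t $ i) holomorphic_on cball 0 2" for i
      unfolding w_def by (simp, intro holomorphic_intros comp_hol iv_hol)
    have f_hol: "(\<lambda>t. \<Sum>\<alpha>\<in>X. f \<alpha> (w t)) holomorphic_on cball 0 2" for X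
      unfolding f_def by (intro holomorphic_intros w_hol)
    have ul: "uniform_limit (cball 0 2) (\<lambda>X t. \<Sum>\<alpha>\<in>X. f \<alpha> (w t)) (\<lambda>t. Gc (w t)) (finite_subsets_at_top UNIV)"
      unfolding Gc_def by (rule Weierstrass_m_test_general[where M = ?m]) (use fle[OF wle] msum in auto)
    have "continuous_on (cball 0 2) (\<lambda>t. Gc (w t)) \<and> (\<lambda>t. Gc (w t)) holomorphic_on ball 0 2"
    proof (rule holomorphic_uniform_limit[OF _ ul])
      show "\<forall>\<^sub>F X in finite_subsets_at_top UNIV. continuous_on (cball 0 2) (\<lambda>t. \<Sum>\<alpha>\<in>X. f \<alpha> (w t)) \<and> (\<lambda>t. \<Sum>\<alpha>\<in>X. f \<alpha> (w t)) holomorphic_on ball 0 2"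
        using f_hol holomorphic_on_imp_continuous_on holomorphic_on_subset[OF f_hol ball_subset_cball] by (intro always_eventually) blast
    qed auto
    then have Gc_hol: "(\<lambda>t. Gc (w t)) holomorphic_on ball 0 2" by blast
    define H where "H = (\<lambda>t. Gc (w t) * pw (seg t))"
    have H_hol: "H holomorphic_on ball 0 2"
      unfolding H_def by (intro holomorphic_intros Gc_hol holomorphic_on_subset[OF pw_hol]) auto
    have Hle: "norm (H t) \<le> M0 * Bd" if "norm t \<le> 2" for t
    proof -
      have "norm (pw (seg t)) \<le> Bd" using d(2)[OF segd[OF that]] by auto
      then show ?thesis unfolding H_def norm_mult using Gcle[OF wle[OF that]]
        by (intro mult_mono) (auto intro: order_trans[OF norm_ge_zero])
    qed
    have Hreal: "H (complex_of_real t) = complex_of_real (kernel s a (z + t *\<^sub>R (y - z)))" if t: "\<bar>t\<bar> \<le> 1" for t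
    proof -
      let ?x = "z + t *\<^sub>R (y - z)"
      have nt: "norm (complex_of_real t) \<le> 2" using t by simp
      have "Re (complex_sq (complex_vec ?x)) > 0" using d(2)[OF segd[OF nt]] unfolding seg_real by blast
      then have x0: "?x \<noteq> 0" by (auto simp: complex_sq_real)
      have ivx: "iv (complex_vec ?x) = complex_of_real (1 / norm ?x)"
        unfolding iv_def exp_Ln_norm[OF x0] by (simp add: powr_minus_divide)
      have weq: "w (complex_of_real t) = complex_vec (?x /\<^sub>R norm ?x - \<theta>)"
        unfolding w_def seg_real ivx by (simp add: complex_vec_def vec_eq_iff divide_inverse mult.commute)
      have wR: "\<bar>(?x /\<^sub>R norm ?x - \<theta>) $ i\<bar> \<le> R" for i
        using wle[OF nt, of i] unfolding weq by (simp add: complex_vec_def flip: of_real_diff of_real_mult)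
      have "Gc (w (complex_of_real t)) = complex_of_real (F (?x /\<^sub>R norm ?x))"
        unfolding weq by (subst Gcreal[OF wR]) simp
      moreover have "F (?x /\<^sub>R norm ?x) = a (?x /\<^sub>R norm ?x)"
      proof -
        have "?x /\<^sub>R norm ?x \<in> ball \<theta> rV" using small[OF wR] by (simp add: dist_norm norm_minus_commute)
        moreover have "?x /\<^sub>R norm ?x \<in> sphere 0 1" using x0 by simp
        ultimately show ?thesis using V(4) rV(2) by blast
      qed
      moreover have "pw (seg (complex_of_real t)) = complex_of_real (norm ?x powr (- q))"
        unfolding seg_real pw_def by (rule exp_Ln_norm[OF x0])
      ultimately show ?thesis by (simp add: H_def kernel_def q_def)
    qed
    let ?b = "\<lambda>k. (deriv ^^ k) H 0 / fact k"
    have "norm (?b k) \<le> (M0 * Bd) * (2/3) ^ k" for k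
    proof -
      have "norm ((deriv ^^ k) H 0) \<le> fact k * (M0 * Bd) / (3/2) ^ k"
      proof (rule Cauchy_inequality)
        show "H holomorphic_on ball 0 (3/2)" by (rule holomorphic_on_subset[OF H_hol]) auto
        show "continuous_on (cball 0 (3/2)) H"
          by (rule continuous_on_subset[OF holomorphic_on_imp_continuous_on[OF H_hol]]) auto
      qed (use Hle in auto)
      then have "norm ((deriv ^^ k) H 0) / fact k \<le> (M0 * Bd) / (3/2) ^ k" by (simp add: field_simps)
      then show ?thesis by (simp add: norm_divide power_divide)
    qed
    moreover have "(\<lambda>k. ?b k * complex_of_real t ^ k) sums complex_of_real (kernel s a (z + t *\<^sub>R (y - z)))" if t: "\<bar>t\<bar> \<le> 1" for t
      using holomorphic_power_series[OF H_hol, of "complex_of_real t"] t Hreal[OF t] by simp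
    ultimately show ?thesis by (intro exI[of _ ?b] conjI allI impI)
  qed
  show ?thesis by (rule that[of "d / 5", OF _ main]) (use d(1) in simp)
qed

lemma power_series_near_0:
  fixes b :: "nat \<Rightarrow> complex" and t :: real
  assumes b: "\<And>k. norm (b k) \<le> M * (2/3) ^ k" and t: "0 \<le> t" "t \<le> 1"
    and h: "(\<lambda>k. b k * complex_of_real t ^ k) sums h"
  shows "norm (h - b 0) \<le> 3 * M * t"
proof -
  have M: "M \<ge> 0" using order_trans[OF norm_ge_zero b[of 0]] by simp
  have "(\<lambda>k. b (Suc k) * complex_of_real t ^ Suc k) sums (h - b 0)"
    using h by (subst sums_Suc_iff) simp
  moreover have "(\<lambda>k. M * t * (2/3) ^ k) sums (M * t * (1 / (1 - 2/3)))"
    by (intro sums_mult geometric_sums) simp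
  moreover have "norm (b (Suc k) * complex_of_real t ^ Suc k) \<le> M * t * (2/3) ^ k" for k
  proof -
    have "norm (b (Suc k) * complex_of_real t ^ Suc k) = norm (b (Suc k)) * (t * t ^ k)" using t by (simp add: norm_mult norm_power)
    also have "\<dots> \<le> (M * (2/3) ^ k) * (t * 1)"
    proof (rule mult_mono)
      have "M * (2/3) ^ Suc k \<le> M * (2/3) ^ k" using M by (intro mult_left_mono) auto
      then show "norm (b (Suc k)) \<le> M * (2/3) ^ k" using b[of "Suc k"] by linarith
      show "t * t ^ k \<le> t * 1" using t by (intro mult_left_mono power_le_one) auto
    qed (use t M in auto)
    finally show ?thesis by (simp add: mult_ac)
  qed
  ultimately have "norm (h - b 0) \<le> M * t * (1 / (1 - 2/3))" by (rule norm_sums_le)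
  then show ?thesis by simp
qed

text \<open>
  Analyticity along segments, with a neighbourhood of \<open>y0\<close> that serves all of them. One complex variable
  suffices for it, and the closed range of \<open>t\<close> includes the end point \<open>y\<close>, so that the germ at \<open>z\<close>
  determines the value at \<open>y\<close>.
\<close>

definition line_analytic_at :: "(real ^ 'n \<Rightarrow> complex) \<Rightarrow> real ^ 'n \<Rightarrow> bool" where
  "line_analytic_at F y0 \<longleftrightarrow> (\<exists>r>0. \<forall>z\<in>ball y0 r. \<forall>y\<in>ball y0 r. \<exists>b :: nat \<Rightarrow> complex.
     \<forall>t. \<bar>t\<bar> \<le> 1 \<longrightarrow> (\<lambda>k. b k * complex_of_real t ^ k) sums F (z + t *\<^sub>R (y - z)))"

lemma line_analytic_at_diff:
  assumes "line_analytic_at F y0" "line_analytic_at G y0"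
  shows "line_analytic_at (\<lambda>x. F x - G x) y0"
proof -
  obtain r1 where r1: "r1 > 0" "\<forall>z\<in>ball y0 r1. \<forall>y\<in>ball y0 r1. \<exists>b :: nat \<Rightarrow> complex.
     \<forall>t. \<bar>t\<bar> \<le> 1 \<longrightarrow> (\<lambda>k. b k * complex_of_real t ^ k) sums F (z + t *\<^sub>R (y - z))" using assms(1) by (auto simp: line_analytic_at_def)
  obtain r2 where r2: "r2 > 0" "\<forall>z\<in>ball y0 r2. \<forall>y\<in>ball y0 r2. \<exists>b :: nat \<Rightarrow> complex.
     \<forall>t. \<bar>t\<bar> \<le> 1 \<longrightarrow> (\<lambda>k. b k * complex_of_real t ^ k) sums G (z + t *\<^sub>R (y - z))" using assms(2) by (auto simp: line_analytic_at_def)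
  show ?thesis unfolding line_analytic_at_def
  proof (intro exI[of _ "min r1 r2"] conjI ballI)
    fix z y assume "z \<in> ball y0 (min r1 r2)" "y \<in> ball y0 (min r1 r2)"
    then have "z \<in> ball y0 r1" "y \<in> ball y0 r1" "z \<in> ball y0 r2" "y \<in> ball y0 r2" by auto
    then obtain b b' where b: "\<forall>t. \<bar>t\<bar> \<le> 1 \<longrightarrow> (\<lambda>k. b k * complex_of_real t ^ k) sums F (z + t *\<^sub>R (y - z))"
      "\<forall>t. \<bar>t\<bar> \<le> 1 \<longrightarrow> (\<lambda>k. b' k * complex_of_real t ^ k) sums G (z + t *\<^sub>R (y - z))"
      using r1(2) r2(2) by metis
    have "(\<lambda>k. (b k - b' k) * complex_of_real t ^ k) sums (F (z + t *\<^sub>R (y - z)) - G (z + t *\<^sub>R (y - z)))" if "\<bar>t\<bar> \<le> 1" for t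
      using sums_diff[of "\<lambda>k. b k * complex_of_real t ^ k" _ "\<lambda>k. b' k * complex_of_real t ^ k"] b that by (simp add: left_diff_distrib)
    then show "\<exists>b. \<forall>t. \<bar>t\<bar> \<le> 1 \<longrightarrow> (\<lambda>k. b k * complex_of_real t ^ k) sums (F (z + t *\<^sub>R (y - z)) - G (z + t *\<^sub>R (y - z)))"
      by (intro exI[of _ "\<lambda>k. b k - b' k"]) blast
  qed (use r1 r2 in auto)
qed

lemma power_series_zero_near_0:
  fixes b :: "nat \<Rightarrow> complex"
  assumes d: "d > 0" and s1: "summable b"
    and z: "\<And>t. 0 \<le> t \<Longrightarrow> t < d \<Longrightarrow> t \<le> 1 \<Longrightarrow> (\<lambda>k. b k * complex_of_real t ^ k) sums 0"
  shows "b = (\<lambda>k. 0)"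
proof (rule ccontr)
  assume "b \<noteq> (\<lambda>k. 0)"
  then obtain m where m: "b m \<noteq> 0" by auto
  have "b 0 = 0"
  proof -
    have "(\<lambda>k. b k * complex_of_real 0 ^ k) sums 0" using d by (intro z) auto
    then show ?thesis using sums_unique2[OF powser_sums_zero, of b 0] by simp
  qed
  then have m0: "m > 0" using m by (cases m) auto
  define f where "f = (\<lambda>x. \<Sum>k. b k * x ^ k)"
  have sm: "(\<lambda>n. b n * (x - 0) ^ n) sums f x" if "norm (x - 0) < 1" for x
  proof -
    have "summable (\<lambda>n. b n * 1 ^ n)" using s1 by simp
    then have "summable (\<lambda>n. b n * x ^ n)" by (rule powser_inside) (use that in simp)
    then show ?thesis by (simp add: f_def summable_sums)
  qed
  have "f 0 = 0" using \<open>b 0 = 0\<close> by (simp add: f_def)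
  then obtain e where e: "e > 0" "\<And>x. x \<in> cball 0 e - {0} \<Longrightarrow> f x \<noteq> 0"
    using powser_0_nonzero[of 1 0 b f m] sm m m0 by auto
  define t where "t = min (min d e) 1 / 2"
  have t: "t > 0" "t < d" "t < e" "t < 1" using d e by (auto simp: t_def min_def)
  have "(\<lambda>k. b k * complex_of_real t ^ k) sums 0" using t by (intro z) auto
  then have "f (complex_of_real t) = 0" by (simp add: f_def sums_unique[symmetric])
  moreover have "complex_of_real t \<in> cball 0 e - {0}" using t by auto
  ultimately show False using e(2) by blast
qed

text \<open>
  The set of points near which \<open>F\<close> vanishes is closed in \<open>C\<close>: a limit point \<open>y0\<close> has such a point \<open>z\<close>
  in its neighbourhood of analyticity, and along the segment from \<open>z\<close> to any \<open>y\<close> of that neighbourhood the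
  power series vanishes for small \<open>t\<close>, hence identically.
\<close>

theorem line_analytic_identity:
  fixes F :: "real ^ 'n \<Rightarrow> complex"
  assumes C: "connected C" and an: "\<And>y. y \<in> C \<Longrightarrow> line_analytic_at F y"
    and W: "open W" "W \<noteq> {}" "W \<subseteq> C" and zero: "\<And>y. y \<in> W \<Longrightarrow> F y = 0"
    and y: "y \<in> C"
  shows "F y = 0"
proof -
  define Z where "Z = {y \<in> C. \<exists>e>0. \<forall>x\<in>ball y e. F x = 0}"
  have "W \<subseteq> Z"
  proof
    fix x assume x: "x \<in> W"
    then obtain e where "e > 0" "ball x e \<subseteq> W" using W(1) open_contains_ball by blast
    then show "x \<in> Z" using x W(3) zero unfolding Z_def by blast
  qed
  then have "Z \<noteq> {}" using W(2) by blast
  moreover have "openin (top_of_set C) Z"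
  proof -
    have "Z = C \<inter> interior {x. F x = 0}" unfolding Z_def by (auto simp: mem_interior subset_eq)
    then show ?thesis by (simp add: openin_open_Int)
  qed
  moreover have "closedin (top_of_set C) Z"
    unfolding closedin_limpt
  proof (intro conjI allI impI)
    show "Z \<subseteq> C" by (auto simp: Z_def)
    fix y0 assume y0: "y0 islimpt Z \<and> y0 \<in> C"
    then obtain r where r: "r > 0" "\<forall>z\<in>ball y0 r. \<forall>y\<in>ball y0 r. \<exists>b :: nat \<Rightarrow> complex.
        \<forall>t. \<bar>t\<bar> \<le> 1 \<longrightarrow> (\<lambda>k. b k * complex_of_real t ^ k) sums F (z + t *\<^sub>R (y - z))"
      using an[of y0] by (auto simp: line_analytic_at_def)
    obtain z where z: "z \<in> Z" "z \<in> ball y0 r" using y0 r(1) unfolding islimpt_approachable by (auto simp: dist_commute)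
    then obtain e where e: "e > 0" "\<And>x. x \<in> ball z e \<Longrightarrow> F x = 0" by (auto simp: Z_def)
    have "F y = 0" if y: "y \<in> ball y0 r" for y
    proof -
      obtain b :: "nat \<Rightarrow> complex" where b: "\<And>t. \<bar>t\<bar> \<le> 1 \<Longrightarrow> (\<lambda>k. b k * complex_of_real t ^ k) sums F (z + t *\<^sub>R (y - z))"
        using r(2) z(2) y by metis
      have "b = (\<lambda>k. 0)"
      proof (rule power_series_zero_near_0[of "e / (norm (y - z) + 1)"])
        show "e / (norm (y - z) + 1) > 0" using e(1) by (simp add: add_nonneg_pos)
        show "summable b" using b[of 1] by (auto simp: sums_iff)
        fix t :: real assume t: "0 \<le> t" "t < e / (norm (y - z) + 1)" "t \<le> 1"
        have "t * norm (y - z) \<le> t * (norm (y - z) + 1)" using t by (intro mult_left_mono) auto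
        also have "\<dots> < e" using t by (simp add: pos_less_divide_eq add_nonneg_pos)
        finally have "F (z + t *\<^sub>R (y - z)) = 0" using t(1) by (intro e(2)) (simp add: dist_norm)
        then show "(\<lambda>k. b k * complex_of_real t ^ k) sums 0" using b[of t] t by simp
      qed
      then show ?thesis using b[of 1] by (simp add: sums_iff)
    qed
    then show "y0 \<in> Z" using r(1) y0 unfolding Z_def by blast
  qed
  ultimately have "Z = C" using C unfolding connected_clopen by blast
  then have "y \<in> Z" using y by simp
  then show ?thesis by (auto simp: Z_def)
qed

text \<open>
  The segment from \<open>p\<close> in the direction of \<open>x\<close>, of length \<open>r / 2\<close>, reaches \<open>x\<close> at \<open>t = 2 \<tau> / r\<close>, so
  the uniform bound on the coefficients gives a Lipschitz estimate at \<open>p\<close>.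
\<close>

lemma kernel_continuous:
  fixes p :: "real ^ 'n"
  assumes a: "real_analytic_on_sphere a" and p: "p \<noteq> 0"
  shows "isCont (kernel s a) p"
proof -
  obtain r M where r: "r > 0" "\<And>z y. z \<in> ball p r \<Longrightarrow> y \<in> ball p r \<Longrightarrow> \<exists>b. (\<forall>k. norm (b k) \<le> M * (2/3) ^ k) \<and>
     (\<forall>t. \<bar>t\<bar> \<le> 1 \<longrightarrow> (\<lambda>k. b k * complex_of_real t ^ k) sums complex_of_real (kernel s a (z + t *\<^sub>R (y - z))))"
    using kernel_segment_power_series[OF a p, of s] by blast
  have bd: "norm (kernel s a x - kernel s a p) \<le> (3 * M * 2 / r) * norm (x - p)" if x: "norm (x - p) < r / 2" for x
  proof (cases "x = p")
    case False
    define \<tau> where "\<tau> = norm (x - p)"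
    have \<tau>: "\<tau> > 0" "\<tau> < r / 2" using False x by (auto simp: \<tau>_def)
    define y where "y = p + (r / (2 * \<tau>)) *\<^sub>R (x - p)"
    define t where "t = 2 * \<tau> / r"
    have t: "0 \<le> t" "t \<le> 1" using \<tau> r(1) by (auto simp: t_def)
    have "norm (y - p) = r / 2" using \<tau> r(1) by (simp add: y_def \<tau>_def[symmetric])
    then have "y \<in> ball p r" using r(1) by (simp add: dist_norm norm_minus_commute)
    moreover have "p \<in> ball p r" using r(1) by simp
    ultimately obtain b where b: "\<And>k. norm (b k) \<le> M * (2/3) ^ k"
      "\<And>t. \<bar>t\<bar> \<le> 1 \<Longrightarrow> (\<lambda>k. b k * complex_of_real t ^ k) sums complex_of_real (kernel s a (p + t *\<^sub>R (y - p)))"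
      using r(2)[of p y] by blast
    have xe: "p + t *\<^sub>R (y - p) = x" using \<tau> r(1) by (simp add: y_def t_def)
    have "(\<lambda>k. b k * complex_of_real t ^ k) sums complex_of_real (kernel s a x)" using b(2)[of t] t xe by simp
    moreover have "b 0 = complex_of_real (kernel s a p)"
      using sums_unique2[OF powser_sums_zero, of b] b(2)[of 0] by simp
    ultimately have "norm (complex_of_real (kernel s a x) - complex_of_real (kernel s a p)) \<le> 3 * M * t"
      using power_series_near_0[OF b(1) t] by metis
    then have "norm (kernel s a x - kernel s a p) \<le> 3 * M * t" by (simp flip: of_real_diff)
    then show ?thesis by (simp add: t_def \<tau>_def)
  qed simp
  have "((\<lambda>x. kernel s a x - kernel s a p) \<longlongrightarrow> 0) (at p)"
  proof (rule tendsto_rabs_zero_cancel, rule tendsto_sandwich[OF _ _ tendsto_const])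
    show "\<forall>\<^sub>F x in at p. \<bar>kernel s a x - kernel s a p\<bar> \<le> (3 * M * 2 / r) * norm (x - p)"
      unfolding eventually_at using bd r(1) by (intro exI[of _ "r/2"]) (auto simp: dist_norm)
    have "((\<lambda>x. (3 * M * 2 / r) * norm (x - p)) \<longlongrightarrow> (3 * M * 2 / r) * norm (p - p)) (at p)" by (intro tendsto_intros)
    then show "((\<lambda>x. (3 * M * 2 / r) * norm (x - p)) \<longlongrightarrow> 0) (at p)" by simp
  qed auto
  then show ?thesis unfolding isCont_def by (simp add: LIM_zero_iff)
qed

lemma kernel_zero [simp]: "kernel s a (0 :: real ^ 'n) = 0"
  by (simp add: kernel_def)

lemma kernel_measurable:
  assumes a: "real_analytic_on_sphere a"
  shows "kernel s a \<in> borel_measurable (borel :: (real ^ 'n) measure)"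
proof -
  have c: "continuous_on (- {0}) (kernel s a :: real ^ 'n \<Rightarrow> real)"
    using kernel_continuous[OF a] by (intro continuous_at_imp_continuous_on) auto
  have "(\<lambda>z. indicator (- {0}) z *\<^sub>R kernel s a z) \<in> borel_measurable (borel :: (real ^ 'n) measure)"
    by (rule borel_measurable_continuous_on_indicator[OF _ c]) auto
  moreover have "(\<lambda>z :: real^'n. indicator (- {0}) z *\<^sub>R kernel s a z) = kernel s a"
  proof
    show "indicator (- {0}) z *\<^sub>R kernel s a z = kernel s a z" for z :: "real^'n" by (cases "z = 0") simp_all
  qed
  ultimately show ?thesis by simp
qed

lemma kernel_bounded_away_from_0:
  fixes a :: "real ^ 'n \<Rightarrow> real"
  assumes a: "real_analytic_on_sphere a" and s: "s > 0" and d: "d > 0"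
  obtains M where "M \<ge> 0" "\<And>z :: real ^ 'n. norm z \<ge> d \<Longrightarrow> \<bar>kernel s a z\<bar> \<le> M"
proof -
  have "continuous_on (sphere 0 1) (kernel s a :: real ^ 'n \<Rightarrow> real)"
    by (intro continuous_at_imp_continuous_on ballI kernel_continuous[OF a]) auto
  then have "bounded (kernel s a ` sphere (0 :: real ^ 'n) 1)" by (intro compact_imp_bounded compact_continuous_image) auto
  then obtain A where A: "A > 0" "\<And>\<theta> :: real ^ 'n. \<theta> \<in> sphere 0 1 \<Longrightarrow> \<bar>kernel s a \<theta>\<bar> \<le> A" by (auto simp: bounded_pos)
  have "\<bar>kernel s a z\<bar> \<le> A * d powr (- (real CARD('n) + 2 * s))" if z: "norm z \<ge> d" for z :: "real ^ 'n"
  proof -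
    have "z \<noteq> 0" using z d by auto
    then have "z /\<^sub>R norm z \<in> sphere 0 1" by simp
    then have "\<bar>a (z /\<^sub>R norm z)\<bar> \<le> A" using A(2)[of "z /\<^sub>R norm z"] by (simp add: kernel_def)
    moreover have "norm z powr (- (real CARD('n) + 2 * s)) \<le> d powr (- (real CARD('n) + 2 * s))"
      using z d s by (intro powr_mono2') auto
    ultimately show ?thesis unfolding kernel_def abs_mult by (intro mult_mono) (use A in auto)
  qed
  then show ?thesis using A by (intro that[of "A * d powr (- (real CARD('n) + 2 * s))"]) auto
qed

text \<open>
  Covering by balls of half the radius leaves room for a ball around each \<open>p \<in> Q\<close> inside the ball of a centre.
\<close>

lemma kernel_segment_power_series_uniform:
  fixes a :: "real ^ 'n \<Rightarrow> real"
  assumes a: "real_analytic_on_sphere a" and Q: "compact Q" "0 \<notin> Q"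
  obtains r M where "r > 0" "\<And>p z y. p \<in> Q \<Longrightarrow> z \<in> ball p r \<Longrightarrow> y \<in> ball p r \<Longrightarrow> \<exists>b. (\<forall>k. norm (b k) \<le> M * (2/3) ^ k) \<and>
     (\<forall>t. \<bar>t\<bar> \<le> 1 \<longrightarrow> (\<lambda>k. b k * complex_of_real t ^ k) sums complex_of_real (kernel s a (z + t *\<^sub>R (y - z))))"
proof -
  define good where "good p r M \<longleftrightarrow> (\<forall>z\<in>ball p r. \<forall>y\<in>ball p r. \<exists>b. (\<forall>k. norm (b k) \<le> M * (2/3) ^ k) \<and>
     (\<forall>t. \<bar>t\<bar> \<le> 1 \<longrightarrow> (\<lambda>k. b k * complex_of_real t ^ k) sums complex_of_real (kernel s a (z + t *\<^sub>R (y - z)))))"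
    for p :: "real ^ 'n" and r M
  have "\<exists>r M. r > 0 \<and> good p r M" if "p \<in> Q" for p
  proof -
    have "p \<noteq> 0" using that Q(2) by auto
    then show ?thesis unfolding good_def by (rule kernel_segment_power_series[OF a, of p s]) blast
  qed
  then obtain \<rho> \<mu> where \<rho>: "\<And>p. p \<in> Q \<Longrightarrow> \<rho> p > 0" and \<mu>: "\<And>p. p \<in> Q \<Longrightarrow> good p (\<rho> p) (\<mu> p)" by metis
  obtain C where C: "C \<subseteq> Q" "finite C" "Q \<subseteq> (\<Union>p\<in>C. ball p (\<rho> p / 2))"
  proof (rule compactE_image[OF Q(1), of Q "\<lambda>p. ball p (\<rho> p / 2)"])
    show "Q \<subseteq> (\<Union>p\<in>Q. ball p (\<rho> p / 2))" using \<rho> by force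
  qed (auto intro: that)
  define r where "r = Min (insert 1 ((\<lambda>p. \<rho> p / 2) ` C))"
  define M where "M = Max (insert 0 (\<mu> ` C))"
  have r0: "r > 0" unfolding r_def using C \<rho> by (subst Min_gr_iff) auto
  show ?thesis
  proof (rule that[OF r0])
    fix p z y assume p: "p \<in> Q" and z: "z \<in> ball p r" and y: "y \<in> ball p r"
    obtain c where c: "c \<in> C" "p \<in> ball c (\<rho> c / 2)" using C(3) p by blast
    have "r \<le> \<rho> c / 2" unfolding r_def using C(2) c(1) by (intro Min_le) auto
    moreover have "\<mu> c \<le> M" unfolding M_def using C(2) c(1) by (intro Max_ge) auto
    ultimately have "z \<in> ball c (\<rho> c)" "y \<in> ball c (\<rho> c)"
      using z y c(2) dist_triangle[of c z p] dist_triangle[of c y p] by auto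
    then obtain b where b: "\<forall>k. norm (b k) \<le> \<mu> c * (2/3) ^ k"
       "\<forall>t. \<bar>t\<bar> \<le> 1 \<longrightarrow> (\<lambda>k. b k * complex_of_real t ^ k) sums complex_of_real (kernel s a (z + t *\<^sub>R (y - z)))"
      using \<mu>[of c] c(1) C(1) unfolding good_def by blast
    have "norm (b k) \<le> M * (2/3) ^ k" for k
    proof -
      have "\<mu> c * (2/3) ^ k \<le> M * (2/3) ^ k" using \<open>\<mu> c \<le> M\<close> by (intro mult_right_mono) auto
      then show ?thesis using b(1) order_trans by blast
    qed
    then show "\<exists>b. (\<forall>k. norm (b k) \<le> M * (2/3) ^ k) \<and>
     (\<forall>t. \<bar>t\<bar> \<le> 1 \<longrightarrow> (\<lambda>k. b k * complex_of_real t ^ k) sums complex_of_real (kernel s a (z + t *\<^sub>R (y - z))))"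
      using b(2) by blast
  qed
qed

text \<open>
  Term by term integration of the power series of \<open>t \<mapsto> kernel s a (z + t *\<^sub>R (y - z) - x)\<close>, whose coefficients are
  bounded uniformly in \<open>x \<in> S\<close>. They come from a choice for each \<open>x\<close>, so their measurability has to be
  recovered from the function they represent.
\<close>

theorem kernel_potential_line_analytic:
  fixes a :: "real ^ 'n \<Rightarrow> real" and u :: "real ^ 'n \<Rightarrow> complex"
  assumes a: "real_analytic_on_sphere a" and u: "integrable lborel u"
    and S: "compact S" "AE x in lborel. x \<notin> S \<longrightarrow> u x = 0" and y0: "y0 \<notin> S"
  shows "line_analytic_at (\<lambda>y. LINT x|lborel. complex_of_real (kernel s a (y - x)) * u x) y0"
proof -
  have [measurable]: "u \<in> borel_measurable borel" "kernel s a \<in> borel_measurable (borel :: (real^'n) measure)" "S \<in> sets borel"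
    using u kernel_measurable[OF a] S(1) by (auto intro: borel_compact)
  let ?Q = "(\<lambda>x. y0 - x) ` S"
  have Q: "compact ?Q" "0 \<notin> ?Q" using S(1) y0 by (auto intro!: compact_continuous_image continuous_intros)
  obtain r M where r: "r > 0" and rM: "\<And>p z y. p \<in> ?Q \<Longrightarrow> z \<in> ball p r \<Longrightarrow> y \<in> ball p r \<Longrightarrow> \<exists>b. (\<forall>k. norm (b k) \<le> M * (2/3) ^ k) \<and>
     (\<forall>t. \<bar>t\<bar> \<le> 1 \<longrightarrow> (\<lambda>k. b k * complex_of_real t ^ k) sums complex_of_real (kernel s a (z + t *\<^sub>R (y - z))))"
    using kernel_segment_power_series_uniform[OF a Q, of s] by blast
  show ?thesis unfolding line_analytic_at_def
  proof (intro exI[of _ r] conjI ballI r)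
    fix z y assume z: "z \<in> ball y0 r" and y: "y \<in> ball y0 r"
    let ?g = "\<lambda>t x. complex_of_real (kernel s a (z + t *\<^sub>R (y - z) - x))"
    have "\<exists>b. (\<forall>k. norm (b k) \<le> M * (2/3) ^ k) \<and> (\<forall>t. \<bar>t\<bar> \<le> 1 \<longrightarrow> (\<lambda>k. b k * complex_of_real t ^ k) sums ?g t x)" if "x \<in> S" for x
      using rM[of "y0 - x" "z - x" "y - x"] z y that by (simp add: dist_norm algebra_simps)
    then obtain b' where b': "\<And>x k. x \<in> S \<Longrightarrow> norm (b' x k) \<le> M * (2/3) ^ k"
      "\<And>x t. x \<in> S \<Longrightarrow> \<bar>t\<bar> \<le> 1 \<Longrightarrow> (\<lambda>k. b' x k * complex_of_real t ^ k) sums ?g t x"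
      by metis
    define b where "b = (\<lambda>k x. if x \<in> S then b' x k else 0)"
    (* The k-th coefficient is the limit, as t tends to 0, of the remainder of order k divided by t ^ k. *)
    have bm: "b k \<in> borel_measurable borel" for k
    proof (induction k rule: less_induct)
      case (less k)
      define \<tau> where "\<tau> = (\<lambda>m::nat. inverse (real (Suc m)))"
      have \<tau>: "0 < \<tau> m" "\<tau> m \<le> 1" for m by (auto simp: \<tau>_def inverse_le_1_iff)
      have \<tau>0: "\<tau> \<longlonglongrightarrow> 0" unfolding \<tau>_def by (rule LIMSEQ_inverse_real_of_nat)
      let ?h = "\<lambda>m x. if x \<in> S then (?g (\<tau> m) x - (\<Sum>j<k. b j x * complex_of_real (\<tau> m) ^ j)) / complex_of_real (\<tau> m) ^ k else 0"
      have "(\<lambda>m. ?h m x) \<longlonglongrightarrow> b k x" for x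
      proof (cases "x \<in> S")
        case True
        have hle: "norm (?h m x - b k x) \<le> 3 * \<bar>M\<bar> * \<tau> m" for m
        proof -
          have t: "\<bar>\<tau> m\<bar> \<le> 1" using \<tau>[of m] by simp
          have "(\<lambda>j. b' x (j + k) * complex_of_real (\<tau> m) ^ (j + k)) sums (?g (\<tau> m) x - (\<Sum>j<k. b' x j * complex_of_real (\<tau> m) ^ j))"
            by (rule sums_split_initial_segment[OF b'(2)[OF True t]])
          then have "(\<lambda>j. b' x (j + k) * complex_of_real (\<tau> m) ^ (j + k) / complex_of_real (\<tau> m) ^ k) sums ((?g (\<tau> m) x - (\<Sum>j<k. b' x j * complex_of_real (\<tau> m) ^ j)) / complex_of_real (\<tau> m) ^ k)"
            by (rule sums_divide)
          then have "(\<lambda>j. b' x (j + k) * complex_of_real (\<tau> m) ^ j) sums ?h m x"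
            using \<tau>(1)[of m] True by (simp add: b_def power_add)
          moreover have "norm (b' x (j + k)) \<le> \<bar>M\<bar> * (2/3) ^ j" for j
          proof -
            have "norm (b' x (j + k)) \<le> M * (2/3) ^ (j + k)" by (rule b'(1)[OF True])
            also have "\<dots> \<le> \<bar>M\<bar> * (2/3) ^ j" by (intro mult_mono power_decreasing) auto
            finally show ?thesis .
          qed
          ultimately have "norm (?h m x - b' x (0 + k)) \<le> 3 * \<bar>M\<bar> * \<tau> m"
            using \<tau>[of m] power_series_near_0[of "\<lambda>j. b' x (j + k)" "\<bar>M\<bar>" "\<tau> m" "?h m x"] by simp
          then show ?thesis using True by (simp add: b_def)
        qed
        have lim0: "(\<lambda>m. 3 * \<bar>M\<bar> * \<tau> m) \<longlonglongrightarrow> 0" using tendsto_mult_left[OF \<tau>0, of "3 * \<bar>M\<bar>"] by simp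
        have "(\<lambda>m. norm (?h m x - b k x)) \<longlonglongrightarrow> 0" by (rule tendsto_zero_squeeze[OF lim0 norm_ge_zero hle])
        then show ?thesis unfolding tendsto_norm_zero_iff by (rule LIM_zero_cancel)
      qed (simp add: b_def)
      moreover have "?h m \<in> borel_measurable borel" for m
      proof -
        have [measurable]: "(\<lambda>x. \<Sum>j<k. b j x * complex_of_real (\<tau> m) ^ j) \<in> borel_measurable borel"
          using less by (intro borel_measurable_sum borel_measurable_times) auto
        show ?thesis by measurable
      qed
      ultimately show ?case by (rule borel_measurable_LIMSEQ_metric[rotated])
    qed
    note [measurable] = bm
    have ble: "norm (b k x) \<le> \<bar>M\<bar> * (2/3) ^ k" for k x
    proof (cases "x \<in> S")
      case True
      have "M * (2/3) ^ k \<le> \<bar>M\<bar> * (2/3) ^ k" by (intro mult_right_mono) auto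
      from order_trans[OF b'(1)[OF True] this] show ?thesis using True by (simp only: b_def if_True)
    qed (simp add: b_def)
    let ?c = "\<lambda>k. LINT x|lborel. b k x * u x"
    have "(\<lambda>k. ?c k * complex_of_real t ^ k) sums (LINT x|lborel. ?g t x * u x)" if t: "\<bar>t\<bar> \<le> 1" for t
    proof -
      let ?f = "\<lambda>k x. complex_of_real t ^ k * (b k x * u x)"
      have fle: "norm (?f k x) \<le> \<bar>M\<bar> * (2/3) ^ k * norm (u x)" for k x
      proof -
        have "norm (?f k x) = \<bar>t\<bar> ^ k * (norm (b k x) * norm (u x))" by (simp add: norm_mult norm_power)
        also have "\<dots> \<le> 1 * (\<bar>M\<bar> * (2/3) ^ k * norm (u x))"
        proof (rule mult_mono)
          show "norm (b k x) * norm (u x) \<le> \<bar>M\<bar> * (2/3) ^ k * norm (u x)" by (rule mult_right_mono[OF ble]) simp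
          show "\<bar>t\<bar> ^ k \<le> 1" using t by (intro power_le_one) auto
        qed simp_all
        finally show ?thesis by simp
      qed
      have fi: "integrable lborel (?f k)" for k
      proof (rule Bochner_Integration.integrable_bound)
        show "integrable lborel (\<lambda>x. \<bar>M\<bar> * (2/3) ^ k * norm (u x))" using u by auto
        show "AE x in lborel. norm (?f k x) \<le> norm (\<bar>M\<bar> * (2/3) ^ k * norm (u x))" using fle by (intro AE_I2) (simp add: abs_mult)
      qed measurable
      have gs: "summable (\<lambda>k. \<bar>M\<bar> * (2/3) ^ k * c)" for c :: real
        by (intro summable_mult2 summable_mult summable_geometric) auto
      have "(\<lambda>k. LINT x|lborel. ?f k x) sums (LINT x|lborel. (\<Sum>k. ?f k x))"
      proof (rule sums_integral)
        show "AE x in lborel. summable (\<lambda>k. norm (?f k x))"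
          using fle by (intro AE_I2 summable_comparison_test'[OF gs]) auto
        show "summable (\<lambda>k. LINT x|lborel. norm (?f k x))"
        proof (rule summable_comparison_test'[OF gs])
          fix k :: nat assume "k \<ge> 0"
          have "(LINT x|lborel. norm (?f k x)) \<le> (LINT x|lborel. \<bar>M\<bar> * (2/3) ^ k * norm (u x))"
            using fi u fle by (intro integral_mono) auto
          then show "norm (LINT x|lborel. norm (?f k x)) \<le> \<bar>M\<bar> * (2/3) ^ k * (LINT x|lborel. norm (u x))" by simp
        qed
      qed (rule fi)
      moreover have "(LINT x|lborel. (\<Sum>k. ?f k x)) = (LINT x|lborel. ?g t x * u x)"
      proof (rule integral_cong_AE)
        show "AE x in lborel. (\<Sum>k. ?f k x) = ?g t x * u x"
          using S(2)
        proof eventually_elim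
          case (elim x)
          show ?case
          proof (cases "x \<in> S")
            case True
            have "(\<lambda>k. b' x k * complex_of_real t ^ k * u x) sums (?g t x * u x)" by (intro sums_mult2 b'(2) True t)
            then show ?thesis using True by (simp add: b_def sums_iff mult_ac)
          qed (use elim in simp)
        qed
      qed measurable
      moreover have "(\<lambda>k. LINT x|lborel. ?f k x) = (\<lambda>k. ?c k * complex_of_real t ^ k)" by (simp add: mult.commute)
      ultimately show ?thesis by (simp only:)
    qed
    then show "\<exists>b. \<forall>t. \<bar>t\<bar> \<le> 1 \<longrightarrow> (\<lambda>k. b k * complex_of_real t ^ k) sums (LINT x|lborel. ?g t x * u x)"
      by (intro exI[of _ ?c] allI impI)
  qed
qed

section \<open>Smooth bump functions\<close>

text \<open>
  The negative powers of \<open>t\<close> close the family under differentiation (\<open>flat_exp_deriv\<close>).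
\<close>

definition flat_exp :: "nat \<Rightarrow> real \<Rightarrow> real" where
  "flat_exp m t = (if 0 < t then exp (- (1 / t)) / t ^ m else 0)"

lemma power_le_fact_exp:
  fixes x :: real assumes "x \<ge> 0" shows "x ^ k \<le> fact k * exp x"
proof -
  have "(\<Sum>n\<in>{k}. x ^ n /\<^sub>R fact n) \<le> (\<Sum>n. x ^ n /\<^sub>R fact n)"
    using assms by (intro sum_le_suminf summable_exp_generic) auto
  then have "inverse (fact k) * x ^ k \<le> exp x" by (simp add: exp_def)
  then show ?thesis by (simp add: field_simps)
qed

text \<open>
  The quadratic bound makes the derivative at \<open>0\<close> vanish.
\<close>

lemma flat_exp_le: "\<bar>flat_exp m t\<bar> \<le> fact (m + 2) * t\<^sup>2"
proof (cases "t > 0")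
  case True
  have "(1 / t) ^ (m + 2) \<le> fact (m + 2) * exp (1 / t)" using True by (intro power_le_fact_exp) simp
  then have "exp (- (1 / t)) * (1 / t) ^ (m + 2) \<le> exp (- (1 / t)) * (fact (m + 2) * exp (1 / t))" by (intro mult_left_mono) auto
  also have "\<dots> = fact (m + 2)" by (simp add: exp_minus)
  also have "exp (- (1 / t)) * (1 / t) ^ (m + 2) = exp (- (1 / t)) / t ^ m / t\<^sup>2"
    by (simp add: power_one_over power_add power2_eq_square)
  finally have "exp (- (1 / t)) / t ^ m / t\<^sup>2 \<le> fact (m + 2)" .
  then have "exp (- (1 / t)) / t ^ m \<le> fact (m + 2) * t\<^sup>2" using True by (subst (asm) pos_divide_le_eq) auto
  then show ?thesis using True by (simp add: flat_exp_def)
qed (simp add: flat_exp_def)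

lemma flat_exp_deriv:
  "(flat_exp m has_real_derivative (flat_exp (m + 2) t - real m * flat_exp (m + 1) t)) (at t)"
proof (cases "t = 0")
  case True
  have "((\<lambda>h. flat_exp m h / h) \<longlongrightarrow> 0) (at 0)"
  proof (rule tendsto_rabs_zero_cancel, rule tendsto_sandwich[OF _ _ tendsto_const])
    show "\<forall>\<^sub>F h in at 0. \<bar>flat_exp m h / h\<bar> \<le> fact (m + 2) * \<bar>h\<bar>"
    proof (intro always_eventually allI)
      fix h :: real
      show "\<bar>flat_exp m h / h\<bar> \<le> fact (m + 2) * \<bar>h\<bar>"
      proof (cases "h = 0")
        case False
        then have "\<bar>flat_exp m h\<bar> / \<bar>h\<bar> \<le> fact (m + 2) * h\<^sup>2 / \<bar>h\<bar>" by (intro divide_right_mono flat_exp_le) simp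
        also have "h\<^sup>2 = \<bar>h\<bar> * \<bar>h\<bar>" by (simp add: power2_eq_square)
        finally have le: "\<bar>flat_exp m h\<bar> / \<bar>h\<bar> \<le> fact (m + 2) * (\<bar>h\<bar> * \<bar>h\<bar>) / \<bar>h\<bar>" .
        have c: "c * (a * a) / a = c * a" if "a \<noteq> 0" for a c :: real using that by simp
        have h: "\<bar>h\<bar> \<noteq> 0" using False by simp
        from le show ?thesis unfolding c[OF h] abs_divide .
      qed simp
    qed
    have "((\<lambda>h::real. fact (m + 2) * \<bar>h\<bar>) \<longlongrightarrow> fact (m + 2) * \<bar>0\<bar>) (at 0)" by (intro tendsto_intros)
    then show "((\<lambda>h::real. fact (m + 2) * \<bar>h\<bar>) \<longlongrightarrow> 0) (at 0)" by simp
  qed simp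
  then show ?thesis using True by (simp add: has_field_derivative_iff flat_exp_def)
next
  case False
  show ?thesis
  proof (cases "t > 0")
    case True
    have "((\<lambda>t. exp (- (1 / t)) / t ^ m) has_real_derivative (flat_exp (m + 2) t - real m * flat_exp (m + 1) t)) (at t)"
      using True by (auto intro!: derivative_eq_intros simp: flat_exp_def)
        (cases m; simp add: field_simps power_add power2_eq_square)
    then show ?thesis
      by (rule DERIV_cong_ev[THEN iffD1, rotated 3, OF _ refl _ refl])
        (use True eventually_nhds_in_open[of "{0<..}" t] in \<open>auto elim!: eventually_mono simp: flat_exp_def\<close>)
  next
    case neg: False
    have "((\<lambda>t. 0) has_real_derivative (flat_exp (m + 2) t - real m * flat_exp (m + 1) t)) (at t)"
      using neg by (simp add: flat_exp_def)
    then show ?thesis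
      by (rule DERIV_cong_ev[THEN iffD1, rotated 3, OF _ refl _ refl])
        (use neg False eventually_nhds_in_open[of "{..<0}" t] in \<open>auto elim!: eventually_mono simp: flat_exp_def\<close>)
  qed
qed

text \<open>
  An algebra of functions that contains its partial derivatives; its members are smooth by a single induction on
  the order.
\<close>

inductive_set bump_algebra :: "real ^ 'n \<Rightarrow> real \<Rightarrow> (real ^ 'n \<Rightarrow> real) set" for x0 :: "real ^ 'n" and e :: real where
  const: "(\<lambda>x. c) \<in> bump_algebra x0 e"
| coord: "(\<lambda>x. vec_nth x i) \<in> bump_algebra x0 e"
| bump: "(\<lambda>x. flat_exp m (e\<^sup>2 - (x - x0) \<bullet> (x - x0))) \<in> bump_algebra x0 e"
| add: "f \<in> bump_algebra x0 e \<Longrightarrow> g \<in> bump_algebra x0 e \<Longrightarrow> (\<lambda>x. f x + g x) \<in> bump_algebra x0 e"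
| mult: "f \<in> bump_algebra x0 e \<Longrightarrow> g \<in> bump_algebra x0 e \<Longrightarrow> (\<lambda>x. f x * g x) \<in> bump_algebra x0 e"

lemma bump_algebra_derivative:
  fixes f :: "real ^ 'n \<Rightarrow> real"
  assumes "f \<in> bump_algebra x0 e"
  shows "\<exists>p. (\<forall>i. p i \<in> bump_algebra x0 e) \<and> (\<forall>x. (f has_derivative (\<lambda>h. \<Sum>i\<in>UNIV. vec_nth h i * p i x)) (at x))"
  using assms
proof induction
  case (const c)
  show ?case by (intro exI[of _ "\<lambda>i x. 0"]) (auto intro: bump_algebra.const)
next
  case (coord i)
  have "((\<lambda>x::real^'n. vec_nth x i) has_derivative (\<lambda>h. vec_nth h i)) (at x)" for x
    by (rule bounded_linear.has_derivative[OF bounded_linear_vec_nth has_derivative_ident])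
  moreover have "(\<lambda>h::real^'n. \<Sum>j\<in>UNIV. vec_nth h j * (if j = i then 1 else 0)) = (\<lambda>h. vec_nth h i)"
    by (simp add: if_distrib cong: if_cong)
  ultimately show ?case
    by (intro exI[of _ "\<lambda>j x. if j = i then 1 else 0"]) (auto intro: bump_algebra.const)
next
  case (bump m)
  let ?q = "\<lambda>x. e\<^sup>2 - (x - x0) \<bullet> (x - x0)"
  let ?p = "\<lambda>i x. (flat_exp (m + 2) (?q x) + (- real m) * flat_exp (m + 1) (?q x)) * (-2 * (vec_nth x i + (- vec_nth x0 i)))"
  have "?p i \<in> bump_algebra x0 e" for i
    by (intro bump_algebra.intros)
  moreover have "((\<lambda>x. flat_exp m (?q x)) has_derivative (\<lambda>h. \<Sum>i\<in>UNIV. vec_nth h i * ?p i x)) (at x)" for x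
  proof -
    let ?d = "flat_exp (m + 2) (?q x) - real m * flat_exp (m + 1) (?q x)"
    have dq: "(?q has_derivative (\<lambda>h. -2 * ((x - x0) \<bullet> h))) (at x)"
      by (auto intro!: derivative_eq_intros simp: inner_commute)
    have "((\<lambda>x. flat_exp m (?q x)) has_derivative (\<lambda>h. ?d * (-2 * ((x - x0) \<bullet> h)))) (at x)"
      using has_derivative_compose[OF dq flat_exp_deriv[of m "?q x", unfolded has_field_derivative_def]] by (simp add: mult.commute)
    moreover have "(\<lambda>h. d * (-2 * ((x - x0) \<bullet> h))) = (\<lambda>h. \<Sum>i\<in>UNIV. vec_nth h i * (d * (-2 * (vec_nth x i + (- vec_nth x0 i)))))" for d :: real
      by (auto simp: inner_vec_def sum_distrib_left algebra_simps intro!: sum.cong)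
    ultimately show ?thesis by simp
  qed
  ultimately show ?case by (intro exI[of _ ?p]) blast
next
  case (add f g)
  then obtain p p' where p: "\<forall>i. p i \<in> bump_algebra x0 e" "\<forall>x. (f has_derivative (\<lambda>h. \<Sum>i\<in>UNIV. vec_nth h i * p i x)) (at x)"
    and p': "\<forall>i. p' i \<in> bump_algebra x0 e" "\<forall>x. (g has_derivative (\<lambda>h. \<Sum>i\<in>UNIV. vec_nth h i * p' i x)) (at x)" by blast
  have "((\<lambda>x. f x + g x) has_derivative (\<lambda>h. \<Sum>i\<in>UNIV. vec_nth h i * (p i x + p' i x))) (at x)" for x
    using has_derivative_add[OF p(2)[rule_format] p'(2)[rule_format], of x] by (simp add: distrib_left sum.distrib)
  then show ?case using p(1) p'(1) by (intro exI[of _ "\<lambda>i x. p i x + p' i x"]) (auto intro: bump_algebra.add)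
next
  case (mult f g)
  then obtain p p' where p: "\<forall>i. p i \<in> bump_algebra x0 e" "\<forall>x. (f has_derivative (\<lambda>h. \<Sum>i\<in>UNIV. vec_nth h i * p i x)) (at x)"
    and p': "\<forall>i. p' i \<in> bump_algebra x0 e" "\<forall>x. (g has_derivative (\<lambda>h. \<Sum>i\<in>UNIV. vec_nth h i * p' i x)) (at x)" by blast
  have "((\<lambda>x. f x * g x) has_derivative (\<lambda>h. \<Sum>i\<in>UNIV. vec_nth h i * (f x * p' i x + p i x * g x))) (at x)" for x
  proof -
    have "(\<lambda>h. f x * (\<Sum>i\<in>UNIV. vec_nth h i * p' i x) + (\<Sum>i\<in>UNIV. vec_nth h i * p i x) * g x) = (\<lambda>h. \<Sum>i\<in>UNIV. vec_nth h i * (f x * p' i x + p i x * g x))"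
      by (simp add: distrib_left sum.distrib sum_distrib_left sum_distrib_right mult_ac)
    then show ?thesis using has_derivative_mult[OF p(2)[rule_format] p'(2)[rule_format], of x] by simp
  qed
  then show ?case using p(1) p'(1) mult(1,2) by (intro exI[of _ "\<lambda>i x. f x * p' i x + p i x * g x"]) (auto intro!: bump_algebra.add bump_algebra.mult)
qed

lemma bump_algebra_C_k:
  fixes f :: "real ^ 'n \<Rightarrow> real"
  assumes "f \<in> bump_algebra x0 e" shows "C_k k (\<lambda>x. complex_of_real (f x))"
  using assms
proof (induction k arbitrary: f)
  case (0 f)
  then obtain p where p: "\<forall>x. (f has_derivative (\<lambda>h. \<Sum>i\<in>UNIV. vec_nth h i * p i x)) (at x)"
    using bump_algebra_derivative by blast
  then have "continuous_on UNIV f" by (intro continuous_at_imp_continuous_on ballI has_derivative_continuous) blast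
  then show ?case by (simp add: continuous_on_of_real)
next
  case (Suc k f)
  then obtain p where p: "\<forall>i. p i \<in> bump_algebra x0 e" "\<forall>x. (f has_derivative (\<lambda>h. \<Sum>i\<in>UNIV. vec_nth h i * p i x)) (at x)"
    using bump_algebra_derivative by blast
  have d: "((\<lambda>x. complex_of_real (f x)) has_derivative (\<lambda>h. complex_of_real (\<Sum>i\<in>UNIV. vec_nth h i * p i x))) (at x)" for x
    using p(2) by (intro has_derivative_of_real) blast
  have ax: "(\<Sum>j\<in>UNIV. vec_nth (axis i 1) j * p j x) = p i x" for i x
    by (simp add: axis_def if_distrib[of "\<lambda>t. t * _"] cong: if_cong)
  have "frechet_derivative (\<lambda>x. complex_of_real (f x)) (at x) (axis i 1) = complex_of_real (p i x)" for x i
    unfolding frechet_derivative_at[OF d, symmetric] ax ..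
  then show ?case using d p(1) Suc.IH by (auto simp: differentiable_on_def differentiable_def)
qed

theorem bump_function_exists:
  fixes x0 :: "real ^ 'n"
  assumes e: "e > 0"
  obtains f :: "real ^ 'n \<Rightarrow> real" where
    "\<And>U. cball x0 e \<subseteq> U \<Longrightarrow> (\<lambda>x. complex_of_real (f x)) \<in> test_functions U"
    "\<And>x. f x \<ge> 0" "\<And>x. x \<notin> ball x0 e \<Longrightarrow> f x = 0" "integrable lborel f" "(LINT x|lborel. f x) = 1"
proof -
  define g where "g = (\<lambda>x. flat_exp 0 (e\<^sup>2 - (x - x0) \<bullet> (x - x0)))"
  have gB: "g \<in> bump_algebra x0 e" unfolding g_def by (rule bump_algebra.bump)
  have gpos: "g x > 0 \<longleftrightarrow> x \<in> ball x0 e" for x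
  proof -
    have "0 < e\<^sup>2 - (x - x0) \<bullet> (x - x0) \<longleftrightarrow> (norm (x - x0))\<^sup>2 < e\<^sup>2" by (simp add: power2_norm_eq_inner)
    also have "\<dots> \<longleftrightarrow> norm (x - x0) < e" using e by (simp add: power_mono_iff flip: not_le)
    finally show ?thesis by (simp add: g_def flat_exp_def dist_norm norm_minus_commute)
  qed
  have gnn: "g x \<ge> 0" for x by (simp add: g_def flat_exp_def)
  have gz: "g x = 0" if "x \<notin> ball x0 e" for x using gpos[of x] gnn[of x] that by linarith
  have supp: "closure {x. complex_of_real (c * g x) \<noteq> 0} \<subseteq> cball x0 e" for c
  proof (rule closure_minimal)
    show "{x. complex_of_real (c * g x) \<noteq> 0} \<subseteq> cball x0 e" using gz ball_subset_cball[of x0 e] by force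
  qed simp
  have test: "(\<lambda>x. complex_of_real (c * g x)) \<in> test_functions U" if "cball x0 e \<subseteq> U" for U c
  proof -
    have "compact (cball x0 e \<inter> closure {x. complex_of_real (c * g x) \<noteq> 0})" by (intro compact_Int_closed) auto
    then have "compact (closure {x. complex_of_real (c * g x) \<noteq> 0})" unfolding Int_absorb1[OF supp] .
    moreover have "C_k k (\<lambda>x. complex_of_real (c * g x))" for k
      by (intro bump_algebra_C_k[where ?x0.0 = x0 and e = e] bump_algebra.mult bump_algebra.const gB)
    ultimately show ?thesis using supp[of c] that unfolding test_functions_def by blast
  qed
  have gi: "integrable lborel g"
    using integrable_Re[OF test_functions_L1_L2(2)[OF test[OF order_refl, of 1]]] by simp
  have "(LINT x|lborel. g x) \<noteq> 0"
  proof
    assume "(LINT x|lborel. g x) = 0"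
    then have "AE x in lborel. g x = 0" using integral_nonneg_eq_0_iff_AE[OF gi] gnn by simp
    then have "AE x in lborel. x \<notin> ball x0 e" by eventually_elim (use gpos in force)
    then have "emeasure lborel (ball x0 e) = 0" by (subst (asm) AE_iff_measurable[where N = "ball x0 e"]) auto
    then have "measure lborel (ball x0 e) = 0" by (simp add: measure_def)
    then show False using content_ball_pos[OF e, of x0] by simp
  qed
  moreover have "(LINT x|lborel. g x) \<ge> 0" using gnn by simp
  ultimately have I: "(LINT x|lborel. g x) > 0" by linarith
  define c where "c = 1 / (LINT x|lborel. g x)"
  show ?thesis
  proof (rule that[of "\<lambda>x. c * g x"])
    show "(LINT x|lborel. c * g x) = 1" using I by (simp add: c_def)
    show "c * g x \<ge> 0" for x using I gnn by (simp add: c_def)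
  qed (use test gz gi in auto)
qed

section \<open>Weak solutions seen through their potentials\<close>

text \<open>
  The constants of ellipticity double, since the multiplier is twice the symbol.
\<close>

lemma analytic_elliptic_nonlocal_kernel:
  fixes a :: "real ^ 'n \<Rightarrow> real"
  assumes s: "0 < s" "s < 1" and a: "analytic_elliptic_density s a"
  shows "\<exists>l L. nonlocal_kernel (kernel s a) s l L"
proof -
  have an: "real_analytic_on_sphere a" and nn: "\<And>\<theta>. norm \<theta> = 1 \<Longrightarrow> 0 \<le> a \<theta>" and el: "elliptic s a"
    using a by (auto simp: analytic_elliptic_density_def)
  obtain l L where lL: "0 < l" "\<And>\<xi>. l * norm \<xi> powr (2 * s) \<le> symbol s a \<xi>" "\<And>\<xi>. symbol s a \<xi> \<le> L * norm \<xi> powr (2 * s)"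
    using el by (auto simp: elliptic_def)
  note m = kernel_multiplier[OF s(1) nn el kernel_measurable[OF an]]
  have "nonlocal_kernel (kernel s a) s (2 * l) (2 * L)"
  proof
    fix z show "0 \<le> kernel s a z" by (cases "z = 0") (simp_all add: kernel_def nn)
  next
    fix \<xi> :: "real^'n"
    have e: "(\<integral>\<^sup>+h. ennreal (kernel s a h * (norm (exp (\<i> * complex_of_real (h \<bullet> \<xi>)) - 1))\<^sup>2) \<partial>lborel) = ennreal (2 * symbol s a \<xi>)"
      by (rule m)
    show "ennreal (2 * l * norm \<xi> powr (2 * s)) \<le> (\<integral>\<^sup>+h. ennreal (kernel s a h * (norm (exp (\<i> * complex_of_real (h \<bullet> \<xi>)) - 1))\<^sup>2) \<partial>lborel)"
      unfolding e using lL(2)[of \<xi>] by (intro ennreal_leI) simp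
    show "(\<integral>\<^sup>+h. ennreal (kernel s a h * (norm (exp (\<i> * complex_of_real (h \<bullet> \<xi>)) - 1))\<^sup>2) \<partial>lborel) \<le> ennreal (2 * L * norm \<xi> powr (2 * s))"
      unfolding e using lL(3)[of \<xi>] by (intro ennreal_leI) simp
  qed (use s lL kernel_measurable[OF an] in auto)
  then show ?thesis by blast
qed

lemma kernel_even:
  fixes a :: "real ^ 'n \<Rightarrow> real"
  assumes a: "analytic_elliptic_density s a" shows "kernel s a (- z) = kernel s a z"
proof (cases "z = 0")
  case False
  then have "z /\<^sub>R norm z \<in> sphere 0 1" by simp
  then show ?thesis using a by (simp add: kernel_def analytic_elliptic_density_def)
qed simp

text \<open>
  The choice in \<open>solution\<close> selects a weak solution because one exists.
\<close>

lemma weak_solution_solution: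
  fixes \<Omega> :: "(real ^ 'n) set"
  assumes s: "0 < s" "s < 1" and a: "analytic_elliptic_density s a" and \<Omega>: "open \<Omega>" "bounded \<Omega>" and f: "f \<in> Hs_L1 s"
  shows "weak_solution s a \<Omega> f (solution s a \<Omega> f)"
proof -
  obtain l L where K: "nonlocal_kernel (kernel s a) s l L" using analytic_elliptic_nonlocal_kernel[OF s a] by blast
  obtain v where v: "v \<in> sobolev_tilde s \<Omega>" "\<And>\<psi>. \<psi> \<in> sobolev_tilde s \<Omega> \<Longrightarrow> nonlocal_kernel.form (kernel s a) (\<lambda>x. f x + v x) \<psi> = 0"
    using nonlocal_kernel.weak_form_solvable[OF K \<Omega> f] by blast
  have H: "(\<lambda>x. f x + v x) \<in> Hs_L1 s" using Hs_L1_add_scale[OF f sobolev_tildeD(1)[OF s \<Omega> v(1)], of 1] by simp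
  then have "(\<lambda>x. f x + v x) \<in> sobolev s" using sobolev_iff_Hs_L1[OF Hs_L1D(1)[OF H] Hs_L1D(2)[OF H]] by blast
  then have "weak_solution s a \<Omega> f (\<lambda>x. f x + v x)"
    using v by (simp add: weak_solution_def energy_def nonlocal_kernel.form_def[OF K])
  then show ?thesis unfolding solution_def by (rule someI[of "weak_solution s a \<Omega> f"])
qed

definition potential :: "real \<Rightarrow> (real ^ 'n \<Rightarrow> real) \<Rightarrow> (real ^ 'n \<Rightarrow> complex) \<Rightarrow> real ^ 'n \<Rightarrow> complex" where
  "potential s a u y = (LINT x|lborel. complex_of_real (kernel s a (y - x)) * u x)"

lemma potential_measurable:
  assumes [measurable]: "kernel s a \<in> borel_measurable borel" "u \<in> borel_measurable borel"
  shows "potential s a u \<in> borel_measurable borel"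
  unfolding potential_def[abs_def] by (rule lborel.borel_measurable_lebesgue_integral) measurable

lemma potential_bound:
  fixes u :: "real ^ 'n \<Rightarrow> complex"
  assumes k: "kernel s a \<in> borel_measurable borel" and u: "integrable lborel u" and S: "AE x in lborel. x \<notin> S \<longrightarrow> u x = 0"
    and M: "\<And>x. x \<in> S \<Longrightarrow> \<bar>kernel s a (y - x)\<bar> \<le> M"
  shows "integrable lborel (\<lambda>x. complex_of_real (kernel s a (y - x)) * u x)"
    "norm (potential s a u y) \<le> M * (LINT x|lborel. norm (u x))"
proof -
  have [measurable]: "kernel s a \<in> borel_measurable borel" "u \<in> borel_measurable borel" using k u by auto
  have le: "AE x in lborel. norm (complex_of_real (kernel s a (y - x)) * u x) \<le> M * norm (u x)"
    using S
  proof eventually_elim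
    case (elim x)
    show ?case
    proof (cases "x \<in> S")
      case True
      then show ?thesis using M[OF True] by (simp add: norm_mult mult_right_mono)
    qed (use elim in simp)
  qed
  show i: "integrable lborel (\<lambda>x. complex_of_real (kernel s a (y - x)) * u x)"
  proof (rule Bochner_Integration.integrable_bound)
    show "integrable lborel (\<lambda>x. M * norm (u x))" using u by auto
    show "AE x in lborel. norm (complex_of_real (kernel s a (y - x)) * u x) \<le> norm (M * norm (u x))"
      using le
    proof eventually_elim
      case (elim x)
      then show ?case by (rule order_trans) (simp only: real_norm_def abs_ge_self)
    qed
  qed measurable
  have "norm (potential s a u y) \<le> (LINT x|lborel. norm (complex_of_real (kernel s a (y - x)) * u x))"
    unfolding potential_def by (rule integral_norm_bound)
  also have "\<dots> \<le> (LINT x|lborel. M * norm (u x))" using i u le by (intro integral_mono_AE) auto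
  finally show "norm (potential s a u y) \<le> M * (LINT x|lborel. norm (u x))" by simp
qed

text \<open>
  Of the four terms of \<open>(u x - u y) * cnj (g x - g y)\<close> the two with equal arguments vanish. The kernel is bounded
  on the remaining region, so Fubini applies to the two mixed terms, and they agree because the kernel is even.
\<close>

lemma energy_disjoint_supports:
  fixes a :: "real ^ 'n \<Rightarrow> real"
  assumes s: "0 < s" and a: "analytic_elliptic_density s a"
    and u: "integrable lborel u" "AE x in lborel. x \<notin> S \<longrightarrow> u x = 0" and S: "S \<in> sets borel"
    and g: "integrable lborel g" "AE x in lborel. x \<notin> T \<longrightarrow> g x = 0" and T: "T \<in> sets borel"
    and d: "d > 0" "\<And>x y. x \<in> S \<Longrightarrow> y \<in> T \<Longrightarrow> dist x y \<ge> d"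
  shows "energy s a u g = - (LINT y|lborel. cnj (g y) * potential s a u y)"
proof -
  let ?P = "lborel \<Otimes>\<^sub>M lborel :: ((real^'n) \<times> (real^'n)) measure"
  have an: "real_analytic_on_sphere a" using a by (simp add: analytic_elliptic_density_def)
  obtain M where M: "M \<ge> 0" "\<And>z. norm z \<ge> d \<Longrightarrow> \<bar>kernel s a z\<bar> \<le> M" using kernel_bounded_away_from_0[OF an s d(1)] by blast
  have [measurable]: "u \<in> borel_measurable borel" "g \<in> borel_measurable borel" "S \<in> sets borel" "T \<in> sets borel"
    "kernel s a \<in> borel_measurable borel" using u g S T kernel_measurable[OF an] by auto
  have ST: "x \<notin> S \<or> x \<notin> T" for x using d(1) d(2)[of x x] by auto
  let ?k = "\<lambda>x y. complex_of_real (kernel s a (x - y))"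
  have kc: "?k x y = ?k y x" for x y using kernel_even[OF a, of "x - y"] by simp
  have ae2: "AE z in ?P. Q (fst z) \<and> Q (snd z)" if Q: "AE x in lborel. Q x" and [measurable]: "Measurable.pred borel Q" for Q :: "real^'n \<Rightarrow> bool"
  proof (rule lborel_pair.AE_pair_measure)
    show "{z \<in> space ?P. Q (fst z) \<and> Q (snd z)} \<in> sets ?P" by measurable
    show "AE x in lborel. AE y in lborel. Q (fst (x, y)) \<and> Q (snd (x, y))"
      using Q
    proof eventually_elim
      case (elim x)
      show ?case using Q by eventually_elim (simp add: elim)
    qed
  qed
  have aeu: "AE z in ?P. (fst z \<notin> S \<longrightarrow> u (fst z) = 0) \<and> (snd z \<notin> S \<longrightarrow> u (snd z) = 0)"
    by (rule ae2[OF u(2)]) measurable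
  have aeg: "AE z in ?P. (fst z \<notin> T \<longrightarrow> g (fst z) = 0) \<and> (snd z \<notin> T \<longrightarrow> g (snd z) = 0)"
    by (rule ae2[OF g(2)]) measurable
  have prod: "integrable ?P (\<lambda>(x, y). u x * cnj (g y))" "integrable ?P (\<lambda>(x, y). cnj (g x) * u y)"
    by (intro integrable_lborel_product u integrable_cnj g)+
  have i1: "integrable ?P (\<lambda>(x, y). u x * cnj (g y) * ?k x y)"
  proof (rule Bochner_Integration.integrable_bound[where f = "\<lambda>z. complex_of_real M * (case z of (x, y) \<Rightarrow> u x * cnj (g y))"])
    show "integrable ?P (\<lambda>z. complex_of_real M * (case z of (x, y) \<Rightarrow> u x * cnj (g y)))" using prod(1) by (intro integrable_mult_right)
    show "AE z in ?P. norm (case z of (x, y) \<Rightarrow> u x * cnj (g y) * ?k x y) \<le> norm (complex_of_real M * (case z of (x, y) \<Rightarrow> u x * cnj (g y)))"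
      using aeu aeg
    proof eventually_elim
      case (elim z)
      obtain x y where z: "z = (x, y)" by (cases z)
      show ?case
      proof (cases "x \<in> S \<and> y \<in> T")
        case True
        then have "\<bar>kernel s a (x - y)\<bar> \<le> M" using d(2)[of x y] M(2) by (simp add: dist_norm)
        then show ?thesis using M(1) unfolding z by (simp add: norm_mult mult.commute[of _ "\<bar>kernel s a _\<bar>"] mult_right_mono)
      qed (use elim z in auto)
    qed
  qed measurable
  have i2: "integrable ?P (\<lambda>(x, y). u y * cnj (g x) * ?k x y)"
  proof (rule Bochner_Integration.integrable_bound[where f = "\<lambda>z. complex_of_real M * (case z of (x, y) \<Rightarrow> cnj (g x) * u y)"])
    show "integrable ?P (\<lambda>z. complex_of_real M * (case z of (x, y) \<Rightarrow> cnj (g x) * u y))" using prod(2) by (intro integrable_mult_right)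
    show "AE z in ?P. norm (case z of (x, y) \<Rightarrow> u y * cnj (g x) * ?k x y) \<le> norm (complex_of_real M * (case z of (x, y) \<Rightarrow> cnj (g x) * u y))"
      using aeu aeg
    proof eventually_elim
      case (elim z)
      obtain x y where z: "z = (x, y)" by (cases z)
      show ?case
      proof (cases "y \<in> S \<and> x \<in> T")
        case True
        then have "\<bar>kernel s a (x - y)\<bar> \<le> M" using d(2)[of y x] M(2) by (simp add: dist_norm norm_minus_commute)
        then have le: "\<bar>kernel s a (x - y)\<bar> * (norm (g x) * norm (u y)) \<le> M * (norm (g x) * norm (u y))" by (rule mult_right_mono) simp
        have n1: "norm (u y * cnj (g x) * ?k x y) = \<bar>kernel s a (x - y)\<bar> * (norm (g x) * norm (u y))" by (simp add: norm_mult)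
        have n2: "norm (complex_of_real M * (cnj (g x) * u y)) = M * (norm (g x) * norm (u y))" using M(1) by (simp add: norm_mult)
        show ?thesis unfolding z prod.case n1 n2 by (rule le)
      qed (use elim z in auto)
    qed
  qed measurable
  have e1: "(LINT (x, y)|?P. u x * cnj (g y) * ?k x y) = (LINT y|lborel. cnj (g y) * potential s a u y)"
  proof -
    have "(LINT (x, y)|?P. u x * cnj (g y) * ?k x y) = (LINT y|lborel. LINT x|lborel. u x * cnj (g y) * ?k x y)"
      using lborel_pair.integral_snd[OF i1] by simp
    also have "\<dots> = (LINT y|lborel. LINT x|lborel. cnj (g y) * (?k y x * u x))"
      by (simp add: kc mult_ac)
    finally show ?thesis by (simp add: potential_def)
  qed
  have e2: "(LINT (x, y)|?P. u y * cnj (g x) * ?k x y) = (LINT y|lborel. cnj (g y) * potential s a u y)"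
  proof -
    have "(LINT (x, y)|?P. u y * cnj (g x) * ?k x y) = (LINT x|lborel. LINT y|lborel. u y * cnj (g x) * ?k x y)"
      using lborel_pair.integral_fst[OF i2] by simp
    also have "\<dots> = (LINT x|lborel. LINT y|lborel. cnj (g x) * (?k x y * u y))"
      by (simp add: mult_ac)
    finally show ?thesis by (simp add: potential_def)
  qed
  have "(LINT (x, y)|?P. (u x - u y) * cnj (g x - g y) * ?k x y) = (LINT z|?P. - (case z of (x, y) \<Rightarrow> u x * cnj (g y) * ?k x y) - (case z of (x, y) \<Rightarrow> u y * cnj (g x) * ?k x y))"
  proof (rule integral_cong_AE)
    show "AE z in ?P. (case z of (x, y) \<Rightarrow> (u x - u y) * cnj (g x - g y) * ?k x y) = - (case z of (x, y) \<Rightarrow> u x * cnj (g y) * ?k x y) - (case z of (x, y) \<Rightarrow> u y * cnj (g x) * ?k x y)"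
      using aeu aeg
    proof eventually_elim
      case (elim z)
      obtain x y where z: "z = (x, y)" by (cases z)
      have 0: "u x * cnj (g x) = 0" "u y * cnj (g y) = 0" using elim ST[of x] ST[of y] z by auto
      have "(u x - u y) * cnj (g x - g y) = u x * cnj (g x) - u x * cnj (g y) - u y * cnj (g x) + u y * cnj (g y)"
        by (simp add: algebra_simps)
      then have "(u x - u y) * cnj (g x - g y) = - (u x * cnj (g y)) - u y * cnj (g x)" unfolding 0 by simp
      then show ?case unfolding z by (simp only: prod.case) (simp add: algebra_simps)
    qed
  qed measurable
  also have "\<dots> = - (LINT (x, y)|?P. u x * cnj (g y) * ?k x y) - (LINT (x, y)|?P. u y * cnj (g x) * ?k x y)"
    using i1 i2 by (subst Bochner_Integration.integral_diff) auto
  finally show ?thesis unfolding energy_def e1 e2 by simp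
qed

text \<open>
  A smooth probability density concentrated on the ball. The quantifier over \<open>U\<close> lets one \<open>f\<close> be a test function for
  every set that contains the closed ball.
\<close>

definition unit_bump :: "real ^ 'n \<Rightarrow> real \<Rightarrow> (real ^ 'n \<Rightarrow> real) \<Rightarrow> bool" where
  "unit_bump x0 e f \<longleftrightarrow> (\<forall>U. cball x0 e \<subseteq> U \<longrightarrow> (\<lambda>x. complex_of_real (f x)) \<in> test_functions U) \<and>
     (\<forall>x. f x \<ge> 0) \<and> (\<forall>x. x \<notin> ball x0 e \<longrightarrow> f x = 0) \<and> integrable lborel f \<and> (LINT x|lborel. f x) = 1"

lemma unit_bump_average:
  fixes F :: "real ^ 'n \<Rightarrow> complex"
  assumes f: "unit_bump x0 e f" and [measurable]: "F \<in> borel_measurable borel"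
    and F: "\<And>x. x \<in> ball x0 e \<Longrightarrow> norm (F x - c) \<le> \<eta>"
  shows "norm ((LINT x|lborel. complex_of_real (f x) * F x) - c) \<le> \<eta>"
proof -
  have fi: "integrable lborel f" "(LINT x|lborel. f x) = 1" and f0: "\<And>x. f x \<ge> 0" "\<And>x. x \<notin> ball x0 e \<Longrightarrow> f x = 0"
    using f by (auto simp: unit_bump_def)
  have le: "norm (complex_of_real (f x) * (F x - c)) \<le> \<eta> * f x" for x
    using F[of x] f0(1)[of x] f0(2)[of x] by (cases "x \<in> ball x0 e") (simp_all add: norm_mult mult.commute[of \<eta>] mult_left_mono)
  have i: "integrable lborel (\<lambda>x. complex_of_real (f x) * (F x - c))"
    by (rule Bochner_Integration.integrable_bound[where f = "\<lambda>x. \<eta> * f x"])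
      (use fi le order_trans[OF le abs_ge_self] in auto)
  have i2: "integrable lborel (\<lambda>x. complex_of_real (f x) * c)" using fi by auto
  have "(LINT x|lborel. complex_of_real (f x) * F x) = (LINT x|lborel. complex_of_real (f x) * (F x - c) + complex_of_real (f x) * c)"
    by (simp add: algebra_simps)
  also have "\<dots> = (LINT x|lborel. complex_of_real (f x) * (F x - c)) + c"
    using i i2 fi(2) by (subst Bochner_Integration.integral_add) auto
  finally have "norm ((LINT x|lborel. complex_of_real (f x) * F x) - c) = norm (LINT x|lborel. complex_of_real (f x) * (F x - c))" by simp
  also have "\<dots> \<le> (LINT x|lborel. norm (complex_of_real (f x) * (F x - c)))" by (rule integral_norm_bound)
  also have "\<dots> \<le> (LINT x|lborel. \<eta> * f x)" using i fi le by (intro integral_mono) auto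
  finally show ?thesis using fi(2) by simp
qed

lemma potential_continuous:
  fixes a :: "real ^ 'n \<Rightarrow> real"
  assumes s: "0 < s" and an: "real_analytic_on_sphere a" and u: "integrable lborel u"
    and S: "closed S" "AE x in lborel. x \<notin> S \<longrightarrow> u x = 0" and y: "y \<notin> S"
  shows "isCont (potential s a u) y"
  unfolding continuous_at_sequentially
proof (intro allI impI)
  fix Y :: "nat \<Rightarrow> real^'n" assume Y: "Y \<longlonglongrightarrow> y"
  have [measurable]: "u \<in> borel_measurable borel" "kernel s a \<in> borel_measurable borel" using u kernel_measurable[OF an] by auto
  obtain d where d: "d > 0" "ball y d \<subseteq> - S" using S(1) y by (metis ComplI open_Compl open_contains_ball)
  obtain M where M: "M \<ge> 0" "\<And>z. norm z \<ge> d / 2 \<Longrightarrow> \<bar>kernel s a z\<bar> \<le> M"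
    using kernel_bounded_away_from_0[OF an s, of "d/2"] d(1) by auto
  obtain N where N: "\<And>k. k \<ge> N \<Longrightarrow> dist (Y k) y < d / 2"
    using Y d(1) unfolding lim_sequentially by (meson half_gt_zero)
  have far: "norm (w - x) \<ge> d / 2" if "dist w y < d / 2" "x \<in> S" for w x
  proof -
    have "dist y x \<ge> d" using d(2) that(2) by (meson ComplD in_mono linorder_not_le mem_ball)
    then show ?thesis using dist_triangle[of y x w] that(1) by (simp add: dist_norm norm_minus_commute)
  qed
  have "(\<lambda>k. potential s a u (Y (k + N))) \<longlonglongrightarrow> potential s a u y"
    unfolding potential_def
  proof (rule Bochner_Integration.integral_dominated_convergence[where w = "\<lambda>x. M * norm (u x)"])
    show "AE x in lborel. (\<lambda>k. complex_of_real (kernel s a (Y (k + N) - x)) * u x) \<longlonglongrightarrow> complex_of_real (kernel s a (y - x)) * u x"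
      using S(2)
    proof eventually_elim
      case (elim x)
      show ?case
      proof (cases "x \<in> S")
        case True
        then have "y - x \<noteq> 0" using y by auto
        then have "isCont (kernel s a) (y - x)" by (rule kernel_continuous[OF an])
        moreover have "(\<lambda>k. Y (k + N) - x) \<longlonglongrightarrow> y - x" by (intro tendsto_intros LIMSEQ_ignore_initial_segment Y)
        ultimately have "(\<lambda>k. kernel s a (Y (k + N) - x)) \<longlonglongrightarrow> kernel s a (y - x)" by (rule isCont_tendsto_compose)
        then show ?thesis by (intro tendsto_intros)
      qed (use elim in simp)
    qed
    show "AE x in lborel. norm (complex_of_real (kernel s a (Y (k + N) - x)) * u x) \<le> M * norm (u x)" for k
      using S(2)
    proof eventually_elim
      case (elim x)
      show ?case
      proof (cases "x \<in> S")
        case True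
        then show ?thesis using M(2)[OF far[OF N[of "k + N"] True]] by (simp add: norm_mult mult_right_mono)
      qed (use elim in simp)
    qed
  qed (use u in auto)
  then have "(\<lambda>k. potential s a u (Y k)) \<longlonglongrightarrow> potential s a u y" by (rule LIMSEQ_offset)
  then show "(potential s a u \<circ> Y) \<longlonglongrightarrow> potential s a u y" by (simp add: o_def)
qed

lemma unit_bumpD:
  assumes "unit_bump x0 e f"
  shows "\<And>U. cball x0 e \<subseteq> U \<Longrightarrow> (\<lambda>x. complex_of_real (f x)) \<in> test_functions U"
    "integrable lborel (\<lambda>x. complex_of_real (f x))" "AE x in lborel. x \<notin> ball x0 e \<longrightarrow> complex_of_real (f x) = 0"
    "(LINT x|lborel. norm (complex_of_real (f x))) = 1"
  using assms by (auto simp: unit_bump_def)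

text \<open>
  By \<open>energy_disjoint_supports\<close> the potentials have the same averages against all bumps in \<open>W\<close>; both are
  continuous there, so shrinking the bump gives equality at each point.
\<close>

lemma energy_determines_potential:
  fixes a1 a2 :: "real ^ 'n \<Rightarrow> real"
  assumes s: "0 < s" and a1: "analytic_elliptic_density s a1" and a2: "analytic_elliptic_density s a2"
    and S: "compact S"
    and u1: "integrable lborel u1" "AE x in lborel. x \<notin> S \<longrightarrow> u1 x = 0"
    and u2: "integrable lborel u2" "AE x in lborel. x \<notin> S \<longrightarrow> u2 x = 0"
    and W: "open W" "W \<inter> S = {}"
    and eq: "\<And>g. g \<in> test_functions W \<Longrightarrow> energy s a1 u1 g = energy s a2 u2 g"
    and y1: "y1 \<in> W"
  shows "potential s a1 u1 y1 = potential s a2 u2 y1"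
proof -
  let ?D = "\<lambda>y. potential s a1 u1 y - potential s a2 u2 y"
  have an1: "real_analytic_on_sphere a1" and an2: "real_analytic_on_sphere a2"
    using a1 a2 by (auto simp: analytic_elliptic_density_def)
  have [measurable]: "u1 \<in> borel_measurable borel" "u2 \<in> borel_measurable borel"
    "kernel s a1 \<in> borel_measurable borel" "kernel s a2 \<in> borel_measurable borel"
    using u1 u2 kernel_measurable[OF an1] kernel_measurable[OF an2] by auto
  have Dm: "?D \<in> borel_measurable borel"
    by (intro borel_measurable_diff potential_measurable) measurable
  have "?D y1 = 0"
  proof (rule ccontr)
    assume nz: "?D y1 \<noteq> 0"
    have y1S: "y1 \<notin> S" using W(2) y1 by blast
    have "isCont ?D y1"
      using potential_continuous[OF s an1 u1(1) compact_imp_closed[OF S] u1(2) y1S]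
        potential_continuous[OF s an2 u2(1) compact_imp_closed[OF S] u2(2) y1S] by (rule isCont_diff)
    then obtain \<rho>1 where \<rho>1: "\<rho>1 > 0" "\<And>x. dist x y1 < \<rho>1 \<Longrightarrow> dist (?D x) (?D y1) < norm (?D y1) / 2"
      unfolding continuous_at_eps_delta using nz by (metis half_gt_zero zero_less_norm_iff)
    have "open (W \<inter> - S)" using W(1) compact_imp_closed[OF S] by auto
    moreover have "y1 \<in> W \<inter> - S" using y1 y1S by blast
    ultimately obtain \<rho>2 where \<rho>2: "\<rho>2 > 0" "cball y1 \<rho>2 \<subseteq> W \<inter> - S" by (meson open_contains_cball)
    define \<rho> where "\<rho> = min \<rho>1 \<rho>2"
    have \<rho>: "\<rho> > 0" "\<rho> \<le> \<rho>1" "cball y1 \<rho> \<subseteq> W" "cball y1 \<rho> \<inter> S = {}"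
      using \<rho>1(1) \<rho>2 subset_cball[of \<rho> \<rho>2 y1] by (auto simp: \<rho>_def)
    obtain g where g: "unit_bump y1 \<rho> g" using bump_function_exists[OF \<rho>(1), of y1] unfolding unit_bump_def by metis
    let ?g = "\<lambda>x. complex_of_real (g x)"
    note gD = unit_bumpD[OF g]
    obtain r where r: "r > 0" "\<And>x y. x \<in> S \<Longrightarrow> y \<in> cball y1 \<rho> \<Longrightarrow> r \<le> dist x y"
      using separate_compact_closed[OF S closed_cball, of y1 \<rho>] \<rho>(4) by blast
    have gz: "AE x in lborel. x \<notin> cball y1 \<rho> \<longrightarrow> ?g x = 0" using gD(3) by eventually_elim auto
    have Sb: "S \<in> sets borel" using S by (rule borel_compact)
    have E: "energy s a u ?g = - (LINT y|lborel. ?g y * potential s a u y)"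
      if "analytic_elliptic_density s a" "integrable lborel u" "AE x in lborel. x \<notin> S \<longrightarrow> u x = 0" for a u
      using energy_disjoint_supports[OF s that Sb gD(2) gz _ r] by simp
    have "energy s a1 u1 ?g = energy s a2 u2 ?g" by (rule eq[OF gD(1)[OF \<rho>(3)]])
    then have eqI: "(LINT y|lborel. ?g y * potential s a1 u1 y) = (LINT y|lborel. ?g y * potential s a2 u2 y)"
      using E[OF a1 u1] E[OF a2 u2] by simp
    have gi: "integrable lborel (\<lambda>y. ?g y * potential s a u y)"
      if an: "real_analytic_on_sphere a" and u: "integrable lborel u" "AE x in lborel. x \<notin> S \<longrightarrow> u x = 0" for a u
    proof -
      obtain M where M: "M \<ge> 0" "\<And>z. norm z \<ge> r \<Longrightarrow> \<bar>kernel s a z\<bar> \<le> M" using kernel_bounded_away_from_0[OF an s r(1)] by blast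
      have [measurable]: "potential s a u \<in> borel_measurable borel" "?g \<in> borel_measurable borel"
        using u(1) gD(2) by (auto intro!: potential_measurable kernel_measurable[OF an])
      show ?thesis
      proof (rule Bochner_Integration.integrable_bound)
        show "integrable lborel (\<lambda>y. ?g y * complex_of_real (M * (LINT x|lborel. norm (u x))))" using gD(2) by (rule integrable_mult_left)
        show "AE y in lborel. norm (?g y * potential s a u y) \<le> norm (?g y * complex_of_real (M * (LINT x|lborel. norm (u x))))"
          using gz
        proof eventually_elim
          case (elim y)
          show ?case
          proof (cases "y \<in> cball y1 \<rho>")
            case True
            have "norm (potential s a u y) \<le> M * (LINT x|lborel. norm (u x))"
              using M(2) r(2)[OF _ True] by (intro potential_bound(2)[OF kernel_measurable[OF an] u]) (simp add: dist_norm norm_minus_commute)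
            also have "\<dots> \<le> norm (complex_of_real (M * (LINT x|lborel. norm (u x))))" by (simp only: norm_of_real abs_ge_self)
            finally show ?thesis unfolding norm_mult by (intro mult_left_mono) auto
          qed (use elim in simp)
        qed
      qed measurable
    qed
    have "(LINT y|lborel. ?g y * ?D y) = 0"
      using gi[OF an1 u1] gi[OF an2 u2] eqI by (simp add: right_diff_distrib)
    moreover have "norm ((LINT y|lborel. ?g y * ?D y) - ?D y1) \<le> norm (?D y1) / 2"
    proof (rule unit_bump_average[OF g Dm])
      fix x assume "x \<in> ball y1 \<rho>"
      then have "dist x y1 < \<rho>1" using \<rho>(2) by (simp add: dist_commute)
      from less_imp_le[OF \<rho>1(2)[OF this]] show "norm (?D x - ?D y1) \<le> norm (?D y1) / 2" by (simp only: dist_norm)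
    qed
    ultimately have "norm (0 - ?D y1) \<le> norm (?D y1) / 2" by (simp only:)
    then have "norm (?D y1) \<le> norm (?D y1) / 2" by (simp only: diff_0 norm_minus_cancel)
    then show False using nz by simp
  qed
  then show ?thesis by simp
qed

text \<open>
  The exterior datum tends to a point mass and is unbounded in \<open>H\<^sup>s\<close>, but it acts on \<open>\<Omega>\<close> only through
  its potential, which is bounded by \<open>M\<close> because its mass is \<open>1\<close> and the ball is at distance at least \<open>d\<close> from
  \<open>\<Omega>\<close>. Testing the equation with \<open>v\<close> itself therefore bounds the energy of \<open>v\<close> by a multiple of its
  \<open>L\<^sup>1\<close> norm, while \<open>Poincare\<close> and \<open>L1_sq_le_L2\<close> bound the square of the \<open>L\<^sup>1\<close> norm by a multiple
  of the energy.
\<close>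

lemma correction_L1_bound:
  fixes \<Omega> :: "(real ^ 'n) set"
  assumes s: "0 < s" "s < 1" and a: "analytic_elliptic_density s a" and \<Omega>: "open \<Omega>" "bounded \<Omega>"
    and d: "d > 0" "\<And>x. x \<in> \<Omega> \<Longrightarrow> 2 * d \<le> dist x0 x"
  obtains C where "C \<ge> 0" "\<And>e f v. e \<le> d \<Longrightarrow> unit_bump x0 e f \<Longrightarrow>
      v = (\<lambda>x. solution s a \<Omega> (\<lambda>x. complex_of_real (f x)) x - complex_of_real (f x)) \<Longrightarrow>
      integrable lborel v \<and> (AE x in lborel. x \<notin> \<Omega> \<longrightarrow> v x = 0) \<and> (LINT x|lborel. norm (v x)) \<le> C"
proof -
  obtain l L where K: "nonlocal_kernel (kernel s a) s l L" using analytic_elliptic_nonlocal_kernel[OF s a] by blast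
  interpret nonlocal_kernel "kernel s a" s l L by (rule K)
  have an: "real_analytic_on_sphere a" using a by (simp add: analytic_elliptic_density_def)
  have \<Omega>b: "\<Omega> \<in> sets borel" using \<Omega> by simp
  obtain M where M: "M \<ge> 0" "\<And>z. norm z \<ge> d \<Longrightarrow> \<bar>kernel s a z\<bar> \<le> M" using kernel_bounded_away_from_0[OF an s(1) d(1)] by blast
  obtain C where C: "C > 0" "\<And>u. u \<in> L2_on lborel \<Longrightarrow> (AE x in lborel. x \<notin> \<Omega> \<longrightarrow> u x = 0) \<Longrightarrow> increments u \<in> L2_on P \<Longrightarrow>
     norm2_on lborel u \<le> C * norm2_on P (increments u)" using Poincare[OF \<Omega>(2) \<Omega>b] by blast
  define C' where "C' = 2 * C * M * measure lborel \<Omega>"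
  have "integrable lborel v \<and> (AE x in lborel. x \<notin> \<Omega> \<longrightarrow> v x = 0) \<and> (LINT x|lborel. norm (v x)) \<le> C'"
    if e: "e \<le> d" and f: "unit_bump x0 e f" and v_def: "v = (\<lambda>x. solution s a \<Omega> (\<lambda>x. complex_of_real (f x)) x - complex_of_real (f x))" for e f v
  proof -
    let ?f = "\<lambda>x. complex_of_real (f x)"
    note fD = unit_bumpD[OF f]
    have fH: "?f \<in> Hs_L1 s" by (rule test_functions_Hs_L1[OF s fD(1)[OF order_refl]])
    have w: "weak_solution s a \<Omega> ?f (solution s a \<Omega> ?f)" by (rule weak_solution_solution[OF s a \<Omega> fH])
    have vT: "v \<in> sobolev_tilde s \<Omega>" using w unfolding weak_solution_def v_def by blast
    note vH = sobolev_tildeD(1)[OF s \<Omega> vT] and vz = sobolev_tildeD(2)[OF s \<Omega> vT]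
    note vD = Hs_L1D[OF vH]
    have Gv: "increments v \<in> L2_on P" and Gf: "increments ?f \<in> L2_on P" using increments_L2(1) vH fH by auto
    let ?I = "LINT x|lborel. norm (v x)"
    have sep: "dist x y \<ge> d" if "x \<in> ball x0 e" "y \<in> \<Omega>" for x y
      using d(2)[OF that(2)] that(1) e dist_triangle[of x0 y x] by simp
    have "energy s a (solution s a \<Omega> ?f) v = 0" using w vT unfolding weak_solution_def by blast
    moreover have "solution s a \<Omega> ?f = (\<lambda>x. v x + 1 * ?f x)" by (simp add: v_def)
    ultimately have "form (\<lambda>x. v x + 1 * ?f x) v = 0" by (simp add: energy_def form_def)
    then have "inner_on P (increments v) (increments v) + inner_on P (increments ?f) (increments v) = 0"
      unfolding form_eq increments_add_scale by (simp add: inner_on_add_left Gv Gf)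
    then have "complex_of_real (norm2_on P (increments v)) = - 2 * form ?f v"
      by (simp add: inner_on_self form_eq add_eq_0_iff)
    also have "form ?f v = energy s a ?f v" by (simp add: energy_def form_def)
    also have "energy s a ?f v = - (LINT y|lborel. cnj (v y) * potential s a ?f y)"
      using energy_disjoint_supports[OF s(1) a fD(2,3) _ vD(2) vz \<Omega>b d(1) sep] by simp
    finally have c: "complex_of_real (norm2_on P (increments v)) = - 2 * - (LINT y|lborel. cnj (v y) * potential s a ?f y)" .
    have "norm2_on P (increments v) = norm (complex_of_real (norm2_on P (increments v)))" by simp
    also have "\<dots> = norm (2 * (LINT y|lborel. cnj (v y) * potential s a ?f y))" unfolding c by simp
    also have "\<dots> \<le> 2 * (M * ?I)"
    proof -
      have [measurable]: "v \<in> borel_measurable borel" "?f \<in> borel_measurable borel" using vD fD(2) by auto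
      have [measurable]: "potential s a ?f \<in> borel_measurable borel" by (intro potential_measurable) measurable
      have le: "AE y in lborel. norm (cnj (v y) * potential s a ?f y) \<le> M * norm (v y)"
        using vz
      proof eventually_elim
        case (elim y)
        show ?case
        proof (cases "y \<in> \<Omega>")
          case True
          have "norm (potential s a ?f y) \<le> M * (LINT x|lborel. norm (?f x))"
            using M(2) sep[OF _ True] by (intro potential_bound[OF kernel_measurable[OF an] fD(2,3)]) (simp add: dist_norm norm_minus_commute)
          then have "norm (v y) * norm (potential s a ?f y) \<le> norm (v y) * M" unfolding fD(4) by (intro mult_left_mono) auto
          then show ?thesis by (simp add: norm_mult mult.commute)
        qed (use elim in simp)
      qed
      have "integrable lborel (\<lambda>y. cnj (v y) * potential s a ?f y)"
      proof (rule Bochner_Integration.integrable_bound)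
        show "integrable lborel (\<lambda>y. M * norm (v y))" using vD by auto
        show "AE y in lborel. norm (cnj (v y) * potential s a ?f y) \<le> norm (M * norm (v y))"
          using le by eventually_elim (simp add: abs_mult M(1))
      qed measurable
      then have "(LINT y|lborel. norm (cnj (v y) * potential s a ?f y)) \<le> (LINT y|lborel. M * norm (v y))"
        using vD le by (intro integral_mono_AE) auto
      then have "norm (LINT y|lborel. cnj (v y) * potential s a ?f y) \<le> M * ?I"
        using order_trans[OF integral_norm_bound] by fastforce
      then show ?thesis by (simp add: norm_mult)
    qed
    finally have E: "norm2_on P (increments v) \<le> 2 * (M * ?I)" .
    have I0: "?I \<ge> 0" by simp
    have "?I\<^sup>2 \<le> norm2_on lborel v * measure lborel \<Omega>" by (rule L1_sq_le_L2[OF \<Omega>(2) \<Omega>b vD(1) vz])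
    also have "\<dots> \<le> (C * norm2_on P (increments v)) * measure lborel \<Omega>" using C(2)[OF vD(1) vz Gv] by (intro mult_right_mono) auto
    also have "\<dots> \<le> (C * (2 * (M * ?I))) * measure lborel \<Omega>" using E C(1) by (intro mult_right_mono mult_left_mono) auto
    finally have "?I * ?I \<le> C' * ?I" by (simp add: C'_def power2_eq_square mult_ac)
    moreover have "C' \<ge> 0" using C(1) M(1) by (simp add: C'_def)
    ultimately have "?I \<le> C'" using I0 by (cases "?I = 0") auto
    then show ?thesis using vD(2) vz by blast
  qed
  moreover have "C' \<ge> 0" using C(1) M(1) by (simp add: C'_def)
  ultimately show ?thesis using that by blast
qed

lemma solution_decomposition_potential:
  fixes a :: "real ^ 'n \<Rightarrow> real"
  assumes s: "0 < s" and an: "real_analytic_on_sphere a"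
    and f: "unit_bump x0 e f" and v: "integrable lborel v" "AE x in lborel. x \<notin> \<Omega> \<longrightarrow> v x = 0"
    and u: "u = (\<lambda>x. complex_of_real (f x) + v x)"
    and r: "r > 0" "\<And>x. x \<in> ball x0 e \<union> \<Omega> \<Longrightarrow> norm (y - x) \<ge> r"
  shows "potential s a u y = potential s a (\<lambda>x. complex_of_real (f x)) y + potential s a v y"
proof -
  obtain M where M: "M \<ge> 0" "\<And>z. norm z \<ge> r \<Longrightarrow> \<bar>kernel s a z\<bar> \<le> M" using kernel_bounded_away_from_0[OF an s r(1)] by blast
  have "integrable lborel (\<lambda>x. complex_of_real (kernel s a (y - x)) * complex_of_real (f x))"
    by (rule potential_bound(1)[OF kernel_measurable[OF an] unit_bumpD(2,3)[OF f], where M = M]) (use M(2) r(2) in blast)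
  moreover have "integrable lborel (\<lambda>x. complex_of_real (kernel s a (y - x)) * v x)"
    by (rule potential_bound(1)[OF kernel_measurable[OF an] v, where M = M]) (use M(2) r(2) in blast)
  ultimately show ?thesis unfolding potential_def u by (simp only: distrib_left Bochner_Integration.integral_add)
qed

section \<open>Determination of the density\<close>

theorem theorem1p4:
  fixes s :: real
    and \<Omega> G W1 W2 :: "(real ^ 'n) set"
    and a1 a2 :: "real ^ 'n \<Rightarrow> real"
  assumes "0 < s" and "s < 1"
    and "CARD('n) \<ge> 2"
    and "open \<Omega>" and "bounded \<Omega>"
    and "G \<in> components (- closure \<Omega>)" and "\<not> bounded G"
    and "open W1" and "W1 \<noteq> {}" and "compactly_contained W1 G"
    and "open W2" and "W2 \<noteq> {}" and "compactly_contained W2 G"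
    and "closure W1 \<inter> closure W2 = {}"
    and "analytic_elliptic_density s a1"
    and "analytic_elliptic_density s a2"
    and "\<forall>f\<in>sobolev_tilde s W1. DN_map s a1 \<Omega> W1 W2 f = DN_map s a2 \<Omega> W1 W2 f"
  shows "\<forall>\<theta>\<in>sphere 0 1. a1 \<theta> = a2 \<theta>"
proof
  fix \<theta> :: "real ^ 'n" assume "\<theta> \<in> sphere 0 1"
  then have \<theta>: "norm \<theta> = 1" by simp
  note s = assms(1,2) and \<Omega> = assms(4,5) and a1 = assms(15) and a2 = assms(16)
  have an1: "real_analytic_on_sphere a1" and an2: "real_analytic_on_sphere a2"
    using a1 a2 by (auto simp: analytic_elliptic_density_def)
  have Gc: "connected G" and Gsub: "G \<subseteq> - closure \<Omega>"
    using in_components_connected[OF assms(6)] in_components_subset[OF assms(6)] .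
  have W1G: "W1 \<subseteq> G" and W2G: "W2 \<subseteq> G"
    using assms(10,13) closure_subset unfolding compactly_contained_def by blast+
  have W12: "W1 \<inter> W2 = {}" using assms(14) closure_subset by blast
  obtain x0 where x0: "x0 \<in> W1" using assms(9) by blast
  (* With 3 d every y within 2 d of x0 still has distance at least d from Omega. *)
  obtain d where d: "d > 0" "cball x0 (3 * d) \<subseteq> W1"
  proof -
    obtain r where "r > 0" "cball x0 r \<subseteq> W1" using assms(8) x0 open_contains_cball by blast
    then show ?thesis by (intro that[of "r / 3"]) auto
  qed
  have far: "3 * d \<le> dist x0 x" if "x \<in> \<Omega>" for x
  proof (rule ccontr)
    assume "\<not> 3 * d \<le> dist x0 x"
    then have "x \<in> cball x0 (3 * d)" by simp
    then have "x \<in> - closure \<Omega>" using d(2) W1G Gsub by blast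
    then show False using that closure_subset by blast
  qed
  have far2: "\<And>x. x \<in> \<Omega> \<Longrightarrow> 2 * d \<le> dist x0 x" using far d(1) by fastforce
  obtain C1 where C1: "C1 \<ge> 0" "\<And>e f v. e \<le> d \<Longrightarrow> unit_bump x0 e f \<Longrightarrow>
      v = (\<lambda>x. solution s a1 \<Omega> (\<lambda>x. complex_of_real (f x)) x - complex_of_real (f x)) \<Longrightarrow>
      integrable lborel v \<and> (AE x in lborel. x \<notin> \<Omega> \<longrightarrow> v x = 0) \<and> (LINT x|lborel. norm (v x)) \<le> C1"
    using correction_L1_bound[OF s a1 \<Omega> d(1) far2] by blast
  obtain C2 where C2: "C2 \<ge> 0" "\<And>e f v. e \<le> d \<Longrightarrow> unit_bump x0 e f \<Longrightarrow>
      v = (\<lambda>x. solution s a2 \<Omega> (\<lambda>x. complex_of_real (f x)) x - complex_of_real (f x)) \<Longrightarrow>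
      integrable lborel v \<and> (AE x in lborel. x \<notin> \<Omega> \<longrightarrow> v x = 0) \<and> (LINT x|lborel. norm (v x)) \<le> C2"
    using correction_L1_bound[OF s a2 \<Omega> d(1) far2] by blast
  obtain M1 where M1: "M1 \<ge> 0" "\<And>z. norm z \<ge> d \<Longrightarrow> \<bar>kernel s a1 z\<bar> \<le> M1" using kernel_bounded_away_from_0[OF an1 s(1) d(1)] by blast
  obtain M2 where M2: "M2 \<ge> 0" "\<And>z. norm z \<ge> d \<Longrightarrow> \<bar>kernel s a2 z\<bar> \<le> M2" using kernel_bounded_away_from_0[OF an2 s(1) d(1)] by blast
  define C where "C = M1 * C1 + M2 * C2 + 2"
  (* The bump used below depends on y, but C does not. *)
  have key: "\<bar>kernel s a1 (y - x0) - kernel s a2 (y - x0)\<bar> \<le> C" if y: "y \<noteq> x0" "dist x0 y \<le> 2 * d" for y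
  proof -
    have yx: "y - x0 \<noteq> 0" using y by simp
    have "\<exists>\<delta>>0. \<forall>x. dist x (y - x0) < \<delta> \<longrightarrow> dist (kernel s a x) (kernel s a (y - x0)) < 1"
      if "real_analytic_on_sphere a" for a
      using kernel_continuous[OF that yx, of s] unfolding continuous_at_eps_delta by (metis zero_less_one)
    then obtain \<delta>1 \<delta>2 where \<delta>: "\<delta>1 > 0" "\<And>x. dist x (y - x0) < \<delta>1 \<Longrightarrow> dist (kernel s a1 x) (kernel s a1 (y - x0)) < 1"
      "\<delta>2 > 0" "\<And>x. dist x (y - x0) < \<delta>2 \<Longrightarrow> dist (kernel s a2 x) (kernel s a2 (y - x0)) < 1"
      using an1 an2 by metis
    (* The ball of radius e around x0 avoids y and stays in W1, and on it x0 may be moved in the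
       argument y - x0 of both kernels at the cost of an error below 1. *)
    define e where "e = Min {d, dist x0 y, \<delta>1, \<delta>2}"
    have e: "e > 0" "e \<le> d" "e \<le> dist x0 y" "e \<le> \<delta>1" "e \<le> \<delta>2" using d(1) y(1) \<delta>(1,3) by (auto simp: e_def)
    obtain f where f: "unit_bump x0 (e / 2) f"
      using bump_function_exists[of "e / 2" x0] e(1) unfolding unit_bump_def by (metis half_gt_zero)
    let ?f = "\<lambda>x. complex_of_real (f x)"
    note fD = unit_bumpD[OF f]
    define u1 where "u1 = solution s a1 \<Omega> ?f"
    define u2 where "u2 = solution s a2 \<Omega> ?f"
    define v1 where "v1 = (\<lambda>x. u1 x - ?f x)"
    define v2 where "v2 = (\<lambda>x. u2 x - ?f x)"
    have e2: "e / 2 \<le> d" using e by simp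
    have v1: "integrable lborel v1" "AE x in lborel. x \<notin> \<Omega> \<longrightarrow> v1 x = 0" "(LINT x|lborel. norm (v1 x)) \<le> C1"
      using C1(2)[OF e2 f] unfolding v1_def u1_def by blast+
    have v2: "integrable lborel v2" "AE x in lborel. x \<notin> \<Omega> \<longrightarrow> v2 x = 0" "(LINT x|lborel. norm (v2 x)) \<le> C2"
      using C2(2)[OF e2 f] unfolding v2_def u2_def by blast+
    have u1_eq: "u1 = (\<lambda>x. ?f x + v1 x)" and u2_eq: "u2 = (\<lambda>x. ?f x + v2 x)" by (auto simp: v1_def v2_def)
    define S where "S = cball x0 (e / 2) \<union> closure \<Omega>"
    have S: "compact S" unfolding S_def using \<Omega>(2) by (intro compact_Un compact_closure[THEN iffD2]) auto
    have uS: "integrable lborel (\<lambda>x. ?f x + v x) \<and> (AE x in lborel. x \<notin> S \<longrightarrow> ?f x + v x = 0)"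
      if v: "integrable lborel v" "AE x in lborel. x \<notin> \<Omega> \<longrightarrow> v x = 0" for v
    proof
      show "integrable lborel (\<lambda>x. ?f x + v x)" using fD(2) v(1) by (rule Bochner_Integration.integrable_add)
      show "AE x in lborel. x \<notin> S \<longrightarrow> ?f x + v x = 0"
        using fD(3) v(2)
      proof eventually_elim
        case (elim x)
        show ?case using elim ball_subset_cball[of x0 "e/2"] closure_subset[of \<Omega>] unfolding S_def by auto
      qed
    qed
    have uS1: "integrable lborel u1" "AE x in lborel. x \<notin> S \<longrightarrow> u1 x = 0" using uS[OF v1(1,2)] unfolding u1_eq by blast+
    have uS2: "integrable lborel u2" "AE x in lborel. x \<notin> S \<longrightarrow> u2 x = 0" using uS[OF v2(1,2)] unfolding u2_eq by blast+
    let ?D = "\<lambda>y. potential s a1 u1 y - potential s a2 u2 y"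
    have W2S: "W2 \<inter> S = {}"
    proof -
      have "cball x0 (e / 2) \<subseteq> cball x0 (3 * d)" using e by (intro subset_cball) simp
      then show ?thesis using d(2) W12 W2G Gsub unfolding S_def by blast
    qed
    have zero: "?D y1 = 0" if y1: "y1 \<in> W2" for y1
    proof -
      have "cball x0 (e / 2) \<subseteq> cball x0 (3 * d)" using e by (intro subset_cball) simp
      then have "cball x0 (e / 2) \<subseteq> W1" using d(2) by blast
      then have fT: "?f \<in> sobolev_tilde s W1" by (intro test_functions_sobolev_tilde[OF s fD(1)])
      have "energy s a1 u1 g = energy s a2 u2 g" if "g \<in> test_functions W2" for g
      proof -
        have gT: "g \<in> sobolev_tilde s W2" by (rule test_functions_sobolev_tilde[OF s that])
        have "DN_map s a1 \<Omega> W1 W2 ?f g = DN_map s a2 \<Omega> W1 W2 ?f g" using assms(17) fT by simp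
        then show ?thesis using fT gT by (simp add: DN_map_def u1_def u2_def)
      qed
      from energy_determines_potential[OF s(1) a1 a2 S uS1 uS2 assms(11) W2S this y1]
      show ?thesis by simp
    qed
    (* The datum lives in the closed ball of radius e / 2, so the larger open ball of radius e can be
       removed from G: this leaves y in place, and in dimension at least 2 a connected set. *)
    have Dy: "?D y = 0"
    proof (rule line_analytic_identity[of "G - ball x0 e" ?D W2])
      have eW: "cball x0 e \<subseteq> W1" using d(2) e(2) subset_cball[of e "3 * d" x0] d(1) by auto
      show "connected (G - ball x0 e)"
        using Gc eW W1G assms(3) by (intro connected_diff_ball) auto
      show "W2 \<subseteq> G - ball x0 e" using W2G W12 eW ball_subset_cball[of x0 e] by blast
      show "y \<in> G - ball x0 e"
      proof
        have "y \<in> cball x0 (3 * d)" using y(2) d(1) by simp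
        then show "y \<in> G" using d(2) W1G by blast
        show "y \<notin> ball x0 e" using e(3) by simp
      qed
      fix z assume z: "z \<in> G - ball x0 e"
      have "z \<notin> cball x0 (e / 2)" using z e(1) by auto
      then have zS: "z \<notin> S" using z Gsub unfolding S_def by blast
      show "line_analytic_at ?D z"
        unfolding potential_def
        by (intro line_analytic_at_diff kernel_potential_line_analytic[OF an1 uS1(1) S uS1(2) zS] kernel_potential_line_analytic[OF an2 uS2(1) S uS2(2) zS])
    qed (use assms(11,12) zero in auto)
    have ry: "norm (y - x) \<ge> d" if "x \<in> \<Omega>" for x
      using far[OF that] y(2) dist_triangle[of x0 x y] by (simp add: dist_norm)
    have ry2: "norm (y - x) \<ge> min d (e / 2)" if "x \<in> ball x0 (e / 2) \<union> \<Omega>" for x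
    proof (cases "x \<in> \<Omega>")
      case False
      then have "dist x0 x < e / 2" using that by simp
      then have "dist y x \<ge> e / 2" using e(3) dist_triangle[of x0 y x] by (simp add: dist_commute)
      then show ?thesis by (simp add: dist_norm)
    next
      case True
      then show ?thesis by (rule min.coboundedI1[OF ry])
    qed
    have mn: "min d (e / 2) > 0" using d(1) e(1) by simp
    have p1: "potential s a1 u1 y = potential s a1 ?f y + potential s a1 v1 y"
      by (rule solution_decomposition_potential[OF s(1) an1 f v1(1,2) u1_eq mn ry2])
    have p2: "potential s a2 u2 y = potential s a2 ?f y + potential s a2 v2 y"
      by (rule solution_decomposition_potential[OF s(1) an2 f v2(1,2) u2_eq mn ry2])
    have "norm (potential s a1 v1 y) \<le> M1 * (LINT x|lborel. norm (v1 x))"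
      by (intro potential_bound(2)[OF kernel_measurable[OF an1] v1(1,2)] M1(2) ry)
    then have b1: "norm (potential s a1 v1 y) \<le> M1 * C1" using mult_left_mono[OF v1(3) M1(1)] by linarith
    have "norm (potential s a2 v2 y) \<le> M2 * (LINT x|lborel. norm (v2 x))"
      by (intro potential_bound(2)[OF kernel_measurable[OF an2] v2(1,2)] M2(2) ry)
    then have b2: "norm (potential s a2 v2 y) \<le> M2 * C2" using mult_left_mono[OF v2(3) M2(1)] by linarith
    have avg: "norm (potential s a ?f y - complex_of_real (kernel s a (y - x0))) \<le> 1"
      if k: "kernel s a \<in> borel_measurable borel" and \<delta>a: "\<And>x. dist x (y - x0) < \<delta> \<Longrightarrow> dist (kernel s a x) (kernel s a (y - x0)) < 1" "e \<le> \<delta>" for a \<delta>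
    proof -
      have [measurable]: "kernel s a \<in> borel_measurable borel" by (rule k)
      have "norm ((LINT x|lborel. ?f x * complex_of_real (kernel s a (y - x))) - complex_of_real (kernel s a (y - x0))) \<le> 1"
      proof (rule unit_bump_average[OF f])
        fix x assume "x \<in> ball x0 (e / 2)"
        then have "dist (y - x) (y - x0) < \<delta>" using \<delta>a(2) e(1) by (simp add: dist_norm norm_minus_commute)
        from \<delta>a(1)[OF this] show "norm (complex_of_real (kernel s a (y - x)) - complex_of_real (kernel s a (y - x0))) \<le> 1"
          by (simp add: dist_norm flip: of_real_diff)
      qed measurable
      then show ?thesis by (simp add: potential_def mult.commute)
    qed
    have c1: "norm (potential s a1 ?f y - complex_of_real (kernel s a1 (y - x0))) \<le> 1" by (rule avg[OF kernel_measurable[OF an1] \<delta>(2) e(4)])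
    have c2: "norm (potential s a2 ?f y - complex_of_real (kernel s a2 (y - x0))) \<le> 1" by (rule avg[OF kernel_measurable[OF an2] \<delta>(4) e(5)])
    let ?k1 = "complex_of_real (kernel s a1 (y - x0))" and ?k2 = "complex_of_real (kernel s a2 (y - x0))"
    have "?k1 - ?k2 = - (potential s a1 ?f y - ?k1) + (potential s a2 ?f y - ?k2) - potential s a1 v1 y + potential s a2 v2 y"
      using Dy unfolding p1 p2 by (simp add: algebra_simps)
    also have "norm \<dots> \<le> norm (potential s a1 ?f y - ?k1) + norm (potential s a2 ?f y - ?k2) + norm (potential s a1 v1 y) + norm (potential s a2 v2 y)"
      by (intro order_trans[OF norm_triangle_ineq] order_trans[OF norm_triangle_ineq4] add_mono order_refl) (simp_all only: norm_minus_cancel order_refl)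
    also have "\<dots> \<le> C" using c1 c2 b1 b2 by (simp add: C_def)
    finally show ?thesis by (simp flip: of_real_diff)
  qed
  (* Along the ray in the direction of theta the bound holds for a1 - a2 times r powr - (n + 2 s). *)
  have lim: "((\<lambda>r. C * r powr (real CARD('n) + 2 * s)) \<longlongrightarrow> C * 0 powr (real CARD('n) + 2 * s)) (at_right 0)"
    using s(1) by (intro tendsto_intros) (auto intro: eventually_mono[OF eventually_at_right_less[of 0]] add_nonneg_pos)
  have bound: "\<bar>a1 \<theta> - a2 \<theta>\<bar> \<le> C * r powr (real CARD('n) + 2 * s)" if r: "0 < r" "r < 2 * d" for r
  proof -
    let ?y = "x0 + r *\<^sub>R \<theta>"
    have "r *\<^sub>R \<theta> \<noteq> 0" using r \<theta> by auto
    then have "\<bar>kernel s a1 (?y - x0) - kernel s a2 (?y - x0)\<bar> \<le> C" using r \<theta> by (intro key) (auto simp: dist_norm)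
    moreover have "kernel s a (?y - x0) = a \<theta> * r powr (- (real CARD('n) + 2 * s))" for a
      using r \<theta> by (simp add: kernel_def)
    ultimately have "\<bar>a1 \<theta> - a2 \<theta>\<bar> * r powr (- (real CARD('n) + 2 * s)) \<le> C"
      by (simp add: left_diff_distrib[symmetric] abs_mult)
    then have "\<bar>a1 \<theta> - a2 \<theta>\<bar> * r powr (- (real CARD('n) + 2 * s)) * r powr (real CARD('n) + 2 * s) \<le> C * r powr (real CARD('n) + 2 * s)"
      by (rule mult_right_mono) simp
    then show ?thesis using r by (simp add: mult.assoc powr_add[symmetric])
  qed
  have "\<bar>a1 \<theta> - a2 \<theta>\<bar> \<le> C * 0 powr (real CARD('n) + 2 * s)"
  proof (rule tendsto_lowerbound[OF lim])
    show "\<forall>\<^sub>F r in at_right 0. \<bar>a1 \<theta> - a2 \<theta>\<bar> \<le> C * r powr (real CARD('n) + 2 * s)"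
      unfolding eventually_at_right_field using bound d(1) by (intro exI[of _ "2 * d"]) auto
  qed simp
  then show "a1 \<theta> = a2 \<theta>" by simp
qed

end
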